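(* Let $H_0=\sqrt{-\Delta}$ in $L^2(\mathbb{R}^3)$ with domain $H^1(\mathbb{R}^3)$. If $z\in\mathbb{C}\setminus[0,+\infty)$, then for all $u\in C_0^\infty(\mathbb{R}^3)$, $$(H_0-z)^{-1}u=G_zu,\qquad G_zu(x)=\int_{\mathbb{R}^3}g_z(x-y)\,u(y)\,dy,$$ where $$g_z(x)=\frac{1}{2\pi^2|x|^2}+\frac{z}{2\pi^2|x|}\big[\sin(z|x|)\,\mathrm{ci}(-z|x|)-\cos(z|x|)\,\mathrm{si}(-z|x|)\big].$$
   Context: $\sqrt{-\Delta}$ is the Fourier multiplier by $|\xi|$, a self-adjoint operator in $L^2(\mathbb{R}^3)$ with domain $H^1(\mathbb{R}^3)$ and spectrum $[0,\infty)$. The functions $\mathrm{ci}$ and $\mathrm{si}$ are the analytic continuations of $\mathrm{ci}(\rho)=\int_\rho^{+\infty}\frac{\cos t}{t}dt$ and $\mathrm{si}(\rho)=-\int_\rho^{+\infty}\frac{\sin t}{t}dt$ ($\rho>0$), explicitly $$\mathrm{ci}(w)=-\gamma-\mathrm{Log}\,w-\sum_{m=1}^\infty\frac{(-1)^m}{(2m)!\,2m}w^{2m},\quad w\in\mathbb{C}\setminus(-\infty,0],$$ with $\gamma$ Euler's constant and $\mathrm{Log}$ the principal branch ($|\mathrm{Im}\,\mathrm{Log}\,w|<\pi$), and $$\mathrm{si}(w)=-\frac{\pi}{2}+\sum_{m=0}^\infty\frac{(-1)^m}{(2m+1)!\,(2m+1)}w^{2m+1},\quad w\in\mathbb{C}.$$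 *)

theory Defs
  imports "HOL-Analysis.Analysis"
begin

(* Elements of the Hilbert space of square-integrable functions are represented by Borel
   functions; the represented vector is the class L2_class f. *)

definition L2 :: "(real^3 \<Rightarrow> complex) set" where
  "L2 = {f \<in> borel_measurable lborel. integrable lborel (\<lambda>x. (cmod (f x))\<^sup>2)}"

definition L2_class :: "(real^3 \<Rightarrow> complex) \<Rightarrow> (real^3 \<Rightarrow> complex) set" where
  "L2_class f = {h \<in> L2. AE x in lborel. h x = f x}"

(* The squared distance is an extended nonnegative integral, so that convergence can not
   hold because a Bochner integral defaults to 0. *)
definition L2_tendsto :: "(nat \<Rightarrow> real^3 \<Rightarrow> complex) \<Rightarrow> (real^3 \<Rightarrow> complex) \<Rightarrow> bool" where
  "L2_tendsto fs f \<longleftrightarrow>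
     (\<lambda>n. \<integral>\<^sup>+ x. ennreal ((cmod (fs n x - f x))\<^sup>2) \<partial>lborel) \<longlonglongrightarrow> 0"

definition fourier_L1 :: "(real^3 \<Rightarrow> complex) \<Rightarrow> real^3 \<Rightarrow> complex" where
  "fourier_L1 f \<xi> = of_real ((2 * pi) powr (- 3 / 2)) *
     (LINT x|lborel. exp (- (\<i> * of_real (\<xi> \<bullet> x))) * f x)"

(* Graph of the Fourier transform on L2: the closure in L2 \<times> L2 of the graph of the integral
   transform on L1 \<inter> L2, i.e. the continuous extension provided by Plancherel's theorem. *)
definition fourier_L2 :: "(real^3 \<Rightarrow> complex) \<Rightarrow> (real^3 \<Rightarrow> complex) \<Rightarrow> bool" where
  "fourier_L2 f F \<longleftrightarrow> f \<in> L2 \<and> F \<in> L2 \<and>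
     (\<exists>fs. (\<forall>n. integrable lborel (fs n) \<and> fs n \<in> L2) \<and>
           L2_tendsto fs f \<and> L2_tendsto (\<lambda>n. fourier_L1 (fs n)) F)"

definition sobolev_H1 :: "(real^3 \<Rightarrow> complex) set" where
  "sobolev_H1 = {f \<in> L2. \<exists>F. fourier_L2 f F \<and>
     (\<lambda>\<xi>. of_real (sqrt (1 + (norm \<xi>)\<^sup>2)) * F \<xi>) \<in> L2}"

(* Operators in L2 are given by their graphs, which contain all representatives. *)

type_synonym L2_operator = "((real^3 \<Rightarrow> complex) \<times> (real^3 \<Rightarrow> complex)) set"

definition fourier_multiplier :: "(real^3 \<Rightarrow> complex) \<Rightarrow> L2_operator" where
  "fourier_multiplier m = {(f, h). \<exists>F. fourier_L2 f F \<and> fourier_L2 h (\<lambda>\<xi>. m \<xi> * F \<xi>)}"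

definition H0 :: L2_operator where
  "H0 = {(f, h) \<in> fourier_multiplier (\<lambda>\<xi>. of_real (norm \<xi>)). f \<in> sobolev_H1}"

definition minus_scalar :: "L2_operator \<Rightarrow> complex \<Rightarrow> L2_operator" where
  "minus_scalar A z = {(f, \<lambda>x. h x - z * f x) | f h. (f, h) \<in> A}"

primrec C_k :: "nat \<Rightarrow> (real^3 \<Rightarrow> complex) \<Rightarrow> bool" where
  "C_k 0 f \<longleftrightarrow> continuous_on UNIV f"
| "C_k (Suc k) f \<longleftrightarrow> (\<forall>x. f differentiable (at x)) \<and>
     (\<forall>i. C_k k (\<lambda>x. frechet_derivative f (at x) (axis i 1)))"

definition Cc_infinity :: "(real^3 \<Rightarrow> complex) set" where
  "Cc_infinity = {u. (\<forall>k. C_k k u) \<and> compact (closure {x. u x \<noteq> 0})}"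

(* Meaningful for w outside the half-line of nonpositive reals. *)
definition ci :: "complex \<Rightarrow> complex" where
  "ci w = - euler_mascheroni - Ln w
     - (\<Sum>m. (-1) ^ Suc m / (fact (2 * Suc m) * of_nat (2 * Suc m)) * w ^ (2 * Suc m))"

definition si :: "complex \<Rightarrow> complex" where
  "si w = - of_real pi / 2
     + (\<Sum>m. (-1) ^ m / (fact (2 * m + 1) * of_nat (2 * m + 1)) * w ^ (2 * m + 1))"

definition g :: "complex \<Rightarrow> real^3 \<Rightarrow> complex" where
  "g z x = (let r = complex_of_real (norm x) in
     1 / (2 * of_real pi ^ 2 * r ^ 2)
     + z / (2 * of_real pi ^ 2 * r) * (sin (z * r) * ci (- z * r) - cos (z * r) * si (- z * r)))"

definition G :: "complex \<Rightarrow> (real^3 \<Rightarrow> complex) \<Rightarrow> real^3 \<Rightarrow> complex" where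
  "G z u x = (LINT y|lborel. g z (x - y) * u y)"

end

theory Submission
  imports Defs "HOL-Probability.Probability" "HOL-Complex_Analysis.Complex_Analysis" "HOL-Real_Asymp.Real_Asymp"
begin

text \<open>
  Write \<open>z = - p\<^sup>2\<close> with \<open>Re p > 0\<close>. The differential equation of the exponential integral, together with
  \<open>\<integral> ln t exp (- t) dt = - \<gamma>\<close>, gives
  \<open>g z x = (1 / (\<pi>\<^sup>2 r\<^sup>2)) \<integral> exp (- p r s) p\<^sup>2 s / (p\<^sup>2 + s\<^sup>2)\<^sup>2 ds\<close> with \<open>r = norm x\<close>. For \<open>p > 0\<close> this is the Laplace
  transform in \<open>t\<close> of the Poisson kernel, whose Fourier transform is \<open>exp (- t (norm \<xi>))\<close> by subordination to
  Gaussians; hence \<open>g z\<close> is integrable with Fourier transform \<open>1 / (norm \<xi> - z)\<close>, and both facts extend to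
  \<open>Re p > 0\<close> by domination and analytic continuation. So \<open>G z u\<close> solves the equation on the Fourier side.
  Uniqueness needs only that the graph of the Fourier transform on square-integrable functions is that of an
  injective function: single-valuedness follows from the Plancherel inequality, injectivity from testing against
  Gaussians.
\<close>

section \<open>Holomorphic dependence on a parameter\<close>

text \<open>Each of the two summands of \<open>g z\<close> decays only like \<open>r^-2\<close>,
  which is not integrable at infinity in three dimensions. Their sum becomes a single Laplace
  integral whose density vanishes at \<open>s = 0\<close>, and there the cancellation is visible.
  The parameter \<open>p\<close> is used because squaring maps the half-plane
  \<open>Re p > 0\<close> onto the plane without the nonpositive reals: \<open>- p^2\<close> runs
  through the whole complement of the spectrum, while \<open>exp (- p r s)\<close> keeps decaying
  and the poles \<open>s = \<plusminus> i p\<close> stay off the ray of integration. For real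
  \<open>p\<close> the density is positive, so interchanging integrals there reduces to finiteness
  of total masses, and the same positive kernel at a smaller real parameter dominates the complex
  ones. Holomorphy in \<open>p\<close> then follows from bounds on the integrands alone. The
  operators are relations between representatives, so the resolvent identity is an equality of sets
  of functions. One inclusion rests on the Fourier graph being single-valued and injective, the
  other on \<open>G z u\<close> lying in the domain, which comes from the growth of
  \<open>norm \<xi> - z\<close>.\<close>

text \<open>Cauchy's inequality on circles of radius \<open>R/4\<close> around points of the half
  ball, which stay inside the ball, bounds the derivative by \<open>4 * B / R\<close>. A bound on
  \<open>f\<close> thus controls its difference quotients.\<close>

lemma holomorphic_Lipschitz_half_ball:
  assumes hol: "f holomorphic_on ball p R" and "0 < R"
    and bound: "\<And>q. q \<in> ball p R \<Longrightarrow> norm (f q) \<le> B"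
    and q: "q \<in> ball p (R/2)"
  shows "norm (f q - f p) \<le> 4 * B / R * norm (q - p)"
proof (rule field_differentiable_bound)
  show "convex (ball p (R/2))" by simp
  fix w assume w: "w \<in> ball p (R/2)"
  have sub: "cball w (R/4) \<subseteq> ball p R" 
  proof
    fix y assume "y \<in> cball w (R/4)"
    then have "dist p y < R/2 + R/4" using w dist_triangle[of p y w] by (simp add: dist_commute)
    then show "y \<in> ball p R" using \<open>0 < R\<close> by simp
  qed
  have "w \<in> ball p R" using w \<open>0 < R\<close> by simp
  with hol show "(f has_field_derivative deriv f w) (at w within ball p (R/2))"
    by (meson DERIV_subset holomorphic_derivI open_ball top_greatest)
  have "norm ((deriv ^^ 1) f w) \<le> fact 1 * B / (R/4)^1"
  proof (rule Cauchy_inequality)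
    show "f holomorphic_on ball w (R/4)" 
      by (rule holomorphic_on_subset[OF hol]) (use sub ball_subset_cball in blast)
    show "continuous_on (cball w (R/4)) f"
      by (rule holomorphic_on_imp_continuous_on[OF holomorphic_on_subset[OF hol sub]])
    show "0 < R/4" using \<open>0 < R\<close> by simp
    fix x assume "norm (w - x) = R/4" 
    then show "norm (f x) \<le> B" by (intro bound subsetD[OF sub]) (simp add: dist_norm)
  qed
  then show "norm (deriv f w) \<le> 4 * B / R" by (simp add: mult.commute)
qed (use q \<open>0 < R\<close> in auto)

text \<open>Dominated convergence of the difference quotients along sequences tending to
  \<open>p\<close>. Their majorant \<open>4 * B x / R\<close> is obtained from the majorant of
  \<open>F\<close> itself, so derivatives in the parameter never have to be estimated.\<close>

lemma
  fixes F :: "complex \<Rightarrow> 'a \<Rightarrow> complex"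
  assumes "0 < R" 
    and hol: "\<And>x. x \<in> space M \<Longrightarrow> (\<lambda>q. F q x) holomorphic_on ball p R"
    and meas: "\<And>q. q \<in> ball p R \<Longrightarrow> F q \<in> borel_measurable M"
    and bound: "\<And>q x. q \<in> ball p R \<Longrightarrow> x \<in> space M \<Longrightarrow> norm (F q x) \<le> B x"
    and B: "integrable M B"
  shows has_field_derivative_integral:
      "((\<lambda>q. \<integral>x. F q x \<partial>M) has_field_derivative (\<integral>x. deriv (\<lambda>q. F q x) p \<partial>M)) (at p)"
    and integrable_deriv: "integrable M (\<lambda>x. deriv (\<lambda>q. F q x) p)"
proof -
  define D where "D X i x = (F (X i) x - F p x) / (X i - p)" for X :: "nat \<Rightarrow> complex" and i x
  have int: "integrable M (F q)" if "q \<in> ball p R" for q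
    by (rule Bochner_Integration.integrable_bound[OF B meas[OF that]])
      (use bound[OF that] in \<open>force intro!: AE_I2\<close>)
  have key: "integrable M (\<lambda>x. deriv (\<lambda>q. F q x) p) \<and> 
       (\<lambda>i. \<integral>x. D X i x \<partial>M) \<longlonglongrightarrow> (\<integral>x. deriv (\<lambda>q. F q x) p \<partial>M)"
    if X: "\<And>i. X i \<noteq> p" "\<And>i. X i \<in> ball p (R/2)" "X \<longlonglongrightarrow> p" for X
  proof -
    have XR: "X i \<in> ball p R" for i using X(2)[of i] \<open>0<R\<close> by simp
    have lim: "(\<lambda>i. D X i x) \<longlonglongrightarrow> deriv (\<lambda>q. F q x) p" if "x \<in> space M" for x
    proof -
      have "((\<lambda>q. F q x) has_field_derivative deriv (\<lambda>q. F q x) p) (at p)"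
        using hol[OF that] \<open>0<R\<close> by (intro holomorphic_derivI[of _ "ball p R"]) auto
      then have "((\<lambda>y. (F y x - F p x) / (y - p)) \<longlongrightarrow> deriv (\<lambda>q. F q x) p) (at p)"
        by (simp add: has_field_derivative_iff)
      then show ?thesis unfolding D_def
        by (rule filterlim_compose) (use X in \<open>auto simp: filterlim_at\<close>)
    qed
    have D[measurable]: "D X i \<in> borel_measurable M" for i
      unfolding D_def using meas[OF XR[of i]] meas[of p] \<open>0<R\<close> by auto
    have m[measurable]: "(\<lambda>x. deriv (\<lambda>q. F q x) p) \<in> borel_measurable M"
      by (rule borel_measurable_LIMSEQ_metric[OF D lim])
    have w: "integrable M (\<lambda>x. 4 * B x / R)" using B by simp
    have b: "AE x in M. norm (D X i x) \<le> 4 * B x / R" for i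
    proof (rule AE_I2)
      fix x assume x: "x \<in> space M"
      have "norm (F (X i) x - F p x) \<le> 4 * B x / R * norm (X i - p)"
        by (rule holomorphic_Lipschitz_half_ball[OF hol[OF x]]) (use \<open>0<R\<close> bound x X in auto)
      then show "norm (D X i x) \<le> 4 * B x / R"
        using X(1)[of i] by (simp add: D_def norm_divide field_simps)
    qed
    have L: "AE x in M. (\<lambda>i. D X i x) \<longlonglongrightarrow> deriv (\<lambda>q. F q x) p"
      using lim by auto
    show ?thesis
      using integral_dominated_convergence[OF m D w L b] integrable_dominated_convergence[OF m D w L b]
      by auto
  qed
  \<comment> \<open>Integrability of the derivative is part of the dominated convergence statement,
    so one explicit sequence inside the half ball is enough for it.\<close>
  define X0 where "X0 i = p + of_real (R / 4 / Suc i)" for i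
  have "(\<lambda>i. R / 4 * inverse (real (Suc i))) \<longlonglongrightarrow> R / 4 * 0" 
    by (intro tendsto_intros LIMSEQ_inverse_real_of_nat)
  then have "X0 \<longlonglongrightarrow> p + of_real 0"
    unfolding X0_def by (intro tendsto_intros) (simp add: field_simps)
  moreover have "X0 i \<in> ball p (R/2)" for i
  proof -
    have "dist p (X0 i) = \<bar>R / 4 / real (Suc i)\<bar>"
      unfolding X0_def dist_norm by (simp only: norm_minus_commute[of p] add_diff_cancel_left' norm_of_real)
    also have "\<dots> \<le> R / 4" using \<open>0<R\<close> by (simp add: divide_simps)
    finally show ?thesis using \<open>0<R\<close> by simp
  qed
  moreover have "X0 i \<noteq> p" for i
  proof -
    have "complex_of_real (R / 4 / Suc i) \<noteq> 0"
      unfolding of_real_eq_0_iff using \<open>0<R\<close> by simp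
    then show ?thesis by (simp add: X0_def)
  qed
  ultimately show "integrable M (\<lambda>x. deriv (\<lambda>q. F q x) p)" using key[of X0] by simp
  show "((\<lambda>q. \<integral>x. F q x \<partial>M) has_field_derivative (\<integral>x. deriv (\<lambda>q. F q x) p \<partial>M)) (at p)"
    unfolding has_field_derivative_iff tendsto_at_iff_sequentially
  proof (intro allI impI)
    fix X assume X0: "\<forall>i. X i \<in> UNIV - {p}" and X1: "X \<longlonglongrightarrow> p"
    \<comment> \<open>Dropping \<open>N\<close> terms puts the whole sequence into the half ball, as
      \<open>key\<close> demands, and leaves the limit unchanged.\<close>
    from X1 have "\<forall>\<^sub>F i in sequentially. X i \<in> ball p (R/2)"
      using \<open>0<R\<close> by (intro topological_tendstoD) auto
    then obtain N where N: "\<And>i. i \<ge> N \<Longrightarrow> X i \<in> ball p (R/2)"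
      by (auto simp: eventually_sequentially)
    have "(\<lambda>i. \<integral>x. D (\<lambda>i. X (i + N)) i x \<partial>M) \<longlonglongrightarrow> (\<integral>x. deriv (\<lambda>q. F q x) p \<partial>M)"
      using key[of "\<lambda>i. X (i + N)"] X0 N LIMSEQ_ignore_initial_segment[OF X1] by auto
    also have "(\<lambda>i. \<integral>x. D (\<lambda>i. X (i + N)) i x \<partial>M) = 
        (\<lambda>i. (integral\<^sup>L M (F (X (i+N))) - integral\<^sup>L M (F p)) / (X (i+N) - p))"
    proof
      fix i
      have "X (i+N) \<in> ball p R" using N[of "i+N"] \<open>0<R\<close> by auto
      then show "(\<integral>x. D (\<lambda>i. X (i + N)) i x \<partial>M) = (integral\<^sup>L M (F (X (i+N))) - integral\<^sup>L M (F p)) / (X (i+N) - p)"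
        using int \<open>0<R\<close> by (simp add: D_def)
    qed
    finally show "((\<lambda>y. (integral\<^sup>L M (F y) - integral\<^sup>L M (F p)) / (y - p)) \<circ> X) \<longlonglongrightarrow> (\<integral>x. deriv (\<lambda>q. F q x) p \<partial>M)"
      unfolding o_def by (rule LIMSEQ_offset[where k = N])
  qed
qed

text \<open>Multiplication by the indicator of \<open>S\<close> makes the integrand constantly 0 in
  the parameter off \<open>S\<close>, so all pointwise conditions concern \<open>S\<close>. The
  derivative is passed as \<open>F'\<close> so that the result appears in closed form.\<close>

lemma
  fixes F :: "complex \<Rightarrow> 'a \<Rightarrow> complex"
  assumes "0 < R" and S: "S \<in> sets M"
    and hol: "\<And>x. x \<in> S \<Longrightarrow> (\<lambda>q. F q x) holomorphic_on ball p R"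
    and meas: "\<And>q. q \<in> ball p R \<Longrightarrow> set_borel_measurable M S (F q)"
    and bound: "\<And>q x. q \<in> ball p R \<Longrightarrow> x \<in> S \<Longrightarrow> norm (F q x) \<le> B x"
    and B: "set_integrable M S B"
    and F': "\<And>x. x \<in> S \<Longrightarrow> ((\<lambda>q. F q x) has_field_derivative F' x) (at p)"
  shows has_field_derivative_set_integral:
      "((\<lambda>q. LINT x:S|M. F q x) has_field_derivative (LINT x:S|M. F' x)) (at p)"
    and set_integrable_deriv: "set_integrable M S F'"
proof -
  have hol': "(\<lambda>q. indicator S x *\<^sub>R F q x) holomorphic_on ball p R" for x
    using hol[of x] by (cases "x \<in> S") auto
  have bound': "norm (indicator S x *\<^sub>R F q x) \<le> indicator S x *\<^sub>R B x" if "q \<in> ball p R" for q x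
    using bound[OF that, of x] by (cases "x \<in> S") auto
  have d: "deriv (\<lambda>q. indicator S x *\<^sub>R F q x) p = indicator S x *\<^sub>R F' x" for x
    using F'[of x] by (cases "x \<in> S") (auto intro!: DERIV_imp_deriv)
  note * = \<open>0<R\<close> hol' meas[unfolded set_borel_measurable_def] bound' B[unfolded set_integrable_def]
  show "((\<lambda>q. LINT x:S|M. F q x) has_field_derivative (LINT x:S|M. F' x)) (at p)"
    using has_field_derivative_integral[OF *] by (simp add: d set_lebesgue_integral_def)
  show "set_integrable M S F'"
    using integrable_deriv[OF *] by (simp add: d set_integrable_def)
qed

text \<open>The identity theorem: the half-plane is connected and the positive reals accumulate at 1
  inside it. It carries formulas for real \<open>p\<close> over to complex \<open>p\<close>.\<close>

lemma half_plane_identity: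
  assumes "f holomorphic_on {p. 0 < Re p}" "h holomorphic_on {p. 0 < Re p}"
    and eq: "\<And>x::real. 0 < x \<Longrightarrow> f (of_real x) = h (of_real x)" and p: "0 < Re p"
  shows "f p = h p"
proof -
  let ?H = "{p. 0 < Re p}"
  have "f p - h p = 0"
  proof (rule analytic_continuation[where f = "\<lambda>p. f p - h p" and U = "of_real ` {0<..}" and \<xi> = 1 and S = ?H])
    show "open ?H" by (rule open_halfspace_Re_gt)
    show "connected ?H" by (rule convex_connected[OF convex_halfspace_Re_gt])
    show "(1::complex) islimpt of_real ` {0<..}"
      unfolding islimpt_sequential
    proof (intro exI conjI allI)
      show "complex_of_real (1 + inverse (real (Suc n))) \<in> complex_of_real ` {0<..} - {1}" for n
      proof -
        have "0 < 1 + inverse (real (Suc n))" "1 + inverse (real (Suc n)) \<noteq> 1" by (auto simp: add_pos_pos)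
        then show ?thesis unfolding Diff_iff singleton_iff of_real_eq_1_iff by blast
      qed
      have "(\<lambda>n. complex_of_real (1 + inverse (real (Suc n)))) \<longlonglongrightarrow> of_real (1 + 0)"
        by (intro tendsto_intros LIMSEQ_inverse_real_of_nat)
      then show "(\<lambda>n. complex_of_real (1 + inverse (real (Suc n)))) \<longlonglongrightarrow> 1" by simp
    qed
  qed (use assms eq in \<open>auto intro!: holomorphic_intros\<close>)
  then show ?thesis by simp
qed

section \<open>The fundamental theorem on a half-line, and differentiation of lacunary power
  series\<close>

lemma set_integral_FTC_atLeast:
  fixes F :: "real \<Rightarrow> 'a::euclidean_space"
  assumes F: "\<And>x. a \<le> x \<Longrightarrow> (F has_vector_derivative f x) (at x within {a..})"
    and cont: "continuous_on {a..} f"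
    and int: "set_integrable lborel {a..} f" and lim: "(F \<longlongrightarrow> L) at_top"
  shows "(LINT x:{a..}|lborel. f x) = L - F a"
proof -
  have eq: "(LINT x:{a..a + real n}|lborel. f x) = F (a + real n) - F a" for n
    unfolding set_lebesgue_integral_def
  proof (rule integral_FTC_Icc)
    show "continuous_on {a..a + real n} f" by (rule continuous_on_subset[OF cont]) auto
    fix x assume "a \<le> x"
    from F[OF this] show "(F has_vector_derivative f x) (at x within {a..a + real n})"
      by (rule has_vector_derivative_within_subset) auto
  qed simp
  have un: "(\<Union>n. {a..a + real n}) = {a..}"
  proof (intro equalityI subsetI)
    fix x assume "x \<in> {a..}"
    moreover obtain n where "x - a \<le> real n" using real_arch_simple by blast
    ultimately show "x \<in> (\<Union>n. {a..a + real n})" by (auto simp: algebra_simps intro!: exI[of _ n])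
  qed auto
  have "(\<lambda>n. LINT x:{a..a + real n}|lborel. f x) \<longlonglongrightarrow> (LINT x:(\<Union>n. {a..a + real n})|lborel. f x)"
    by (rule set_integral_cont_up) (auto simp: incseq_def un int)
  also note un
  finally have "(\<lambda>n. F (a + real n) - F a) \<longlonglongrightarrow> (LINT x:{a..}|lborel. f x)" by (simp only: eq)
  moreover have "(\<lambda>n. F (a + real n) - F a) \<longlonglongrightarrow> L - F a"
    by (intro tendsto_intros filterlim_compose[OF lim]
        filterlim_tendsto_add_at_top[OF tendsto_const] filterlim_real_sequentially)
  ultimately show ?thesis by (rule LIMSEQ_unique)
qed

lemma complex_cos_paired: "(\<lambda>n. (- 1) ^ n / fact (2 * n) * x ^ (2 * n)) sums cos x"
  for x :: complex
proof -
  have "(\<lambda>n. \<Sum>k = n * 2..<n * 2 + 2. of_real (cos_coeff k) * x ^ k) sums cos x"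
    by (rule sums_group) (use cos_converges [of x, unfolded scaleR_conv_of_real] in auto)
  then show ?thesis
    by (simp add: cos_coeff_def ac_simps)
qed

lemma complex_sin_paired: "(\<lambda>n. (- 1) ^ n / fact (2 * n + 1) * x ^ (2 * n + 1)) sums sin x"
  for x :: complex
proof -
  have "(\<lambda>n. \<Sum>k = n * 2..<n * 2 + 2. of_real (sin_coeff k) * x ^ k) sums sin x"
    by (rule sums_group) (use sin_converges [of x, unfolded scaleR_conv_of_real] in auto)
  then show ?thesis
    by (simp add: sin_coeff_def ac_simps)
qed

text \<open>The coefficients are written \<open>c m / k m\<close> so that the differentiated series
  has the plain coefficients \<open>c m\<close>, below those of sine and cosine. Absolute
  convergence for every radius gives uniform convergence on a ball around \<open>w\<close> by the
  M-test.\<close>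

lemma has_field_derivative_lacunary_series:
  fixes c :: "nat \<Rightarrow> complex"
  assumes k: "\<And>m. 0 < k m" and sum: "\<And>R::real. 0 < R \<Longrightarrow> summable (\<lambda>m. norm (c m) * R ^ (k m - 1))"
  shows "((\<lambda>w. \<Sum>m. c m / of_nat (k m) * w ^ k m) has_field_derivative (\<Sum>m. c m * w ^ (k m - 1))) (at w)"
proof -
  define R where "R = norm w + 1"
  have R: "0 < R" by (simp add: R_def add_nonneg_pos)
  show ?thesis
  proof (rule has_field_derivative_series'(2)[where S = "ball 0 R" and ?x0.0 = 0 and f = "\<lambda>m w. c m / of_nat (k m) * w ^ k m"
        and f' = "\<lambda>m w. c m * w ^ (k m - 1)"])
    show "uniformly_convergent_on (ball 0 R) (\<lambda>n x. \<Sum>i<n. c i * x ^ (k i - 1))"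
    proof (rule Weierstrass_m_test'[OF _ sum[OF R]])
      fix n and x :: complex assume "x \<in> ball 0 R"
      then show "norm (c n * x ^ (k n - 1)) \<le> norm (c n) * R ^ (k n - 1)"
        by (auto simp: norm_mult norm_power intro!: mult_left_mono power_mono)
    qed
    show "((\<lambda>w. c n / of_nat (k n) * w ^ k n) has_field_derivative c n * x ^ (k n - 1)) (at x within ball 0 R)" for n x
      using k[of n] by (auto intro!: derivative_eq_intros)
    show "w \<in> interior (ball 0 R)" by (simp add: R_def)
    show "summable (\<lambda>m. c m / of_nat (k m) * 0 ^ k m)"
      using k by (simp add: zero_power)
  qed (use R in auto)
qed

lemma summable_fact_double: "summable (\<lambda>m. (R::real) ^ (2 * m) / fact (2 * m))"
proof (rule summable_comparison_test')
  show "summable (\<lambda>m. inverse (fact m) * (R\<^sup>2) ^ m)" by (rule summable_exp)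
  fix m :: nat
  have "(fact m :: real) \<le> fact (2 * m)" by (rule fact_mono) auto
  then have "(R\<^sup>2) ^ m / fact (2 * m) \<le> (R\<^sup>2) ^ m / fact m"
    by (intro divide_left_mono) auto
  then show "norm (R ^ (2 * m) / fact (2 * m)) \<le> inverse (fact m) * (R\<^sup>2) ^ m"
    by (simp only: power_mult) (simp add: field_simps)
qed

section \<open>The sine and cosine integrals\<close>

text \<open>The derivative as a power series, rather than as \<open>sin w / w\<close>, makes sense
  at 0 too; continuity of \<open>si\<close> there supplies the limit
  \<open>- pi / 2\<close>.\<close>

lemma has_field_derivative_si_series:
  "(si has_field_derivative (\<Sum>m. (-1) ^ m / fact (2 * m + 1) * w ^ (2 * m))) (at w)"
proof -
  have "((\<lambda>w. \<Sum>m. ((-1) ^ m / fact (2 * m + 1)) / of_nat (2 * m + 1) * w ^ (2 * m + 1)) has_field_derivative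
      (\<Sum>m. (-1) ^ m / fact (2 * m + 1) * w ^ (2 * m + 1 - 1))) (at w)" for w :: complex
  proof (rule has_field_derivative_lacunary_series)
    fix R :: real assume "0 < R"
    show "summable (\<lambda>m. norm ((-1) ^ m / fact (2 * m + 1) :: complex) * R ^ (2 * m + 1 - 1))"
    proof (rule summable_comparison_test'[OF summable_fact_double[of R]])
      fix m :: nat
      have "(fact (2 * m) :: real) \<le> fact (2 * m + 1)" by (rule fact_mono) auto
      then show "norm (norm ((-1) ^ m / fact (2 * m + 1) :: complex) * R ^ (2 * m + 1 - 1)) \<le> R ^ (2 * m) / fact (2 * m)"
        using \<open>0 < R\<close> by (auto simp: norm_divide norm_power divide_simps simp del: fact_Suc)
    qed
  qed simp
  from DERIV_add[OF DERIV_const this, of "- of_real pi / 2" w]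
  show ?thesis
    by (simp add: si_def[abs_def] divide_divide_eq_left' mult.commute del: fact_Suc)
qed

lemma has_field_derivative_si:
  assumes "w \<noteq> 0"
  shows "(si has_field_derivative sin w / w) (at w)"
proof -
  have "(\<lambda>m. (-1) ^ m / fact (2 * m + 1) * w ^ (2 * m + 1) / w) sums (sin w / w)"
    by (intro sums_divide complex_sin_paired)
  then have "(\<Sum>m. (-1) ^ m / fact (2 * m + 1) * w ^ (2 * m)) = sin w / w"
    using assms by (simp add: sums_iff del: fact_Suc)
  then show ?thesis using has_field_derivative_si_series[of w] by simp
qed

lemma si_tendsto_0: "(si \<longlongrightarrow> - of_real pi / 2) (at 0)"
proof -
  have "isCont si 0" by (rule DERIV_isCont[OF has_field_derivative_si_series])
  moreover have "si 0 = - of_real pi / 2" by (simp add: si_def)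
  ultimately show ?thesis by (simp add: isCont_def)
qed

text \<open>The integral of \<open>(cos t - 1) / t\<close> from 0 to \<open>w\<close>: what remains
  of \<open>ci\<close>, up to sign, once the logarithm and Euler's constant are split off.\<close>

definition ci_entire :: "complex \<Rightarrow> complex" where
  "ci_entire w = (\<Sum>m. (-1) ^ Suc m / (fact (2 * Suc m) * of_nat (2 * Suc m)) * w ^ (2 * Suc m))"

lemma ci_eq: "ci w = - euler_mascheroni - Ln w - ci_entire w"
  by (simp add: ci_def ci_entire_def)

lemma has_field_derivative_ci_entire:
  "(ci_entire has_field_derivative (\<Sum>m. (-1) ^ Suc m / fact (2 * Suc m) * w ^ (2 * Suc m - 1))) (at w)"
proof -
  have "((\<lambda>w. \<Sum>m. ((-1) ^ Suc m / fact (2 * Suc m)) / of_nat (2 * Suc m) * w ^ (2 * Suc m)) has_field_derivative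
      (\<Sum>m. (-1) ^ Suc m / fact (2 * Suc m) * w ^ (2 * Suc m - 1))) (at w)"
  proof (rule has_field_derivative_lacunary_series)
    fix R :: real assume "0 < R"
    show "summable (\<lambda>m. norm ((-1) ^ Suc m / fact (2 * Suc m) :: complex) * R ^ (2 * Suc m - 1))"
    proof (rule summable_comparison_test'[OF summable_mult[OF summable_fact_double[of R], of R]])
      fix m :: nat
      have f: "(fact (2 * m) :: real) \<le> fact (2 * Suc m)" by (rule fact_mono) auto
      have "R * R ^ (2 * m) / fact (2 * Suc m) \<le> R * R ^ (2 * m) / fact (2 * m)"
        using \<open>0 < R\<close> f by (intro divide_left_mono) auto
      then show "norm (norm ((-1) ^ Suc m / fact (2 * Suc m) :: complex) * R ^ (2 * Suc m - 1)) \<le> R * (R ^ (2 * m) / fact (2 * m))"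
        using \<open>0 < R\<close> by (auto simp: norm_divide norm_power norm_mult simp del: fact_Suc)
    qed
  qed simp
  then show ?thesis unfolding ci_entire_def[abs_def] by (simp only: divide_divide_eq_left)
qed

lemma ci_entire_0: "ci_entire 0 = 0"
  by (simp add: ci_entire_def)

lemma has_field_derivative_ci:
  assumes "w \<notin> \<real>\<^sub>\<le>\<^sub>0"
  shows "(ci has_field_derivative - cos w / w) (at w)"
proof -
  have [simp]: "w \<noteq> 0" using assms by auto
  have "(\<lambda>m. (- 1) ^ Suc m / fact (2 * Suc m) * w ^ (2 * Suc m)) sums (cos w - 1)"
    using complex_cos_paired[of w] unfolding sums_Suc_iff[of "\<lambda>m. (- 1) ^ m / fact (2 * m) * w ^ (2 * m)"] by simp
  then have "(\<lambda>m. (- 1) ^ Suc m / fact (2 * Suc m) * w ^ (2 * Suc m) / w) sums ((cos w - 1) / w)"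
    by (rule sums_divide)
  then have eq: "(\<Sum>m. (-1) ^ Suc m / fact (2 * Suc m) * w ^ (2 * Suc m - 1)) = (cos w - 1) / w"
    by (simp add: sums_iff del: fact_Suc)
  have "((\<lambda>w. - euler_mascheroni - Ln w - ci_entire w) has_field_derivative 0 - 1 / w - (cos w - 1) / w) (at w)"
    by (rule derivative_eq_intros has_field_derivative_ci_entire[of w, unfolded eq] refl assms)+ (simp add: divide_inverse)
  also have "0 - 1 / w - (cos w - 1) / w = - cos w / w" by (simp add: field_simps)
  finally show ?thesis by (simp only: ci_eq[abs_def])
qed

lemma ci_tendsto_0: "((\<lambda>w. ci w + Ln w) \<longlongrightarrow> - euler_mascheroni) (at 0)"
proof -
  have "isCont ci_entire 0" by (rule DERIV_isCont[OF has_field_derivative_ci_entire])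
  then have "(ci_entire \<longlongrightarrow> 0) (at 0)" by (simp add: isCont_def ci_entire_0)
  then have "((\<lambda>w. - euler_mascheroni - ci_entire w) \<longlongrightarrow> - euler_mascheroni - 0) (at 0)"
    by (intro tendsto_intros)
  then show ?thesis by (simp add: ci_eq)
qed

section \<open>Euler's constant as an integral of the logarithm\<close>

lemma set_integrable_power_exp_atLeast:
  "set_integrable lborel {0..} (\<lambda>t::real. t ^ k * exp (- t))"
  using has_bochner_integral_I0i_power_exp_m'[of k]
  by (auto simp: set_integrable_def has_bochner_integral_iff mult.commute mult.left_commute)

text \<open>The integral of \<open>t powr s * exp (- t)\<close> is \<open>Gamma (s + 1)\<close>;
  differentiating at \<open>s = 0\<close> brings down \<open>ln t\<close> on one side and gives
  \<open>Gamma 1 * Digamma 1\<close> on the other.\<close>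

lemma
  shows set_integrable_ln_exp: "set_integrable lborel {0..} (\<lambda>t. complex_of_real (ln t * exp (- t)))"
    and integral_ln_exp: "(LINT t:{0..}|lborel. complex_of_real (ln t * exp (- t))) = - euler_mascheroni"
proof -
  define F where "F s t = of_real t powr s / of_real (exp t)" for s :: complex and t :: real
  \<comment> \<open>For \<open>\<bar>Re s\<bar> \<le> 1/2\<close> the power
    \<open>t powr Re s\<close> is at most \<open>t powr (- 1/2)\<close> on the unit interval and at
    most \<open>t powr (1/2)\<close> beyond it. The exponents are written \<open>x - 1\<close> so
    that the two terms are Gamma integrals at \<open>1/2\<close> and \<open>3/2\<close>.\<close>
  define B where "B t = t powr (1/2 - 1) / exp t + t powr (3/2 - 1) / exp t" for t :: real
  have B1: "set_integrable lborel {0..} (\<lambda>t. t powr (x - 1) / exp t)" if "0 < x" for x :: real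
  proof -
    have "(\<integral>\<^sup>+t. ennreal (indicator {0..} t * (t powr (x - 1) / exp t)) \<partial>lborel) = Gamma x"
      using Gamma_conv_nn_integral_real[OF that] by simp
    then show ?thesis unfolding set_integrable_def
      by (intro integrableI_nonneg) (auto simp: ennreal_less_top)
  qed
  have B: "set_integrable lborel {0..} B" unfolding B_def by (intro set_integral_add B1) auto
  have m: "set_borel_measurable lborel {0..} (F s)" for s
    unfolding set_borel_measurable_def F_def by measurable
  have bound: "norm (F s t) \<le> B t" if "s \<in> ball 0 (1/2)" "t \<in> {0..}" for s t
  proof (cases "t = 0")
    case False
    with that have t: "0 < t" by simp
    have s: "\<bar>Re s\<bar> \<le> 1/2" using that abs_Re_le_cmod[of s] by simp
    have "t powr Re s \<le> t powr (1/2 - 1) + t powr (3/2 - 1)"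
    proof (cases "t \<le> 1")
      case True
      have "t powr Re s \<le> t powr (1/2 - 1)"
        using t True s by (intro powr_mono') auto
      then show ?thesis by (simp add: add_increasing2)
    next
      case False
      have "t powr Re s \<le> t powr (3/2 - 1)"
        using t False s by (intro powr_mono) auto
      then show ?thesis by (simp add: add_increasing)
    qed
    then have "t powr Re s / exp t \<le> (t powr (1/2 - 1) + t powr (3/2 - 1)) / exp t"
      by (rule divide_right_mono) simp
    then show ?thesis using t
      by (simp add: F_def B_def norm_divide norm_powr_real_powr add_divide_distrib)
  qed (simp add: F_def B_def)
  have F': "((\<lambda>s. F s t) has_field_derivative complex_of_real (ln t * exp (- t))) (at 0)" if "t \<in> {0..}" for t
  \<comment> \<open>At \<open>t = 0\<close> both sides vanish, by the conventions
    \<open>0 powr s = 0\<close> and \<open>ln 0 = 0\<close>.\<close>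
  proof (cases "t = 0")
    case False
    with that have "0 < t" by simp
    then show ?thesis unfolding F_def
      by (auto intro!: derivative_eq_intros simp: exp_minus Ln_of_real divide_inverse)
  qed (simp add: F_def)
  have hol: "(\<lambda>s. F s t) holomorphic_on ball 0 (1/2)" for t
    by (cases "t = 0") (auto simp: F_def intro!: holomorphic_intros)
  note * = has_field_derivative_set_integral[of "1/2" "{0..}" lborel F 0 B, OF _ _ hol m bound B F']
    set_integrable_deriv[of "1/2" "{0..}" lborel F 0 B, OF _ _ hol m bound B F']
  show "set_integrable lborel {0..} (\<lambda>t. complex_of_real (ln t * exp (- t)))"
    by (rule *(2)) auto
  have "((\<lambda>s. LINT t:{0..}|lborel. F s t) has_field_derivative (LINT t:{0..}|lborel. complex_of_real (ln t * exp (- t)))) (at 0)"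
    by (rule *(1)) auto
  moreover have "((\<lambda>s. LINT t:{0..}|lborel. F s t) has_field_derivative Gamma 1 * Digamma 1) (at 0)"
  proof (rule DERIV_cong_ev[THEN iffD2, OF refl _ refl])
    have "((\<lambda>s. Gamma (s + 1)) has_field_derivative Gamma (0 + 1) * Digamma (0 + 1) * 1) (at (0::complex))"
      by (rule DERIV_chain2[OF has_field_derivative_Gamma]) (auto intro!: derivative_eq_intros)
    then show "((\<lambda>s. Gamma (s + 1)) has_field_derivative Gamma 1 * Digamma 1) (at (0::complex))"
      by simp
    have "eventually (\<lambda>s. s \<in> ball 0 (1/2)) (nhds (0::complex))"
      by (intro eventually_nhds_in_open) auto
    then show "\<forall>\<^sub>F s in nhds 0. (LINT t:{0..}|lborel. F s t) = Gamma (s + 1)"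
    proof eventually_elim
      case (elim s)
      then have re: "0 < Re (s + 1)" using abs_Re_le_cmod[of s] by simp
      have "set_integrable lborel {0..} (F s)"
        by (rule set_integrable_bound[OF B m]) (use bound[OF elim] in force)
      then have "(LINT t:{0..}|lborel. F s t) = integral {0..} (F s)"
        by (rule set_borel_integral_eq_integral)
      also have "\<dots> = Gamma (s + 1)"
        using Gamma_integral_complex[OF re] by (intro integral_unique) (simp add: F_def[abs_def])
      finally show ?case .
    qed
  qed
  ultimately show "(LINT t:{0..}|lborel. complex_of_real (ln t * exp (- t))) = - euler_mascheroni"
    using DERIV_unique by fastforce
qed

section \<open>Laplace integrals in the right half-plane\<close>

lemma exp_mult_tendsto_0:
  assumes "0 < Re w"
  shows "((\<lambda>s. exp (- (w * of_real s))) \<longlongrightarrow> 0) at_top"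
proof (rule tendsto_norm_zero_cancel)
  have "((\<lambda>s. exp (- (Re w * s))) \<longlongrightarrow> 0) at_top"
    using assms by real_asymp
  then show "((\<lambda>s. norm (exp (- (w * complex_of_real s)))) \<longlongrightarrow> 0) at_top" by simp
qed

lemma set_integrable_exp_mult:
  fixes k :: "real \<Rightarrow> complex"
  assumes w: "0 < Re w" and k[measurable]: "k \<in> borel_measurable borel" and C: "\<And>s. 0 \<le> s \<Longrightarrow> norm (k s) \<le> C"
  shows "set_integrable lborel {0..} (\<lambda>s. exp (- (w * of_real s)) * k s)"
proof (rule set_integrable_bound)
  have "integrable lborel (\<lambda>s::real. indicator {0..} s *\<^sub>R (s ^ 0 * exp (- s)))"
    using set_integrable_power_exp_atLeast[of 0] by (simp add: set_integrable_def)
  from lborel_integrable_real_affine[OF this, of "Re w" 0] w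
  have "set_integrable lborel {0..} (\<lambda>s. exp (- (Re w * s)))"
    by (simp add: set_integrable_def indicator_def zero_le_mult_iff)
  then show "set_integrable lborel {0..} (\<lambda>s. C * exp (- (Re w * s)))" by simp
  show "set_borel_measurable lborel {0..} (\<lambda>s. exp (- (w * of_real s)) * k s)"
    unfolding set_borel_measurable_def by measurable
  have "norm (exp (- (w * of_real s)) * k s) \<le> norm (C * exp (- (Re w * s)))" if "0 \<le> s" for s
  proof -
    have "0 \<le> C" using C[OF that] by (rule order_trans[OF norm_ge_zero])
    then show ?thesis using C[OF that] by (simp add: norm_mult mult.commute mult_right_mono)
  qed
  then show "AE s in lborel. s \<in> {0..} \<longrightarrow> norm (exp (- (w * of_real s)) * k s) \<le> norm (C * exp (- (Re w * s)))"
    by auto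
qed

lemma integral_exp_mult:
  assumes "0 < Re w"
  shows "(LINT s:{0..}|lborel. exp (- (w * of_real s))) = 1 / w"
proof -
  have w: "w \<noteq> 0" using assms by auto
  have "(LINT s:{0..}|lborel. exp (- (w * of_real s))) = 0 - (- exp (- (w * of_real 0)) / w)"
  proof (rule set_integral_FTC_atLeast)
    show "((\<lambda>s. - exp (- (w * of_real s)) / w) has_vector_derivative exp (- (w * of_real x))) (at x within {0..})" for x
      using w by (auto intro!: derivative_eq_intros has_vector_derivative_real_field)
    show "continuous_on {0..} (\<lambda>s. exp (- (w * complex_of_real s)))" by (intro continuous_intros)
    show "set_integrable lborel {0..} (\<lambda>x. exp (- (w * complex_of_real x)))"
      using set_integrable_exp_mult[OF assms, of "\<lambda>_. 1" 1] by simp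
    have "((\<lambda>s. - exp (- (w * of_real s)) / w) \<longlongrightarrow> - 0 / w) at_top"
      by (intro tendsto_intros exp_mult_tendsto_0 assms) (rule w)
    then show "((\<lambda>s. - exp (- (w * of_real s)) / w) \<longlongrightarrow> 0) at_top" by simp
  qed
  then show ?thesis by simp
qed

text \<open>For \<open>j = \<plusminus>\<i>\<close> and \<open>w > 0\<close>, the substitution \<open>s = (t - w) / (j w)\<close> and a rotation of the contour turn this into
  \<open>exp (- j w)\<close> times the integral of \<open>exp (j t) / t\<close> over \<open>{w..}\<close>.\<close>
definition aux_exp_integral :: "complex \<Rightarrow> complex \<Rightarrow> complex" where
  "aux_exp_integral j w = (LINT s:{0..}|lborel. exp (- (w * of_real s)) / (of_real s - j))"

context
  fixes j :: complex
  assumes j: "j = \<i> \<or> j = - \<i>"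
begin

lemma norm_diff_unit: "norm (of_real s - j) = sqrt (s\<^sup>2 + 1)"
  using j by (auto simp: cmod_def)

lemma diff_unit_nonzero: "of_real s - j \<noteq> 0"
proof -
  have "0 < s\<^sup>2 + 1" by (simp add: add_nonneg_pos)
  then have "norm (of_real s - j) \<noteq> 0" by (simp only: norm_diff_unit real_sqrt_eq_zero_cancel_iff)
  then show ?thesis by (simp del: right_minus_eq)
qed

lemma norm_inverse_diff_unit_le: "norm (1 / (of_real s - j)) \<le> 1"
proof -
  have "1 \<le> sqrt (s\<^sup>2 + 1)" by simp
  then show ?thesis unfolding norm_divide norm_diff_unit by (subst divide_le_eq_1_pos) (auto simp: add_nonneg_pos)
qed

text \<open>Since \<open>- s / (s - j) = - 1 - j / (s - j)\<close>, the differentiated integral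
  returns the original one plus an elementary term. Multiplication by \<open>exp (j * w)\<close>
  later removes the homogeneous part of this linear equation.\<close>

lemma has_field_derivative_aux_exp_integral:
  assumes w: "0 < Re w"
  shows "(aux_exp_integral j has_field_derivative - 1 / w - j * aux_exp_integral j w) (at w)"
proof -
  let ?F' = "\<lambda>s. - of_real s * exp (- (w * of_real s)) / (of_real s - j)"
  have B: "set_integrable lborel {0..} (\<lambda>s. exp (- (Re w / 2 * s)))"
    using set_integrable_norm[OF set_integrable_exp_mult[of "of_real (Re w / 2)" "\<lambda>_. 1" 1]] w by simp
  have "((\<lambda>w. LINT s:{0..}|lborel. exp (- (w * of_real s)) / (of_real s - j)) has_field_derivative
      (LINT s:{0..}|lborel. ?F' s)) (at w)"
  proof (rule has_field_derivative_set_integral[OF _ _ _ _ _ B, where R = "Re w / 2"])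
    show "(\<lambda>q. exp (- (q * of_real s)) / (of_real s - j)) holomorphic_on ball w (Re w / 2)" for s
      using diff_unit_nonzero[of s] by (intro holomorphic_intros) auto
    show "set_borel_measurable lborel {0..} (\<lambda>s. exp (- (q * of_real s)) / (of_real s - j))" for q
      unfolding set_borel_measurable_def by measurable
    show "((\<lambda>q. exp (- (q * of_real s)) / (of_real s - j)) has_field_derivative ?F' s) (at w)" for s
      using diff_unit_nonzero[of s] by (auto intro!: derivative_eq_intros)
    fix q s assume q: "q \<in> ball w (Re w / 2)" and s: "s \<in> {0::real..}"
    have "Re w / 2 \<le> Re q" using q abs_Re_le_cmod[of "w - q"] by (auto simp: dist_norm)
    then have "norm (exp (- (q * of_real s))) \<le> exp (- (Re w / 2 * s))"
      using s mult_right_mono[of "Re w / 2" "Re q" s] by simp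
    then have "norm (exp (- (q * of_real s))) * norm (1 / (of_real s - j)) \<le> exp (- (Re w / 2 * s)) * 1"
      by (intro mult_mono norm_inverse_diff_unit_le) auto
    then show "norm (exp (- (q * of_real s)) / (of_real s - j)) \<le> exp (- (Re w / 2 * s))"
      by (simp add: norm_divide)
  qed (use w in auto)
  also have "(LINT s:{0..}|lborel. ?F' s)
      = (LINT s:{0..}|lborel. - exp (- (w * of_real s)) - j * (exp (- (w * of_real s)) / (of_real s - j)))"
    using diff_unit_nonzero by (intro set_lebesgue_integral_cong) (auto simp: field_simps)
  also have "\<dots> = (LINT s:{0..}|lborel. - exp (- (w * of_real s))) - (LINT s:{0..}|lborel. j * (exp (- (w * of_real s)) / (of_real s - j)))"
  proof (rule set_integral_diff)
    show "set_integrable lborel {0..} (\<lambda>s. - exp (- (w * complex_of_real s)))"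
      using set_integrable_exp_mult[OF w, of "\<lambda>_. -1" 1] by simp
    show "set_integrable lborel {0..} (\<lambda>s. j * (exp (- (w * of_real s)) / (of_real s - j)))"
      using set_integrable_exp_mult[OF w, of "\<lambda>s. 1 / (of_real s - j)" 1] norm_inverse_diff_unit_le
      by (intro set_integrable_mult_right) auto
  qed
  also have "\<dots> = - 1 / w - j * aux_exp_integral j w"
  proof -
    have "(LINT s:{0..}|lborel. - exp (- (w * complex_of_real s))) = - (1 / w)"
      using set_integral_uminus[OF set_integrable_exp_mult[OF w, of "\<lambda>_. 1" 1]] by (simp add: integral_exp_mult[OF w])
    then show ?thesis by (simp only: aux_exp_integral_def set_integral_mult_right) simp
  qed
  finally show ?thesis by (simp add: aux_exp_integral_def[abs_def])
qed

end

context
  fixes j :: complex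
  assumes j: "j = \<i> \<or> j = - \<i>"
begin

text \<open>Integration by parts: \<open>ln (w\<^sup>2 + t\<^sup>2) / 2 + j arctan (t / w)\<close> is an antiderivative of \<open>1 / (t - j w)\<close>.\<close>
lemma aux_exp_integral_add_ln:
  fixes w :: real
  assumes w: "0 < w" "w \<le> 1"
  defines "L \<equiv> \<lambda>t. of_real (exp (- t) * (ln (w\<^sup>2 + t\<^sup>2) / 2)) + j * of_real (exp (- t) * arctan (t / w))"
  assumes int: "set_integrable lborel {0..} L"
  shows "aux_exp_integral j (of_real w) + of_real (ln w) = (LINT t:{0..}|lborel. L t)"
proof -
  \<comment> \<open>The integrand after the substitution \<open>s = t / w\<close>: the exponential
    is now independent of \<open>w\<close>, which has moved into the pole \<open>j * w\<close>. In
    this form \<open>w\<close> can tend to 0.\<close>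
  let ?K = "\<lambda>t. exp (- of_real t) / (of_real t - j * of_real w)"
  have nz: "of_real t - j * of_real w \<noteq> 0" for t
    using diff_unit_nonzero[OF j, of "t / w"] w(1) by (auto simp: field_simps)
  have bd: "norm (1 / (of_real t - j * of_real w)) \<le> 1 / w" for t
  proof -
    have "of_real t - j * of_real w = (of_real (t / w) - j) * of_real w"
      using w(1) by (simp add: left_diff_distrib)
    then have "1 / (of_real t - j * of_real w) = (1 / (of_real (t / w) - j)) / of_real w"
      by simp
    then have "norm (1 / (of_real t - j * of_real w)) = norm (1 / (of_real (t / w) - j)) / w"
      using w(1) by (simp add: norm_mult norm_divide)
    then show ?thesis using norm_inverse_diff_unit_le[OF j, of "t / w"] w(1)
      by (simp only: divide_right_mono less_imp_le)
  qed
  have intK: "set_integrable lborel {0..} ?K"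
    using set_integrable_exp_mult[of 1 "\<lambda>t. 1 / (of_real t - j * of_real w)" "1 / w"] bd by simp
  have "aux_exp_integral j (of_real w) = \<bar>1 / w\<bar> *\<^sub>R (LINT t|lborel.
      indicator {0..} (0 + 1 / w * t) *\<^sub>R (exp (- (of_real w * of_real (0 + 1 / w * t))) / (of_real (0 + 1 / w * t) - j)))"
    unfolding aux_exp_integral_def set_lebesgue_integral_def
    by (rule lborel_integral_real_affine) (use w in auto)
  also have "\<dots> = (LINT t|lborel. \<bar>1 / w\<bar> *\<^sub>R (
      indicator {0..} (0 + 1 / w * t) *\<^sub>R (exp (- (of_real w * of_real (0 + 1 / w * t))) / (of_real (0 + 1 / w * t) - j))))"
    by (simp only: integral_scaleR_right)
  also have "\<dots> = (LINT t:{0..}|lborel. ?K t)"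
    unfolding set_lebesgue_integral_def
  proof (rule Bochner_Integration.integral_cong[OF refl])
    fix t :: real
    have "of_real t / of_real w - j \<noteq> 0" using diff_unit_nonzero[OF j, of "t/w"] by simp
    then show "\<bar>1 / w\<bar> *\<^sub>R (indicator {0..} (0 + 1 / w * t) *\<^sub>R (exp (- (of_real w * of_real (0 + 1 / w * t))) / (of_real (0 + 1 / w * t) - j)))
       = indicator {0..} t *\<^sub>R ?K t"
      using w nz[of t] by (auto simp: indicator_def zero_le_divide_iff scaleR_conv_of_real) (simp add: field_simps)
  qed
  finally have E: "aux_exp_integral j (of_real w) = (LINT t:{0..}|lborel. ?K t)" .
  \<comment> \<open>\<open>L\<close> is \<open>exp (- t)\<close> times the antiderivative, so its
    derivative is \<open>?K - L\<close>. Its value at 0 is \<open>ln w\<close>, the logarithm added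
    in the statement.\<close>
  have "(LINT t:{0..}|lborel. ?K t - L t) = 0 - L 0"
  proof (rule set_integral_FTC_atLeast)
    show "set_integrable lborel {0..} (\<lambda>t. ?K t - L t)" by (intro set_integral_diff intK int)
    have pos: "0 < w\<^sup>2 + t\<^sup>2" for t using w by (simp add: add_pos_nonneg)
    show "continuous_on {0..} (\<lambda>t. ?K t - L t)"
      unfolding L_def using nz pos by (intro continuous_intros) (auto simp: less_imp_neq[OF pos, symmetric])
    fix t :: real
    have "((\<lambda>t. exp (- t) * (ln (w\<^sup>2 + t\<^sup>2) / 2)) has_real_derivative
        - exp (- t) * (ln (w\<^sup>2 + t\<^sup>2) / 2) + exp (- t) * (t / (w\<^sup>2 + t\<^sup>2))) (at t within {0..})"
    proof -
      have "((\<lambda>t. exp (- t)) has_real_derivative - exp (- t)) (at t within {0..})"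
        by (auto intro!: derivative_eq_intros)
      moreover have "((\<lambda>t. ln (w\<^sup>2 + t\<^sup>2) / 2) has_real_derivative t / (w\<^sup>2 + t\<^sup>2)) (at t within {0..})"
      proof -
        have "((\<lambda>t. w\<^sup>2 + t\<^sup>2) has_real_derivative 2 * t) (at t within {0..})"
          by (auto intro!: derivative_eq_intros)
        note d = DERIV_cdivide[OF DERIV_chain2[OF DERIV_ln_divide[OF pos[of t]] this], of 2]
        have "1 / u * (2 * t) / 2 = t / u" for u by simp
        from d[unfolded this] show ?thesis .
      qed
      ultimately show ?thesis
        by (rule DERIV_cong[OF DERIV_mult]) (simp add: mult.commute)
    qed
    moreover have "((\<lambda>t. exp (- t) * arctan (t / w)) has_real_derivative
        - exp (- t) * arctan (t / w) + exp (- t) * (w / (w\<^sup>2 + t\<^sup>2))) (at t within {0..})"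
      using pos[of t] w by (auto intro!: derivative_eq_intros simp: field_simps power2_eq_square)
    ultimately have "(L has_vector_derivative of_real (- exp (- t) * (ln (w\<^sup>2 + t\<^sup>2) / 2) + exp (- t) * (t / (w\<^sup>2 + t\<^sup>2)))
        + j * of_real (- exp (- t) * arctan (t / w) + exp (- t) * (w / (w\<^sup>2 + t\<^sup>2)))) (at t within {0..})"
      unfolding L_def by (intro has_vector_derivative_add has_vector_derivative_mult_right has_vector_derivative_of_real)
       (simp_all add: has_real_derivative_iff_has_vector_derivative)
    also have "of_real (- exp (- t) * (ln (w\<^sup>2 + t\<^sup>2) / 2) + exp (- t) * (t / (w\<^sup>2 + t\<^sup>2)))
        + j * of_real (- exp (- t) * arctan (t / w) + exp (- t) * (w / (w\<^sup>2 + t\<^sup>2))) =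
        of_real (exp (- t)) * ((of_real t + j * of_real w) / of_real (w\<^sup>2 + t\<^sup>2)) - L t"
      by (simp add: L_def add_divide_distrib algebra_simps)
    also have "(of_real t + j * of_real w) / of_real (w\<^sup>2 + t\<^sup>2) = 1 / (of_real t - j * of_real w)"
    proof -
      have "(of_real t + j * of_real w) * (of_real t - j * of_real w) = complex_of_real (w\<^sup>2 + t\<^sup>2)"
        using j by (auto simp: algebra_simps power2_eq_square)
      moreover have "complex_of_real (w\<^sup>2 + t\<^sup>2) \<noteq> 0" using pos[of t] unfolding of_real_eq_0_iff by (metis less_irrefl)
      ultimately show ?thesis using nz[of t] by (simp add: frac_eq_eq)
    qed
    also have "of_real (exp (- t)) * (1 / (of_real t - j * of_real w)) - L t = ?K t - L t"
      by (simp flip: exp_of_real)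
    finally show "(L has_vector_derivative ?K t - L t) (at t within {0..})" .
  next
    have "((\<lambda>t. exp (- t) * (ln (w\<^sup>2 + t\<^sup>2) / 2)) \<longlongrightarrow> 0) at_top" using w by real_asymp
    moreover have "((\<lambda>t. exp (- t) * arctan (t / w)) \<longlongrightarrow> 0 * (pi / 2)) at_top"
    proof (rule tendsto_mult)
      have "LIM t at_top. t / w :> at_top" using w by real_asymp
      then show "((\<lambda>t. arctan (t / w)) \<longlongrightarrow> pi / 2) at_top"
        by (rule filterlim_compose[OF tendsto_arctan_at_top])
    qed real_asymp
    ultimately have "(L \<longlongrightarrow> of_real 0 + j * of_real (0 * (pi / 2))) at_top"
      unfolding L_def by (rule tendsto_add[OF tendsto_of_real tendsto_mult[OF tendsto_const tendsto_of_real]])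
    then show "(L \<longlongrightarrow> 0) at_top" by simp
  qed
  moreover have "(LINT t:{0..}|lborel. ?K t - L t) = (LINT t:{0..}|lborel. ?K t) - (LINT t:{0..}|lborel. L t)"
    by (intro set_integral_diff intK int)
  moreover have "L 0 = of_real (ln w)" using w by (simp add: L_def ln_realpow)
  ultimately show ?thesis by (simp add: E algebra_simps)
qed

text \<open>As \<open>w\<close> tends to 0, the integrand \<open>L\<close> tends to
  \<open>exp (- t) * (ln t + j * pi / 2)\<close>. The logarithm integrates to minus Euler's
  constant, and \<open>pi / 2\<close> is the limit of \<open>arctan (t / w)\<close>.\<close>

lemma aux_exp_integral_asymptotics:
  fixes X :: "nat \<Rightarrow> real"
  assumes X: "\<And>n. 0 < X n" "\<And>n. X n \<le> 1" "X \<longlonglongrightarrow> 0"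
  shows "(\<lambda>n. aux_exp_integral j (of_real (X n)) + of_real (ln (X n))) \<longlonglongrightarrow> - euler_mascheroni + j * of_real (pi / 2)"
proof -
  define L where "L n t = of_real (exp (- t) * (ln ((X n)\<^sup>2 + t\<^sup>2) / 2)) + j * of_real (exp (- t) * arctan (t / X n))" for n and t :: real
  \<comment> \<open>A majorant for all \<open>n\<close>, by \<open>X n \<le> 1\<close>. If
    \<open>(X n)^2 + t^2 \<ge> 1\<close>, its logarithm lies between 0 and \<open>t^2\<close>;
    otherwise it lies between \<open>2 * ln t\<close> and 0. The coefficient 2 bounds the
    arctangent.\<close>
  define B where "B t = \<bar>ln t * exp (- t)\<bar> + t ^ 2 * exp (- t) + 2 * (t ^ 0 * exp (- t))" for t :: real
  have B: "set_integrable lborel {0..} B"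
    unfolding B_def using set_integrable_norm[OF set_integrable_ln_exp]
    by (intro set_integral_add set_integrable_mult_right set_integrable_power_exp_atLeast) (simp add: norm_of_real del: of_real_mult)
  have AE0: "AE t in lborel. t \<noteq> (0::real)" by (rule AE_lborel_singleton)
  have bound: "norm (L n t) \<le> B t" if t: "0 < t" for n t
  proof -
    have "\<bar>ln ((X n)\<^sup>2 + t\<^sup>2) / 2\<bar> \<le> \<bar>ln t\<bar> + t\<^sup>2"
    proof (cases "(X n)\<^sup>2 + t\<^sup>2 \<ge> 1")
      case True
      have "(X n)\<^sup>2 \<le> 1" using X(1,2)[of n] by (simp add: power_le_one)
      moreover have "ln ((X n)\<^sup>2 + t\<^sup>2) \<le> (X n)\<^sup>2 + t\<^sup>2 - 1" by (rule ln_le_minus_one) (use True in linarith)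
      moreover have "0 \<le> t\<^sup>2" by simp
      moreover have "0 \<le> ln ((X n)\<^sup>2 + t\<^sup>2)" using True by simp
      ultimately show ?thesis by linarith
    next
      case False
      have "ln (t\<^sup>2) \<le> ln ((X n)\<^sup>2 + t\<^sup>2)" using t by (intro ln_mono) (auto simp: add_nonneg_pos)
      moreover have "ln (t\<^sup>2) = 2 * ln t" using t by (simp add: ln_realpow)
      moreover have "ln ((X n)\<^sup>2 + t\<^sup>2) \<le> 0" using False t by (subst ln_le_zero_iff) (auto simp: add_nonneg_pos)
      moreover have "0 \<le> t\<^sup>2" by simp
      ultimately show ?thesis by linarith
    qed
    moreover have "\<bar>arctan (t / X n)\<bar> \<le> 2"
      using arctan_bounded[of "t / X n"] pi_less_4 by linarith
    moreover have "norm (L n t) \<le> exp (- t) * \<bar>ln ((X n)\<^sup>2 + t\<^sup>2) / 2\<bar> + exp (- t) * \<bar>arctan (t / X n)\<bar>"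
    proof -
      have "norm j = 1" using j by auto
      then show ?thesis unfolding L_def
        by (intro order_trans[OF norm_triangle_ineq]) (simp add: norm_mult abs_mult del: of_real_mult)
    qed
    ultimately have "norm (L n t) \<le> exp (- t) * (\<bar>ln t\<bar> + t\<^sup>2) + exp (- t) * 2"
      by (meson add_mono exp_ge_zero mult_left_mono order_trans)
    then show ?thesis by (simp add: B_def abs_mult algebra_simps)
  qed
  have m: "(\<lambda>t. indicator {0..} t *\<^sub>R L n t) \<in> borel_measurable lborel" for n
    unfolding L_def by measurable
  have bound': "AE t in lborel. norm (indicator {0..} t *\<^sub>R L n t) \<le> indicator {0..} t *\<^sub>R B t" for n
    using AE0
  proof eventually_elim
    case (elim t)
    then show ?case using bound[of t n] by (cases "t > 0") auto
  qed
  have int: "set_integrable lborel {0..} (L n)" for n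
    unfolding set_integrable_def
  proof (rule Bochner_Integration.integrable_bound[OF B[unfolded set_integrable_def] m])
    have *: "x \<le> norm x" for x :: real by simp
    show "AE t in lborel. norm (indicator {0..} t *\<^sub>R L n t) \<le> norm (indicator {0..} t *\<^sub>R B t)"
      using bound'[of n] by (rule eventually_mono) (erule order_trans, rule *)
  qed
  define l where "l t = of_real (ln t * exp (- t)) + j * of_real (pi / 2) * of_real (exp (- t))" for t :: real
  have "(\<lambda>n. LINT t:{0..}|lborel. L n t) \<longlonglongrightarrow> (LINT t:{0..}|lborel. l t)"
    unfolding set_lebesgue_integral_def
  proof (rule integral_dominated_convergence[OF _ m B[unfolded set_integrable_def] _ bound'])
    show "(\<lambda>t. indicator {0..} t *\<^sub>R l t) \<in> borel_measurable lborel"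
      unfolding l_def by measurable
    show "AE t in lborel. (\<lambda>n. indicator {0..} t *\<^sub>R L n t) \<longlonglongrightarrow> indicator {0..} t *\<^sub>R l t"
      using AE0
    proof eventually_elim
      case (elim t)
      show ?case
      proof (cases "t > 0")
        case True
        have "(\<lambda>n. ln ((X n)\<^sup>2 + t\<^sup>2) / 2) \<longlonglongrightarrow> ln (0\<^sup>2 + t\<^sup>2) / 2"
          using True by (intro tendsto_intros X) auto
        then have 1: "(\<lambda>n. ln ((X n)\<^sup>2 + t\<^sup>2) / 2) \<longlonglongrightarrow> ln t" using True by (simp add: ln_realpow)
        have "LIM n sequentially. inverse (X n) :> at_top"
          using X by (intro filterlim_inverse_at_top always_eventually) auto
        from filterlim_tendsto_pos_mult_at_top[OF tendsto_const True this]
        have "LIM n sequentially. t / X n :> at_top" by (simp add: divide_inverse)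
        then have 2: "(\<lambda>n. arctan (t / X n)) \<longlonglongrightarrow> pi / 2"
          by (rule filterlim_compose[OF tendsto_arctan_at_top])
        have "(\<lambda>n. L n t) \<longlonglongrightarrow> of_real (exp (- t) * ln t) + j * of_real (exp (- t) * (pi / 2))"
          unfolding L_def by (intro tendsto_intros 1 2)
        then show ?thesis by (intro tendsto_intros) (simp add: l_def mult_ac)
      qed (use elim in simp)
    qed
  qed
  also have "(LINT t:{0..}|lborel. l t) = - euler_mascheroni + j * of_real (pi / 2)"
  proof -
    have er: "exp (- complex_of_real s) = of_real (exp (- s))" for s by (simp flip: exp_of_real)
    have e: "set_integrable lborel {0..} (\<lambda>t. complex_of_real (exp (- t)))"
      using set_integrable_exp_mult[of 1 "\<lambda>_. 1" 1] by (simp add: er)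
    have "(LINT t:{0..}|lborel. complex_of_real (exp (- t))) = 1"
      using integral_exp_mult[of 1] by (simp add: er)
    moreover have "(LINT t:{0..}|lborel. l t) = (LINT t:{0..}|lborel. complex_of_real (ln t * exp (- t)))
       + (LINT t:{0..}|lborel. j * of_real (pi / 2) * of_real (exp (- t)))"
      unfolding l_def by (intro set_integral_add set_integrable_ln_exp set_integrable_mult_right e)
    ultimately show ?thesis by (simp only: set_integral_mult_right integral_ln_exp) simp
  qed
  also have "(\<lambda>n. LINT t:{0..}|lborel. L n t) = (\<lambda>n. aux_exp_integral j (of_real (X n)) + of_real (ln (X n)))"
    using aux_exp_integral_add_ln[OF X(1,2) int[unfolded L_def]] unfolding L_def by simp
  finally show ?thesis .
qed

text \<open>Both sides have derivative \<open>- exp (j * w) / w\<close>, so their difference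
  \<open>D\<close> is constant on the half-plane. As \<open>w\<close> tends to 0 along the positive
  reals the logarithmic singularities cancel, and each side leaves
  \<open>- \<gamma> + j * pi / 2\<close>, so the constant is 0.\<close>

lemma aux_exp_integral_eq:
  assumes w: "0 < Re w"
  shows "aux_exp_integral j w * exp (j * w) = ci w - j * si w"
proof -
  let ?H = "{w. 0 < Re w}"
  define D where "D w = aux_exp_integral j w * exp (j * w) - (ci w - j * si w)" for w
  have cis: "exp (j * w) = cos w + j * sin w" for w
    using j exp_Euler[of w] exp_minus_Euler[of w] by auto
  have jj: "j * j = -1" using j by auto
  have "\<exists>c. \<forall>w\<in>?H. D w = c"
  proof (rule has_field_derivative_zero_constant)
    show "convex ?H" by (rule convex_halfspace_Re_gt)
    fix w assume "w \<in> ?H"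
    then have w: "0 < Re w" "w \<noteq> 0" "w \<notin> \<real>\<^sub>\<le>\<^sub>0" by (auto simp: complex_nonpos_Reals_iff)
    have "(D has_field_derivative (- 1 / w - j * aux_exp_integral j w) * exp (j * w) + (j * 1 * exp (j * w)) * aux_exp_integral j w
       - (- cos w / w - j * (sin w / w))) (at w)"
      unfolding D_def
      by (intro DERIV_diff DERIV_mult has_field_derivative_aux_exp_integral[OF j] has_field_derivative_ci has_field_derivative_si w
          DERIV_cmult) (auto intro!: derivative_eq_intros)
    also have "(- 1 / w - j * aux_exp_integral j w) * exp (j * w) + (j * 1 * exp (j * w)) * aux_exp_integral j w
       - (- cos w / w - j * (sin w / w)) = (- exp (j * w) + cos w + j * sin w) / w"
      using w(2) by (simp add: field_simps)
    finally show "(D has_field_derivative 0) (at w within ?H)"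
      by (simp add: cis has_field_derivative_at_within)
  qed
  then obtain c where c: "\<And>w. 0 < Re w \<Longrightarrow> D w = c" by blast
  define X where "X n = 1 / real (Suc n)" for n
  have "X \<longlonglongrightarrow> 0" unfolding X_def by real_asymp
  then have X: "\<And>n. 0 < X n" "\<And>n. X n \<le> 1" "X \<longlonglongrightarrow> 0" by (auto simp: X_def)
  have X0: "(\<lambda>n. complex_of_real (X n)) \<longlonglongrightarrow> 0" using tendsto_of_real[OF X(3), where 'a=complex] by simp
  have X0': "filterlim (\<lambda>n. complex_of_real (X n)) (at 0) sequentially"
    using X0 less_imp_neq[OF X(1)] by (auto simp: filterlim_at intro!: always_eventually)
  have "(\<lambda>n. D (of_real (X n))) \<longlonglongrightarrow> 0"
  proof -
    let ?E = "\<lambda>n. aux_exp_integral j (of_real (X n)) + of_real (ln (X n))"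
    have "(\<lambda>x. (exp (j * x) - 1) / x) \<midarrow>0\<rightarrow> j"
    proof -
      have "((\<lambda>x. exp (j * x)) has_field_derivative j) (at 0)" by (auto intro!: derivative_eq_intros)
      then show ?thesis by (simp add: has_field_derivative_iff)
    qed
    then have 1: "(\<lambda>n. (exp (j * of_real (X n)) - 1) / of_real (X n)) \<longlonglongrightarrow> j"
      by (rule filterlim_compose[OF _ X0'])
    have "(\<lambda>n. X n * ln (X n)) \<longlonglongrightarrow> 0" unfolding X_def by real_asymp
    then have "(\<lambda>n. complex_of_real (X n * ln (X n))) \<longlonglongrightarrow> of_real 0" by (rule tendsto_of_real)
    note 2 = tendsto_mult[OF this 1]
    have 3: "(\<lambda>n. exp (j * of_real (X n))) \<longlonglongrightarrow> exp (j * 0)" by (intro tendsto_intros X0)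
    \<comment> \<open>Adding \<open>ln x\<close> to both sides leaves the error
      \<open>ln x * (exp (j * x) - 1)\<close>, because on the left it is multiplied by the
      exponential. The error is split as \<open>(x * ln x) * ((exp (j * x) - 1) / x)\<close>, a null
      sequence times a convergent one.\<close>
    have "(\<lambda>n. ?E n * exp (j * of_real (X n)) - of_real (X n * ln (X n)) * ((exp (j * of_real (X n)) - 1) / of_real (X n))
       - ((ci (of_real (X n)) + Ln (of_real (X n))) - j * si (of_real (X n)))) \<longlonglongrightarrow>
       (- euler_mascheroni + j * of_real (pi / 2)) * exp (j * 0) - of_real 0 * j - (- euler_mascheroni - j * (- of_real pi / 2))"
      by (intro tendsto_diff tendsto_mult aux_exp_integral_asymptotics X 2 3 tendsto_const
          filterlim_compose[OF ci_tendsto_0 X0'] filterlim_compose[OF si_tendsto_0 X0'])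
    also have "(- euler_mascheroni + j * of_real (pi / 2)) * exp (j * 0) - of_real 0 * j - (- euler_mascheroni - j * (- of_real pi / 2)) = 0"
      by simp
    also have "(\<lambda>n. ?E n * exp (j * of_real (X n)) - of_real (X n * ln (X n)) * ((exp (j * of_real (X n)) - 1) / of_real (X n))
       - ((ci (of_real (X n)) + Ln (of_real (X n))) - j * si (of_real (X n)))) = (\<lambda>n. D (of_real (X n)))"
    proof
      fix n
      have "(E + l) * e - x * l * ((e - 1) / x) - ((c + l) - j * s) = E * e - (c - j * s)" if "x \<noteq> 0" for E l e x c s :: complex
        using that by (simp add: field_simps)
      from this[of "of_real (X n)"] X(1)[of n]
      show "?E n * exp (j * of_real (X n)) - of_real (X n * ln (X n)) * ((exp (j * of_real (X n)) - 1) / of_real (X n))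
         - ((ci (of_real (X n)) + Ln (of_real (X n))) - j * si (of_real (X n))) = D (of_real (X n))"
        by (simp add: D_def Ln_of_real)
    qed
    finally show ?thesis .
  qed
  then have "c = 0" using c X(1) by (simp add: LIMSEQ_const_iff)
  then show ?thesis using c[OF w] by (simp add: D_def)
qed

end

lemma one_plus_sq_nonzero: "1 + (complex_of_real s)\<^sup>2 \<noteq> 0"
proof -
  have "0 < 1 + s\<^sup>2" by (simp add: add_pos_nonneg)
  then have "complex_of_real (1 + s\<^sup>2) \<noteq> 0" unfolding of_real_eq_0_iff by simp
  then show ?thesis by simp
qed

lemma norm_one_plus_sq: "norm (1 + (complex_of_real s)\<^sup>2) = 1 + s\<^sup>2"
  by (metis (no_types, lifting) add_nonneg_nonneg norm_of_real of_real_1 of_real_add of_real_power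
      abs_of_nonneg zero_le_one zero_le_power2)

text \<open>Partial fractions of \<open>1 / (1 + s^2)\<close> over the poles
  \<open>\<plusminus> i\<close>, followed by Euler's formula. The value is a classical auxiliary
  function of the sine and cosine integrals.\<close>

lemma integral_exp_over_one_plus_sq:
  assumes w: "0 < Re w"
  shows "(LINT s:{0..}|lborel. exp (- (w * of_real s)) / (1 + (of_real s)\<^sup>2)) = - ci w * sin w - si w * cos w"
proof -
  have int: "set_integrable lborel {0..} (\<lambda>s. exp (- (w * of_real s)) / (of_real s - j))" if "j = \<i> \<or> j = - \<i>" for j
    using set_integrable_exp_mult[OF w, of "\<lambda>s. 1 / (of_real s - j)" 1] norm_inverse_diff_unit_le[OF that] by simp
  have "(LINT s:{0..}|lborel. exp (- (w * of_real s)) / (1 + (of_real s)\<^sup>2))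
     = (LINT s:{0..}|lborel. (exp (- (w * of_real s)) / (of_real s - \<i>) - exp (- (w * of_real s)) / (of_real s - (- \<i>))) / (2 * \<i>))"
  proof (rule set_lebesgue_integral_cong)
    show "\<forall>s. s \<in> {0..} \<longrightarrow> exp (- (w * of_real s)) / (1 + (of_real s)\<^sup>2) =
       (exp (- (w * of_real s)) / (of_real s - \<i>) - exp (- (w * of_real s)) / (of_real s - (- \<i>))) / (2 * \<i>)"
    proof (intro allI impI)
      fix s :: real
      have nz: "of_real s - \<i> \<noteq> 0" "of_real s + \<i> \<noteq> 0"
        using diff_unit_nonzero[of \<i> s] diff_unit_nonzero[of "- \<i>" s] by auto
      have "1 + (complex_of_real s)\<^sup>2 = (of_real s - \<i>) * (of_real s + \<i>)"
        by (simp add: algebra_simps power2_eq_square)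
      moreover have "e / (a * b) = (e / a - e / b) / (b - a)" if "a \<noteq> 0" "b \<noteq> 0" "b - a \<noteq> 0" for a b e :: complex
        using that by (simp add: diff_frac_eq right_diff_distrib[symmetric])
      from this[OF nz] have "e / ((of_real s - \<i>) * (of_real s + \<i>)) = (e / (of_real s - \<i>) - e / (of_real s + \<i>)) / (2 * \<i>)" for e
        by simp
      ultimately show "exp (- (w * of_real s)) / (1 + (of_real s)\<^sup>2) =
       (exp (- (w * of_real s)) / (of_real s - \<i>) - exp (- (w * of_real s)) / (of_real s - (- \<i>))) / (2 * \<i>)"
        by simp
    qed
  qed simp
  also have "\<dots> = (aux_exp_integral \<i> w - aux_exp_integral (- \<i>) w) / (2 * \<i>)"
    by (simp only: set_integral_divide_zero aux_exp_integral_def set_integral_diff(2)[OF int[OF disjI1[OF refl]] int[OF disjI2[OF refl]]])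
  also have "aux_exp_integral \<i> w = (ci w - \<i> * si w) * exp (- (\<i> * w))"
    using aux_exp_integral_eq[OF _ w, of \<i>] by (simp add: exp_minus field_simps)
  also have "aux_exp_integral (- \<i>) w = (ci w + \<i> * si w) * exp (\<i> * w)"
    using aux_exp_integral_eq[OF _ w, of "- \<i>"] by (simp add: exp_minus field_simps)
  also have "((ci w - \<i> * si w) * exp (- (\<i> * w)) - (ci w + \<i> * si w) * exp (\<i> * w)) / (2 * \<i>) = - ci w * sin w - si w * cos w"
    by (simp add: exp_Euler exp_minus_Euler field_simps)
  finally show ?thesis .
qed

lemma norm_sq_kernel_le: "norm (2 * of_real s / (1 + (of_real s)\<^sup>2)\<^sup>2 :: complex) \<le> 1"
proof -
  have "2 * \<bar>s\<bar> * 1 \<le> (1 + s\<^sup>2) * (1 + s\<^sup>2)"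
  proof (rule mult_mono)
    show "2 * \<bar>s\<bar> \<le> 1 + s\<^sup>2" using zero_le_power2[of "\<bar>s\<bar> - 1"] by (simp add: power2_diff)
  qed (auto simp: add_nonneg_nonneg)
  then show ?thesis
    by (simp add: norm_divide norm_mult norm_power norm_one_plus_sq power2_eq_square[of "1 + s\<^sup>2"] divide_le_eq_1 add_nonneg_eq_0_iff add_pos_nonneg)
qed

text \<open>Integration by parts: the derivative of \<open>- exp (- w s) / (1 + s^2)\<close> is this
  integrand plus \<open>w\<close> times the one of \<open>integral_exp_over_one_plus_sq\<close>, and
  its boundary contribution is 1. For \<open>w = - z r\<close> the right side is
  \<open>2 pi^2 r^2\<close> times the kernel \<open>g\<close>, whose inverse-square summand is thus
  the boundary term.\<close>

lemma integral_exp_sq_kernel: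
  assumes w: "0 < Re w"
  shows "(LINT s:{0..}|lborel. exp (- (w * of_real s)) * (2 * of_real s / (1 + (of_real s)\<^sup>2)\<^sup>2))
     = 1 + w * (ci w * sin w + si w * cos w)"
proof -
  let ?a = "\<lambda>s. w * (exp (- (w * of_real s)) / (1 + (of_real s)\<^sup>2))"
  let ?b = "\<lambda>s. exp (- (w * of_real s)) * (2 * of_real s / (1 + (of_real s)\<^sup>2)\<^sup>2)"
  note nz = one_plus_sq_nonzero
  have le: "norm (1 / (1 + (of_real s)\<^sup>2) :: complex) \<le> 1" for s
    unfolding norm_divide norm_one_plus_sq by (subst divide_le_eq_1_pos) (auto simp: add_pos_nonneg)
  have ia: "set_integrable lborel {0..} ?a"
    using set_integrable_exp_mult[OF w, of "\<lambda>s. 1 / (1 + (of_real s)\<^sup>2)" 1] le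
    by (intro set_integrable_mult_right) simp
  have ib: "set_integrable lborel {0..} ?b"
    by (rule set_integrable_exp_mult[OF w, where C = 1]) (auto intro: norm_sq_kernel_le)
  have "(LINT s:{0..}|lborel. ?a s + ?b s) = 0 - (- (exp (- (w * of_real 0)) / (1 + (of_real 0)\<^sup>2)))"
  proof (rule set_integral_FTC_atLeast)
    show "set_integrable lborel {0..} (\<lambda>s. ?a s + ?b s)" by (intro set_integral_add ia ib)
    show "continuous_on {0..} (\<lambda>s. ?a s + ?b s)"
      by (intro continuous_intros) (auto simp: nz)
    fix s :: real
    have "((\<lambda>s. - (exp (- (w * s)) / (1 + s\<^sup>2))) has_field_derivative
       w * (exp (- (w * of_real s)) / (1 + (of_real s)\<^sup>2)) + exp (- (w * of_real s)) * (2 * of_real s / (1 + (of_real s)\<^sup>2)\<^sup>2)) (at (complex_of_real s))"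
    proof (rule DERIV_cong)
      have d1: "((\<lambda>s. exp (- (w * s))) has_field_derivative - w * exp (- (w * of_real s))) (at (complex_of_real s))"
        and d2: "((\<lambda>s. 1 + s\<^sup>2) has_field_derivative 2 * of_real s) (at (complex_of_real s))"
        by (auto intro!: derivative_eq_intros)
      show "((\<lambda>s. - (exp (- (w * s)) / (1 + s\<^sup>2))) has_field_derivative - ((- w * exp (- (w * of_real s)) * (1 + (of_real s)\<^sup>2)
           - exp (- (w * of_real s)) * (2 * of_real s)) / ((1 + (of_real s)\<^sup>2) * (1 + (of_real s)\<^sup>2)))) (at (complex_of_real s))"
        by (intro DERIV_minus DERIV_divide d1 d2 nz)
      have "- ((- w * e * u - e * v) / (u * u)) = w * (e / u) + e * (v / u\<^sup>2)" if "u \<noteq> 0" for e u v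
        using that by (simp add: field_simps power2_eq_square)
      from this[OF nz] show "- ((- w * exp (- (w * of_real s)) * (1 + (of_real s)\<^sup>2)
           - exp (- (w * of_real s)) * (2 * of_real s)) / ((1 + (of_real s)\<^sup>2) * (1 + (of_real s)\<^sup>2)))
         = w * (exp (- (w * of_real s)) / (1 + (of_real s)\<^sup>2)) + exp (- (w * of_real s)) * (2 * of_real s / (1 + (of_real s)\<^sup>2)\<^sup>2)" .
    qed
    then show "((\<lambda>s. - (exp (- (w * of_real s)) / (1 + (of_real s)\<^sup>2))) has_vector_derivative ?a s + ?b s) (at s within {0..})"
      by (rule has_vector_derivative_at_within[OF has_vector_derivative_real_field])
  next
    have "((\<lambda>s. exp (- (w * of_real s)) * (1 / (1 + (of_real s)\<^sup>2))) \<longlongrightarrow> 0) at_top"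
    proof (rule tendsto_norm_zero_cancel, rule tendsto_sandwich[OF _ _ tendsto_const])
      show "((\<lambda>s. norm (exp (- (w * complex_of_real s)))) \<longlongrightarrow> 0) at_top"
        by (rule tendsto_norm_zero[OF exp_mult_tendsto_0[OF w]])
      show "\<forall>\<^sub>F s in at_top. norm (exp (- (w * of_real s)) * (1 / (1 + (of_real s)\<^sup>2))) \<le> norm (exp (- (w * complex_of_real s)))"
        using le unfolding norm_mult by (intro always_eventually allI mult_left_le) auto
    qed auto
    from tendsto_minus[OF this] show "((\<lambda>s. - (exp (- (w * of_real s)) / (1 + (of_real s)\<^sup>2))) \<longlongrightarrow> 0) at_top" by simp
  qed
  then have "(LINT s:{0..}|lborel. ?a s) + (LINT s:{0..}|lborel. ?b s) = 1"
    by (subst (asm) set_integral_add[OF ia ib]) simp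
  then have "(LINT s:{0..}|lborel. ?b s) = 1 - (LINT s:{0..}|lborel. ?a s)" by (simp add: algebra_simps)
  also have "(LINT s:{0..}|lborel. ?a s) = w * (- ci w * sin w - si w * cos w)"
    by (simp only: set_integral_mult_right integral_exp_over_one_plus_sq[OF w])
  finally show ?thesis by (simp add: algebra_simps)
qed

section \<open>The resolvent kernel as a Laplace integral\<close>

text \<open>Half the integral of \<open>integral_exp_sq_kernel\<close> at \<open>w = p\<^sup>2 r\<close>, with \<open>s / p\<close> substituted for \<open>s\<close>. It
  converges, and is holomorphic in \<open>p\<close>, for all \<open>p\<close> with \<open>Re p > 0\<close>, that is, for every \<open>z = - p\<^sup>2\<close> outside the
  spectrum, whereas the original one needs \<open>Re z < 0\<close>.\<close>
definition resolvent_profile :: "complex \<Rightarrow> real \<Rightarrow> complex" where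
  "resolvent_profile p r = (LINT s:{0..}|lborel. exp (- (p * of_real (r * s))) * (p\<^sup>2 * of_real s / (p\<^sup>2 + (of_real s)\<^sup>2)\<^sup>2))"

abbreviation resolvent_radial :: "complex \<Rightarrow> real \<Rightarrow> complex" where
  "resolvent_radial p r \<equiv> resolvent_profile p r / of_real (pi\<^sup>2 * r\<^sup>2)"

text \<open>In \<open>q^2 + s^2 = (q + i s) (q - i s)\<close> each factor has norm at least
  \<open>Re q\<close> and at least \<open>\<bar>s\<bar> - norm q\<close>. The bound is stated
  against \<open>\<kappa>^2 + s^2\<close>, and uniformly on a ball, so that complex parameters near
  \<open>p\<close> are all compared with the one real parameter \<open>\<kappa>\<close>.\<close>

lemma right_half_plane_bound:
  assumes p: "0 < Re p"
  obtains c M \<kappa> R where "0 < c" "0 < \<kappa>" "0 < R"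
    "\<And>q. q \<in> ball p R \<Longrightarrow> \<kappa> \<le> Re q"  "\<And>q. q \<in> ball p R \<Longrightarrow> norm q \<le> M"
    "\<And>q s. q \<in> ball p R \<Longrightarrow> c * (\<kappa>\<^sup>2 + s\<^sup>2) \<le> norm (q\<^sup>2 + (complex_of_real s)\<^sup>2)"
proof -
  define \<kappa> where "\<kappa> = Re p / 2"
  have \<kappa>: "0 < \<kappa>" using p by (simp add: \<kappa>_def)
  define M where "M = norm p + \<kappa>"
  \<comment> \<open>The largest constant with \<open>c * (\<kappa> + \<bar>s\<bar>) \<le> max
    \<kappa> (\<bar>s\<bar> - M)\<close>: the worst case is
    \<open>\<bar>s\<bar> = M + \<kappa>\<close>, where both terms of the maximum equal
    \<open>\<kappa>\<close>.\<close>
  define c where "c = \<kappa> / (2 * \<kappa> + M)"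
  have re: "\<kappa> \<le> Re q" if "q \<in> ball p \<kappa>" for q
    using that abs_Re_le_cmod[of "p - q"] by (auto simp: dist_norm \<kappa>_def)
  have M: "norm q \<le> M" if "q \<in> ball p \<kappa>" for q
    using that norm_triangle_ineq2[of q p] by (auto simp: dist_norm M_def norm_minus_commute)
  have M0: "0 \<le> M" using \<kappa> by (simp add: M_def)
  have c: "0 < c" using \<kappa> M0 by (simp add: c_def)
  have le: "c * (\<kappa> + \<bar>s\<bar>) \<le> norm (q + e * of_real s)" if q: "q \<in> ball p \<kappa>" and e: "e = \<i> \<or> e = - \<i>" for q s e
  proof -
    have "\<kappa> \<le> norm (q + e * of_real s)"
      using re[OF q] e complex_Re_le_cmod[of "q + e * of_real s"] by auto
    moreover have "\<bar>s\<bar> - M \<le> norm (q + e * of_real s)"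
      using norm_triangle_ineq2[of "e * of_real s" "- q"] M[OF q] e by (auto simp: norm_mult add.commute)
    moreover have "c * (\<kappa> + \<bar>s\<bar>) \<le> max \<kappa> (\<bar>s\<bar> - M)"
    proof (cases "\<bar>s\<bar> \<le> M + \<kappa>")
      case True
      then have "\<kappa> * (\<kappa> + \<bar>s\<bar>) \<le> \<kappa> * (2 * \<kappa> + M)" using \<kappa> by (intro mult_left_mono) auto
      then have "c * (\<kappa> + \<bar>s\<bar>) \<le> \<kappa>" using \<kappa> M0 by (simp add: c_def divide_le_eq)
      then show ?thesis by simp
    next
      case False
      have "0 \<le> (\<kappa> + M) * (\<bar>s\<bar> - (M + \<kappa>))" using False \<kappa> M0 by (intro mult_nonneg_nonneg) auto
      then have "\<kappa> * (\<kappa> + \<bar>s\<bar>) \<le> (\<bar>s\<bar> - M) * (2 * \<kappa> + M)" by (simp add: algebra_simps)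
      then have "c * (\<kappa> + \<bar>s\<bar>) \<le> \<bar>s\<bar> - M" using \<kappa> M0 by (simp add: c_def divide_le_eq)
      then show ?thesis by simp
    qed
    ultimately show ?thesis by linarith
  qed
  have "c\<^sup>2 * (\<kappa>\<^sup>2 + s\<^sup>2) \<le> norm (q\<^sup>2 + (complex_of_real s)\<^sup>2)" if q: "q \<in> ball p \<kappa>" for q s
  proof -
    have "\<kappa>\<^sup>2 + s\<^sup>2 \<le> (\<kappa> + \<bar>s\<bar>)\<^sup>2" using \<kappa> by (simp add: power2_sum)
    then have "c\<^sup>2 * (\<kappa>\<^sup>2 + s\<^sup>2) \<le> (c * (\<kappa> + \<bar>s\<bar>)) * (c * (\<kappa> + \<bar>s\<bar>))"
      using c by (simp add: power2_eq_square[of c] power2_eq_square[of "\<kappa> + \<bar>s\<bar>"] mult_ac)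
    also have "\<dots> \<le> norm (q + \<i> * of_real s) * norm (q + (- \<i>) * of_real s)"
      using c \<kappa> by (intro mult_mono le q) auto
    also have "\<dots> = norm (q\<^sup>2 + (complex_of_real s)\<^sup>2)"
      by (simp add: norm_mult[symmetric] algebra_simps power2_eq_square)
    finally show ?thesis .
  qed
  then show thesis using that[of "c\<^sup>2" \<kappa> \<kappa> M] c \<kappa> re M by auto
qed

abbreviation (input) profile_integrand :: "complex \<Rightarrow> real \<Rightarrow> real \<Rightarrow> complex" where
  "profile_integrand p r s \<equiv> exp (- (p * of_real (r * s))) * (p\<^sup>2 * of_real s / (p\<^sup>2 + (of_real s)\<^sup>2)\<^sup>2)"

lemma sq_plus_sq_nonzero:
  assumes "0 < Re p" shows "p\<^sup>2 + (complex_of_real s)\<^sup>2 \<noteq> 0"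
proof -
  obtain c M \<kappa> R where b: "0 < c" "0 < \<kappa>" "0 < R"
    "\<And>q. q \<in> ball p R \<Longrightarrow> \<kappa> \<le> Re q"  "\<And>q. q \<in> ball p R \<Longrightarrow> norm q \<le> M"
    "\<And>q s. q \<in> ball p R \<Longrightarrow> c * (\<kappa>\<^sup>2 + s\<^sup>2) \<le> norm (q\<^sup>2 + (complex_of_real s)\<^sup>2)"
    by (rule right_half_plane_bound[OF assms]) (rule that)
  have "0 < c * (\<kappa>\<^sup>2 + s\<^sup>2)" using b by (intro mult_pos_pos add_pos_nonneg) auto
  also have "\<dots> \<le> norm (p\<^sup>2 + (complex_of_real s)\<^sup>2)" using b by simp
  finally show ?thesis by auto
qed

abbreviation real_integrand :: "real \<Rightarrow> real \<Rightarrow> real \<Rightarrow> real" where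
  "real_integrand \<kappa> r s \<equiv> exp (- (\<kappa> * (r * s))) * (\<kappa>\<^sup>2 * s / (\<kappa>\<^sup>2 + s\<^sup>2)\<^sup>2)"

text \<open>Comparison with the positive integrand at the real parameter \<open>\<kappa>\<close>. In
  the constant, \<open>M^2\<close> bounds the numerator, \<open>c^2\<close> is lost in the squared
  denominator, and \<open>\<kappa>^2\<close> compensates for the numerator of
  \<open>real_integrand\<close>.\<close>

lemma profile_integrand_bound:
  assumes "0 < c" "0 < \<kappa>" "\<kappa> \<le> Re q" "norm q \<le> M" "c * (\<kappa>\<^sup>2 + s\<^sup>2) \<le> norm (q\<^sup>2 + (complex_of_real s)\<^sup>2)"
    "0 \<le> r" "0 \<le> s"
  shows "norm (profile_integrand q r s) \<le> M\<^sup>2 / (c\<^sup>2 * \<kappa>\<^sup>2) * (real_integrand \<kappa> r s)"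
proof -
  have pos: "0 < \<kappa>\<^sup>2 + s\<^sup>2" using assms by (intro add_pos_nonneg) auto
  have "\<kappa> * (r * s) \<le> Re q * (r * s)" using assms by (intro mult_right_mono) auto
  then have 1: "norm (exp (- (q * of_real (r * s)))) \<le> exp (- (\<kappa> * (r * s)))" by simp
  have "norm (q\<^sup>2 * of_real s / (q\<^sup>2 + (of_real s)\<^sup>2)\<^sup>2) = (norm q)\<^sup>2 * s / (norm (q\<^sup>2 + (of_real s)\<^sup>2))\<^sup>2"
    using assms by (simp add: norm_divide norm_mult norm_power)
  also have "\<dots> \<le> M\<^sup>2 * s / (c * (\<kappa>\<^sup>2 + s\<^sup>2))\<^sup>2"
    using assms pos by (intro frac_le mult_right_mono power_mono mult_nonneg_nonneg zero_less_power mult_pos_pos) auto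
  also have "\<dots> = M\<^sup>2 / (c\<^sup>2 * \<kappa>\<^sup>2) * (\<kappa>\<^sup>2 * s / (\<kappa>\<^sup>2 + s\<^sup>2)\<^sup>2)"
    using assms by (simp add: power_mult_distrib)
  finally have 2: "norm (q\<^sup>2 * of_real s / (q\<^sup>2 + (of_real s)\<^sup>2)\<^sup>2) \<le> M\<^sup>2 / (c\<^sup>2 * \<kappa>\<^sup>2) * (\<kappa>\<^sup>2 * s / (\<kappa>\<^sup>2 + s\<^sup>2)\<^sup>2)" .
  have "norm (profile_integrand q r s) \<le> exp (- (\<kappa> * (r * s))) * (M\<^sup>2 / (c\<^sup>2 * \<kappa>\<^sup>2) * (\<kappa>\<^sup>2 * s / (\<kappa>\<^sup>2 + s\<^sup>2)\<^sup>2))"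
    unfolding norm_mult by (rule mult_mono[OF 1]) (use 2 in \<open>auto simp: norm_mult norm_divide\<close>)
  then show ?thesis by (simp only: mult_ac)
qed

lemma set_integrable_real_profile:
  fixes \<kappa> r :: real
  assumes "0 < \<kappa>" "0 < r"
  shows "set_integrable lborel {0..} (\<lambda>s. real_integrand \<kappa> r s)"
proof -
  have b: "norm (complex_of_real (\<kappa>\<^sup>2 * s / (\<kappa>\<^sup>2 + s\<^sup>2)\<^sup>2)) \<le> 1 / \<kappa>" if "0 \<le> s" for s
  proof -
    have pos: "0 < \<kappa>\<^sup>2 + s\<^sup>2" using assms by (intro add_pos_nonneg) auto
    have "2 * \<kappa> * s \<le> \<kappa>\<^sup>2 + s\<^sup>2" by (rule sum_squares_bound)
    then have "\<kappa> * s \<le> \<kappa>\<^sup>2 + s\<^sup>2" using assms that mult_nonneg_nonneg[of \<kappa> s] by linarith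
    moreover have "\<kappa>\<^sup>2 \<le> \<kappa>\<^sup>2 + s\<^sup>2" by simp
    ultimately have "\<kappa>\<^sup>2 * (\<kappa> * s) \<le> (\<kappa>\<^sup>2 + s\<^sup>2) * (\<kappa>\<^sup>2 + s\<^sup>2)"
      using assms that by (intro mult_mono) auto
    then have "\<kappa>\<^sup>2 * s / (\<kappa>\<^sup>2 + s\<^sup>2)\<^sup>2 \<le> 1 / \<kappa>"
      using assms pos by (simp add: divide_le_eq power2_eq_square[of "\<kappa>\<^sup>2 + s\<^sup>2"] le_divide_eq mult_ac)
    moreover have "0 \<le> \<kappa>\<^sup>2 * s / (\<kappa>\<^sup>2 + s\<^sup>2)\<^sup>2" using that by simp
    ultimately show ?thesis unfolding norm_of_real by linarith
  qed
  have "set_integrable lborel {0..} (\<lambda>s. exp (- (of_real (\<kappa> * r) * of_real s)) * complex_of_real (\<kappa>\<^sup>2 * s / (\<kappa>\<^sup>2 + s\<^sup>2)\<^sup>2))"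
    by (rule set_integrable_exp_mult[where C = "1 / \<kappa>"]) (use assms b in auto)
  also have "(\<lambda>s. exp (- (of_real (\<kappa> * r) * of_real s)) * complex_of_real (\<kappa>\<^sup>2 * s / (\<kappa>\<^sup>2 + s\<^sup>2)\<^sup>2)) =
    (\<lambda>s. complex_of_real (real_integrand \<kappa> r s))"
    by (simp add: fun_eq_iff exp_of_real[symmetric] mult_ac)
  finally have "integrable lborel (\<lambda>s. Re (indicator {0..} s *\<^sub>R complex_of_real (real_integrand \<kappa> r s)))"
    unfolding set_integrable_def by (rule integrable_Re)
  then show ?thesis
    unfolding set_integrable_def by (simp only: scaleR_complex.sel Re_complex_of_real real_scaleR_def)
qed

lemma holomorphic_resolvent_profile:
  assumes r: "0 < r"
  shows "(\<lambda>p. resolvent_profile p r) holomorphic_on {p. 0 < Re p}"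
proof (rule holomorphic_onI)
  fix p assume "p \<in> {p. 0 < Re p}"
  then have p: "0 < Re p" by simp
  obtain c M \<kappa> R where b: "0 < c" "0 < \<kappa>" "0 < R"
    "\<And>q. q \<in> ball p R \<Longrightarrow> \<kappa> \<le> Re q"  "\<And>q. q \<in> ball p R \<Longrightarrow> norm q \<le> M"
    "\<And>q s. q \<in> ball p R \<Longrightarrow> c * (\<kappa>\<^sup>2 + s\<^sup>2) \<le> norm (q\<^sup>2 + (complex_of_real s)\<^sup>2)"
    by (rule right_half_plane_bound[OF p]) (rule that)
  have hol: "(\<lambda>q. profile_integrand q r s) holomorphic_on ball p R" for s
  proof (intro holomorphic_intros)
    fix q assume "q \<in> ball p R"
    then have "0 < Re q" using b(2,4) by force
    then show "(q\<^sup>2 + (complex_of_real s)\<^sup>2)\<^sup>2 \<noteq> 0" using sq_plus_sq_nonzero by simp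
  qed
  have "((\<lambda>q. LINT s:{0..}|lborel. profile_integrand q r s) has_field_derivative
     (LINT s:{0..}|lborel. deriv (\<lambda>q. profile_integrand q r s) p)) (at p)"
  proof (rule has_field_derivative_set_integral[where R = R])
    show "set_integrable lborel {0..} (\<lambda>s. M\<^sup>2 / (c\<^sup>2 * \<kappa>\<^sup>2) * (real_integrand \<kappa> r s))"
      by (intro set_integrable_mult_right set_integrable_real_profile b r)
    show "norm (profile_integrand q r s) \<le> M\<^sup>2 / (c\<^sup>2 * \<kappa>\<^sup>2) * (real_integrand \<kappa> r s)"
      if "q \<in> ball p R" "s \<in> {0..}" for q s
      using that r by (intro profile_integrand_bound b) auto
    show "((\<lambda>q. profile_integrand q r s) has_field_derivative deriv (\<lambda>q. profile_integrand q r s) p) (at p)" for s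
      using hol[of s] b(3) by (intro holomorphic_derivI[of _ "ball p R"]) auto
    show "set_borel_measurable lborel {0..} (profile_integrand q r)" for q
      unfolding set_borel_measurable_def by measurable
  qed (use hol b in auto)
  then show "(\<lambda>p. resolvent_profile p r) field_differentiable at p within {p. 0 < Re p}"
    unfolding resolvent_profile_def[abs_def] field_differentiable_def
    using has_field_derivative_at_within by blast
qed

text \<open>If \<open>p^2\<close> is real, then so is \<open>p\<close>, because
  \<open>Re p > 0\<close>; hence \<open>p^2 > 0\<close>. Thus \<open>p^2 r\<close> avoids the branch
  cut of \<open>ci\<close> on the whole half-plane.\<close>

lemma sq_notin_nonpos_Reals:
  assumes "0 < Re p" "0 < r" shows "p\<^sup>2 * of_real r \<notin> \<real>\<^sub>\<le>\<^sub>0"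
proof
  assume "p\<^sup>2 * of_real r \<in> \<real>\<^sub>\<le>\<^sub>0"
  then have "Re (p\<^sup>2) \<le> 0" "Im (p\<^sup>2) = 0" using assms by (auto simp: complex_nonpos_Reals_iff mult_le_0_iff)
  then show False using assms by (auto simp: power2_eq_square mult_le_0_iff)
qed

text \<open>For \<open>p = x > 0\<close>, replacing \<open>s\<close> by \<open>s / x\<close> in
  \<open>integral_exp_sq_kernel\<close> gives the identity. It is continued in \<open>p\<close>,
  since the unscaled integral diverges where \<open>Re (p^2) < 0\<close>.\<close>

lemma resolvent_profile_eq:
  assumes p: "0 < Re p" and r: "0 < r"
  defines "w \<equiv> \<lambda>p. p\<^sup>2 * complex_of_real r"
  shows "2 * resolvent_profile p r = 1 + w p * (ci (w p) * sin (w p) + si (w p) * cos (w p))"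
proof (rule half_plane_identity[where f = "\<lambda>p. 2 * resolvent_profile p r"
      and h = "\<lambda>p. 1 + w p * (ci (w p) * sin (w p) + si (w p) * cos (w p))", OF _ _ _ p])
  show "(\<lambda>p. 2 * resolvent_profile p r) holomorphic_on {p. 0 < Re p}"
    by (intro holomorphic_intros holomorphic_resolvent_profile r)
  show "(\<lambda>p. 1 + w p * (ci (w p) * sin (w p) + si (w p) * cos (w p))) holomorphic_on {p. 0 < Re p}"
  proof -
    have d: "(f \<circ> w) holomorphic_on {p. 0 < Re p}"
      if "\<And>w. w \<notin> \<real>\<^sub>\<le>\<^sub>0 \<Longrightarrow> (f has_field_derivative f' w) (at w)" for f f'
    proof (rule holomorphic_on_compose_gen[of w _ f "- \<real>\<^sub>\<le>\<^sub>0"])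
      show "w holomorphic_on {p. 0 < Re p}" unfolding w_def by (intro holomorphic_intros)
      show "f holomorphic_on - \<real>\<^sub>\<le>\<^sub>0"
      proof (rule holomorphic_onI)
        fix v :: complex assume "v \<in> - \<real>\<^sub>\<le>\<^sub>0"
        then have "(f has_field_derivative f' v) (at v)" by (intro that) auto
        then show "f field_differentiable at v within - \<real>\<^sub>\<le>\<^sub>0"
          using has_field_derivative_at_within unfolding field_differentiable_def by blast
      qed
      show "w ` {p. 0 < Re p} \<subseteq> - \<real>\<^sub>\<le>\<^sub>0" using sq_notin_nonpos_Reals[OF _ r] by (auto simp: w_def)
    qed
    have "(ci \<circ> w) holomorphic_on {p. 0 < Re p}" by (rule d[OF has_field_derivative_ci])
    moreover have "(si \<circ> w) holomorphic_on {p. 0 < Re p}" by (rule d[OF has_field_derivative_si]) auto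
    moreover have "w holomorphic_on {p. 0 < Re p}" unfolding w_def by (intro holomorphic_intros)
    ultimately show ?thesis unfolding o_def by (intro holomorphic_intros)
  qed
  fix x :: real assume x: "0 < x"
  define v where "v = x\<^sup>2 * r"
  have wx: "w (of_real x) = of_real v" by (simp add: w_def v_def)
  have v: "0 < v" using x r by (simp add: v_def)
  let ?k = "\<lambda>s. exp (- (of_real v * of_real s)) * (2 * of_real s / (1 + (of_real s)\<^sup>2)\<^sup>2) :: complex"
  have "1 + w (of_real x) * (ci (w (of_real x)) * sin (w (of_real x)) + si (w (of_real x)) * cos (w (of_real x)))
    = (LINT s:{0..}|lborel. ?k s)"
    unfolding wx by (rule integral_exp_sq_kernel[symmetric]) (use v in simp)
  also have "\<dots> = \<bar>1 / x\<bar> *\<^sub>R (LINT s|lborel. indicator {0..} (0 + 1 / x * s) *\<^sub>R ?k (0 + 1 / x * s))"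
    unfolding set_lebesgue_integral_def by (rule lborel_integral_real_affine) (use x in auto)
  also have "\<dots> = (LINT s|lborel. \<bar>1 / x\<bar> *\<^sub>R (indicator {0..} (0 + 1 / x * s) *\<^sub>R ?k (0 + 1 / x * s)))"
    by (simp only: integral_scaleR_right)
  also have "\<dots> = (LINT s:{0..}|lborel. 2 * profile_integrand (of_real x) r s)"
    unfolding set_lebesgue_integral_def
  proof (rule Bochner_Integration.integral_cong[OF refl])
    fix s :: real
    define X where "X = complex_of_real x"
    define S where "S = complex_of_real s"
    have X: "X \<noteq> 0" using x by (simp add: X_def)
    have "X\<^sup>2 + S\<^sup>2 \<noteq> 0" using sq_plus_sq_nonzero[of X s] x by (simp add: X_def S_def)
    then have nz: "1 + (S / X)\<^sup>2 \<noteq> 0" using X by (simp add: power_divide field_simps)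
    have e1: "1 + (S / X)\<^sup>2 = (X\<^sup>2 + S\<^sup>2) / X\<^sup>2" using X by (simp add: power_divide field_simps)
    have "(1 / X) * (2 * (S / X) / (1 + (S / X)\<^sup>2)\<^sup>2) = 2 * (X\<^sup>2 * S / (X\<^sup>2 + S\<^sup>2)\<^sup>2)"
      unfolding e1 power_divide using X \<open>X\<^sup>2 + S\<^sup>2 \<noteq> 0\<close> by (simp add: field_simps power2_eq_square)
    then have alg: "e * ((1 / X) * (2 * (S / X) / (1 + (S / X)\<^sup>2)\<^sup>2)) = 2 * (e * (X\<^sup>2 * S / (X\<^sup>2 + S\<^sup>2)\<^sup>2))" for e by simp
    have e2: "of_real v * (S / X) = X * of_real (r * s)" using x by (simp add: X_def S_def v_def power2_eq_square)
    show "\<bar>1 / x\<bar> *\<^sub>R (indicator {0..} (0 + 1 / x * s) *\<^sub>R ?k (0 + 1 / x * s)) = indicator {0..} s *\<^sub>R (2 * profile_integrand (of_real x) r s)"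
    proof (cases "0 \<le> s")
      case True
      have "\<bar>1 / x\<bar> *\<^sub>R (indicator {0..} (0 + 1 / x * s) *\<^sub>R ?k (0 + 1 / x * s)) =
          exp (- (of_real v * (S / X))) * ((1 / X) * (2 * (S / X) / (1 + (S / X)\<^sup>2)\<^sup>2))"
        using True x by (simp add: X_def S_def scaleR_conv_of_real mult_ac)
      also have "\<dots> = 2 * profile_integrand (of_real x) r s"
        unfolding alg e2 by (simp add: X_def S_def)
      finally show ?thesis using True by simp
    qed (use x in \<open>auto simp: zero_le_divide_iff\<close>)
  qed
  also have "\<dots> = 2 * resolvent_profile (of_real x) r"
    unfolding resolvent_profile_def by (simp only: set_integral_mult_right)
  finally show "2 * resolvent_profile (of_real x) r = 1 + w (of_real x) * (ci (w (of_real x)) * sin (w (of_real x)) + si (w (of_real x)) * cos (w (of_real x)))"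
    by (rule sym)
qed

lemma g_eq_resolvent_profile:
  assumes p: "0 < Re p"
  shows "g (- (p\<^sup>2)) x = resolvent_radial p (norm x)"
\<comment> \<open>At \<open>x = 0\<close> both sides are 0, because division by 0 yields 0.\<close>
proof (cases "x = 0")
  case False
  define r where "r = norm x"
  have r: "0 < r" using False by (simp add: r_def)
  define w where "w = p\<^sup>2 * complex_of_real r"
  have "g (- (p\<^sup>2)) x = 1 / (2 * of_real pi ^ 2 * (of_real r)\<^sup>2) +
      - (p\<^sup>2) / (2 * of_real pi ^ 2 * of_real r) * (sin (- w) * ci w - cos (- w) * si w)"
    by (simp add: g_def Let_def r_def w_def)
  also have "\<dots> = (1 + w * (ci w * sin w + si w * cos w)) / (2 * of_real pi ^ 2 * (of_real r)\<^sup>2)"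
  proof -
    have "1 / (2 * P\<^sup>2 * R\<^sup>2) + - q / (2 * P\<^sup>2 * R) * (- S * c - K * t) = (1 + q * R * (c * S + t * K)) / (2 * P\<^sup>2 * R\<^sup>2)"
      if "R \<noteq> 0" for P R q S c K t :: complex
    proof -
      have "- q / (2 * P\<^sup>2 * R) * (- S * c - K * t) = (- q * (- S * c - K * t)) / (2 * P\<^sup>2 * R)"
        by (rule times_divide_eq_left)
      also have "- q * (- S * c - K * t) = q * (c * S + t * K)" by (simp add: algebra_simps)
      also have "q * (c * S + t * K) / (2 * P\<^sup>2 * R) = (q * (c * S + t * K) * R) / (2 * P\<^sup>2 * R * R)" using that by simp
      finally show ?thesis by (simp add: power2_eq_square[of R] mult_ac add_divide_distrib)
    qed
    from this[of "of_real r" "of_real pi" "p\<^sup>2"] r show ?thesis by (simp add: w_def)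
  qed
  also have "1 + w * (ci w * sin w + si w * cos w) = 2 * resolvent_profile p r"
    unfolding w_def by (rule resolvent_profile_eq[OF p r, symmetric])
  finally show ?thesis by (simp add: r_def)
qed (simp add: g_def)

section \<open>Fourier transforms of Gaussians and of the Poisson kernel\<close>

text \<open>The characteristic function of the standard normal distribution, rescaled:
  \<open>c = sqrt (2 * s)\<close> turns its density into a multiple of
  \<open>exp (- s * x^2)\<close>, and the frequency becomes \<open>- \<eta> / c\<close>.\<close>

lemma
  assumes s: "0 < s"
  shows gaussian_fourier_real: "(LINT x|lborel. exp (- (\<i> * of_real (\<eta> * x))) * of_real (exp (- s * x\<^sup>2)))
      = complex_of_real (sqrt (pi / s) * exp (- \<eta>\<^sup>2 / (4 * s)))"
    and gaussian_integrable_real: "integrable lborel (\<lambda>x. complex_of_real (exp (- s * x\<^sup>2)))"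
proof -
  define c where "c = sqrt (2 * s)"
  have c: "0 < c" "c\<^sup>2 = 2 * s" using s by (auto simp: c_def)
  have dens: "std_normal_density (0 + c * x) = exp (- s * x\<^sup>2) / sqrt (2 * pi)" for x
    using c by (simp add: std_normal_density_def power_mult_distrib)
  have "integrable lborel (\<lambda>x. std_normal_density (0 + c * x))"
    using c by (intro lborel_integrable_real_affine integrable_normal_density) auto
  then have "integrable lborel (\<lambda>x. sqrt (2 * pi) * (exp (- s * x\<^sup>2) / sqrt (2 * pi)))"
    unfolding dens by (rule integrable_mult_right)
  then have "integrable lborel (\<lambda>x. exp (- s * x\<^sup>2))"
    by simp
  then show "integrable lborel (\<lambda>x. complex_of_real (exp (- s * x\<^sup>2)))" by (rule integrable_of_real)
  have "complex_of_real (exp (- ((- \<eta> / c)\<^sup>2) / 2)) = char std_normal_distribution (- \<eta> / c)"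
    by (simp add: char_std_normal_distribution)
  also have "\<dots> = (LINT x|lborel. std_normal_density x *\<^sub>R iexp (- \<eta> / c * x))"
    unfolding char_def by (subst integral_density) auto
  also have "\<dots> = \<bar>c\<bar> *\<^sub>R (LINT x|lborel. std_normal_density (0 + c * x) *\<^sub>R iexp (- \<eta> / c * (0 + c * x)))"
    by (rule lborel_integral_real_affine) (use c in auto)
  also have "\<dots> = \<bar>c\<bar> *\<^sub>R (LINT x|lborel. of_real (1 / sqrt (2 * pi)) * (exp (- (\<i> * of_real (\<eta> * x))) * of_real (exp (- s * x\<^sup>2))))"
    unfolding dens using c by (simp add: scaleR_conv_of_real mult_ac divide_inverse)
  also have "\<dots> = of_real (c / sqrt (2 * pi)) * (LINT x|lborel. exp (- (\<i> * of_real (\<eta> * x))) * of_real (exp (- s * x\<^sup>2)))"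
    using c by (simp add: scaleR_conv_of_real)
  finally have "(LINT x|lborel. exp (- (\<i> * of_real (\<eta> * x))) * of_real (exp (- s * x\<^sup>2)))
     = complex_of_real (sqrt (2 * pi) / c * exp (- ((- \<eta> / c)\<^sup>2) / 2))"
    using c by (simp add: field_simps del: of_real_mult of_real_divide) (simp add: field_simps)
  also have "sqrt (2 * pi) / c = sqrt (pi / s)"
    using s by (simp add: c_def real_sqrt_mult real_sqrt_divide)
  also have "- (- \<eta> / c)\<^sup>2 / 2 = - \<eta>\<^sup>2 / (4 * s)" using c by (simp add: power_divide)
  finally show "(LINT x|lborel. exp (- (\<i> * of_real (\<eta> * x))) * of_real (exp (- s * x\<^sup>2)))
      = complex_of_real (sqrt (pi / s) * exp (- \<eta>\<^sup>2 / (4 * s)))" .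
qed

text \<open>Fubini in coordinates: \<open>lborel\<close> is the image of the product of
  one-dimensional Lebesgue measures under the coordinate isomorphism.\<close>

lemma
  fixes f :: "'a::euclidean_space \<Rightarrow> real \<Rightarrow> 'b::{real_normed_field,banach,second_countable_topology}"
  assumes f: "\<And>b. b \<in> Basis \<Longrightarrow> integrable lborel (f b)"
  shows integrable_prod_Basis: "integrable lborel (\<lambda>x. \<Prod>b\<in>Basis. f b (x \<bullet> b))"
    and integral_prod_Basis: "(LINT x|lborel. (\<Prod>b\<in>Basis. f b (x \<bullet> b))) = (\<Prod>b\<in>Basis. LINT t|lborel. f b t)"
proof -
  interpret product_sigma_finite "\<lambda>_::'a. lborel::real measure" ..
  let ?T = "\<lambda>g. \<Sum>b\<in>Basis. g b *\<^sub>R (b::'a)"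
  have T: "?T \<in> (\<Pi>\<^sub>M b\<in>Basis. lborel) \<rightarrow>\<^sub>M borel" by measurable
  have [measurable]: "f b \<in> borel_measurable borel" if "b \<in> Basis" for b
    using borel_measurable_integrable[OF f[OF that]] by simp
  have m: "(\<lambda>x. \<Prod>b\<in>Basis. f b (x \<bullet> b)) \<in> borel_measurable borel"
    by measurable
  have eq: "(\<Prod>b\<in>Basis. f b (?T g \<bullet> b)) = (\<Prod>b\<in>Basis. f b (g b))" for g
    by (intro prod.cong refl) (simp add: inner_sum_left inner_Basis if_distrib cong: if_cong)
  show "integrable lborel (\<lambda>x. \<Prod>b\<in>Basis. f b (x \<bullet> b))"
    unfolding lborel_eq[where 'a='a] integrable_distr_eq[OF T m] eq
    by (rule product_integrable_prod) (use f in auto)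
  show "(LINT x|lborel. (\<Prod>b\<in>Basis. f b (x \<bullet> b))) = (\<Prod>b\<in>Basis. LINT t|lborel. f b t)"
    unfolding lborel_eq[where 'a='a] integral_distr[OF T m] eq
    by (rule product_integral_prod) (use f in auto)
qed

lemma norm_sq_eq_sum_Basis: "(norm x)\<^sup>2 = (\<Sum>b\<in>Basis. (x \<bullet> b)\<^sup>2)" for x :: "'a::euclidean_space"
  unfolding power2_norm_eq_inner by (subst euclidean_inner) (simp add: power2_eq_square)

abbreviation wave :: "'a::euclidean_space \<Rightarrow> 'a \<Rightarrow> complex" where
  "wave \<xi> x \<equiv> exp (- (\<i> * of_real (\<xi> \<bullet> x)))"

abbreviation gauss :: "real \<Rightarrow> 'a::euclidean_space \<Rightarrow> real" where
  "gauss s x \<equiv> exp (- s * (norm x)\<^sup>2)"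

text \<open>\<open>(2 * pi) ^ DIM('a)\<close> times the heat kernel at time \<open>s\<close>; with
  this factor it is the unnormalised Fourier transform of \<open>gauss s\<close>.\<close>

abbreviation heat :: "real \<Rightarrow> 'a::euclidean_space \<Rightarrow> real" where
  "heat s v \<equiv> sqrt (pi / s) ^ DIM('a) * exp (- (norm v)\<^sup>2 / (4 * s))"

lemma
  fixes \<xi> :: "'a::euclidean_space"
  assumes s: "0 < s"
  shows gaussian_integrable: "integrable lborel (\<lambda>x::'a. gauss s x)"
    and gaussian_fourier: "(LINT x|lborel. wave \<xi> x * of_real (gauss s x))
      = complex_of_real (heat s \<xi>)"
proof -
  have int: "integrable lborel (\<lambda>t. exp (- (\<i> * of_real (\<eta> * t))) * complex_of_real (exp (- s * t\<^sup>2)))" for \<eta>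
    using gaussian_integrable_real[OF s]
    by (rule Bochner_Integration.integrable_bound) (auto simp: norm_mult)
  have eq: "wave \<xi> x * of_real (gauss s x) =
      (\<Prod>b\<in>Basis. exp (- (\<i> * of_real ((\<xi> \<bullet> b) * (x \<bullet> b)))) * complex_of_real (exp (- s * (x \<bullet> b)\<^sup>2)))" for x \<xi> :: 'a
    by (simp add: prod.distrib exp_sum[symmetric] norm_sq_eq_sum_Basis euclidean_inner[of \<xi> x]
        sum_distrib_left sum_negf of_real_prod[symmetric] del: of_real_prod)
  have "integrable lborel (\<lambda>x::'a. wave 0 x * complex_of_real (gauss s x))"
    unfolding eq by (rule integrable_prod_Basis[OF int])
  then have "integrable lborel (\<lambda>x::'a. complex_of_real (gauss s x))" by simp
  then show "integrable lborel (\<lambda>x::'a. gauss s x)"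
    by (simp only: complex_of_real_integrable_eq)
  show "(LINT x|lborel. wave \<xi> x * of_real (gauss s x))
      = complex_of_real (heat s \<xi>)"
    unfolding eq integral_prod_Basis[OF int] gaussian_fourier_real[OF s]
    by (simp add: of_real_prod[symmetric] prod.distrib exp_sum[symmetric] norm_sq_eq_sum_Basis[of \<xi>]
         sum_negf sum_divide_distrib del: of_real_prod)
qed

section \<open>Subordination of the exponential to Gaussians\<close>

lemma gaussian_antiderivative:
  obtains E :: "real \<Rightarrow> real" where "\<And>x. (E has_real_derivative exp (- x\<^sup>2)) (at x)" "E 0 = 0"
    "(E \<longlongrightarrow> sqrt pi / 2) at_top" "(E \<longlongrightarrow> - (sqrt pi / 2)) at_bot"
proof
  define E where "E x = (LBINT t=0..x. exp (- t\<^sup>2))" for x :: real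
  show "(E has_real_derivative exp (- x\<^sup>2)) (at x)" for x
  proof -
    define b where "b = \<bar>x\<bar> + 1"
    have "((\<lambda>u. LBINT t=ereal 0..u. exp (- t\<^sup>2)) has_vector_derivative exp (- x\<^sup>2)) (at x within {-b..b})"
      by (rule interval_integral_FTC2) (auto simp: b_def intro!: continuous_intros)
    moreover have "at x within {-b..b} = at x" by (rule at_within_Icc_at) (auto simp: b_def)
    ultimately show ?thesis
      unfolding E_def[abs_def] has_real_derivative_iff_has_vector_derivative by (simp add: zero_ereal_def)
  qed
  show "E 0 = 0" by (simp add: E_def zero_ereal_def)
  show top: "(E \<longlongrightarrow> sqrt pi / 2) at_top"
  proof (rule Lim_transform_eventually)
    show "((\<lambda>y. \<integral>x. indicator {..y} x *\<^sub>R (indicator {0..} x *\<^sub>R exp (- x\<^sup>2)) \<partial>lborel) \<longlongrightarrow> sqrt pi / 2) at_top"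
    proof -
      have I: "integrable lborel (\<lambda>x::real. indicator {0..} x *\<^sub>R exp (- x\<^sup>2))"
        and V: "(\<integral>x. indicator {0..} x *\<^sub>R exp (- x\<^sup>2) \<partial>lborel) = sqrt pi / 2"
        using gaussian_moment_0 by (simp_all only: has_bochner_integral_iff)
      show ?thesis using tendsto_integral_at_top[OF _ I] unfolding V by simp
    qed
    show "\<forall>\<^sub>F y in at_top. (\<integral>x. indicator {..y} x *\<^sub>R (indicator {0..} x *\<^sub>R exp (- x\<^sup>2)) \<partial>lborel) = E y"
      using eventually_ge_at_top[of 0]
    proof eventually_elim
      case (elim y)
      then have "E y = (LBINT x:{0..y}. exp (- x\<^sup>2))"
        unfolding E_def zero_ereal_def by (rule interval_integral_Icc)
      then show ?case by (auto simp: set_lebesgue_integral_def indicator_def intro!: Bochner_Integration.integral_cong)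
    qed
  qed
  have odd: "E (- x) = - E x" for x
  proof -
    have "E (- x) = - (LBINT t=- x..0. exp (- t\<^sup>2))"
      unfolding E_def by (rule interval_integral_endpoints_reverse)
    also have "(LBINT t=- x..0. exp (- t\<^sup>2)) = (LBINT t=- 0..x. exp (- (- t)\<^sup>2))"
      by (subst interval_integral_reflect) simp
    finally show ?thesis by (simp add: E_def)
  qed
  show "(E \<longlongrightarrow> - (sqrt pi / 2)) at_bot"
    unfolding filterlim_at_bot_mirror odd by (intro tendsto_minus top)
qed

abbreviation subordinator :: "real \<Rightarrow> real \<Rightarrow> real \<Rightarrow> real" where
  "subordinator \<tau> \<rho> s \<equiv> exp (- (s * \<tau>\<^sup>2)) * exp (- \<rho>\<^sup>2 / (4 * s)) / sqrt s"

text \<open>An antiderivative in closed form, up to the error function, comes from completing the squares of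
  \<open>\<tau> \<surd>s \<plusminus> \<rho> / (2 \<surd>s)\<close>.\<close>
lemma
  fixes \<tau> \<rho> :: real
  assumes \<tau>: "0 < \<tau>" and \<rho>: "0 \<le> \<rho>"
  shows set_integrable_subordination: "set_integrable lborel {0<..} (\<lambda>s. subordinator \<tau> \<rho> s)"
    and integral_subordination: "(LINT s:{0<..}|lborel. subordinator \<tau> \<rho> s) = sqrt pi / \<tau> * exp (- (\<tau> * \<rho>))"
proof -
  obtain E :: "real \<Rightarrow> real" where E: "\<And>x. (E has_real_derivative exp (- x\<^sup>2)) (at x)" "E 0 = 0"
    "(E \<longlongrightarrow> sqrt pi / 2) at_top" "(E \<longlongrightarrow> - (sqrt pi / 2)) at_bot"
    using gaussian_antiderivative by blast
  define f where "f s = subordinator \<tau> \<rho> s" for s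
  define F where "F s = (exp (\<tau> * \<rho>) * E (\<tau> * sqrt s + \<rho> / (2 * sqrt s)) + exp (- (\<tau> * \<rho>)) * E (\<tau> * sqrt s - \<rho> / (2 * sqrt s))) / \<tau>" for s
  \<comment> \<open>\<open>A\<close> and \<open>B\<close> are the limits of \<open>F\<close> at 0
    and at infinity. At 0 the two arguments of \<open>E\<close> tend to plus and minus infinity if
    \<open>\<rho> > 0\<close>, but both to 0 if \<open>\<rho> = 0\<close>, whence the case
    distinction. The difference \<open>B - A\<close> has the same form in both cases.\<close>
  define A where "A = (if \<rho> = 0 then 0 else (exp (\<tau> * \<rho>) * (sqrt pi / 2) + exp (- (\<tau> * \<rho>)) * (- (sqrt pi / 2))) / \<tau>)"
  define B where "B = (exp (\<tau> * \<rho>) * (sqrt pi / 2) + exp (- (\<tau> * \<rho>)) * (sqrt pi / 2)) / \<tau>"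
  have dF: "(F has_real_derivative f s) (at s)" if s: "0 < s" for s
  proof -
    define q where "q = sqrt s"
    have q: "0 < q" "s = q\<^sup>2" "sqrt s = q" using s by (auto simp: q_def)
    have dq: "(sqrt has_real_derivative inverse q / 2) (at s)"
      using s by (auto intro!: derivative_eq_intros simp: q_def)
    have d1: "((\<lambda>s. \<tau> * sqrt s + \<rho> / (2 * sqrt s)) has_real_derivative (\<tau> - \<rho> / (2 * s)) / (2 * q)) (at s)"
    proof (rule DERIV_cong)
      show "((\<lambda>s. \<tau> * sqrt s + \<rho> / (2 * sqrt s)) has_real_derivative
          \<tau> * (inverse q / 2) + (0 * (2 * sqrt s) - \<rho> * (2 * (inverse q / 2))) / ((2 * sqrt s) * (2 * sqrt s))) (at s)"
        by (intro DERIV_add DERIV_diff DERIV_divide DERIV_cmult DERIV_const dq) (use s in simp)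
      show "\<tau> * (inverse q / 2) + (0 * (2 * sqrt s) - \<rho> * (2 * (inverse q / 2))) / ((2 * sqrt s) * (2 * sqrt s)) = (\<tau> - \<rho> / (2 * s)) / (2 * q)"
        unfolding q(3) using q(1) by (simp add: q(2) field_simps power2_eq_square)
    qed
    have d2: "((\<lambda>s. \<tau> * sqrt s - \<rho> / (2 * sqrt s)) has_real_derivative (\<tau> + \<rho> / (2 * s)) / (2 * q)) (at s)"
    proof (rule DERIV_cong)
      show "((\<lambda>s. \<tau> * sqrt s - \<rho> / (2 * sqrt s)) has_real_derivative
          \<tau> * (inverse q / 2) - (0 * (2 * sqrt s) - \<rho> * (2 * (inverse q / 2))) / ((2 * sqrt s) * (2 * sqrt s))) (at s)"
        by (intro DERIV_add DERIV_diff DERIV_divide DERIV_cmult DERIV_const dq) (use s in simp)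
      show "\<tau> * (inverse q / 2) - (0 * (2 * sqrt s) - \<rho> * (2 * (inverse q / 2))) / ((2 * sqrt s) * (2 * sqrt s)) = (\<tau> + \<rho> / (2 * s)) / (2 * q)"
        unfolding q(3) using q(1) by (simp add: q(2) field_simps power2_eq_square)
    qed
    have "(F has_real_derivative
       (exp (\<tau> * \<rho>) * (exp (- (\<tau> * sqrt s + \<rho> / (2 * sqrt s))\<^sup>2) * ((\<tau> - \<rho> / (2 * s)) / (2 * q))) +
        exp (- (\<tau> * \<rho>)) * (exp (- (\<tau> * sqrt s - \<rho> / (2 * sqrt s))\<^sup>2) * ((\<tau> + \<rho> / (2 * s)) / (2 * q)))) / \<tau>) (at s)"
      unfolding F_def by (intro DERIV_cdivide DERIV_add DERIV_cmult DERIV_chain2[OF E(1)] d1 d2)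
    then have "(F has_real_derivative
       (exp (\<tau> * \<rho>) * (exp (- (\<tau> * q + \<rho> / (2 * q))\<^sup>2) * ((\<tau> - \<rho> / (2 * s)) / (2 * q))) +
        exp (- (\<tau> * \<rho>)) * (exp (- (\<tau> * q - \<rho> / (2 * q))\<^sup>2) * ((\<tau> + \<rho> / (2 * s)) / (2 * q)))) / \<tau>) (at s)"
      unfolding q(3) .
    \<comment> \<open>The cross term of each square cancels the exponential in front of it. Both
      summands then carry the same Gaussian factor, and the terms
      \<open>\<plusminus> \<rho> / (2 * s)\<close> cancel in their sum.\<close>
    also have "exp (\<tau> * \<rho>) * (exp (- (\<tau> * q + \<rho> / (2 * q))\<^sup>2) * ((\<tau> - \<rho> / (2 * s)) / (2 * q))) 
       = exp (- (s * \<tau>\<^sup>2)) * exp (- \<rho>\<^sup>2 / (4 * s)) * ((\<tau> - \<rho> / (2 * s)) / (2 * q))"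
    proof -
      have "\<tau> * \<rho> + - (\<tau> * q + \<rho> / (2 * q))\<^sup>2 = - (s * \<tau>\<^sup>2) + - \<rho>\<^sup>2 / (4 * s)"
        using q by (simp add: power2_sum power_mult_distrib power_divide)
      then show ?thesis by (simp only: mult.assoc[symmetric] exp_add[symmetric])
    qed
    also have "exp (- (\<tau> * \<rho>)) * (exp (- (\<tau> * q - \<rho> / (2 * q))\<^sup>2) * ((\<tau> + \<rho> / (2 * s)) / (2 * q))) 
       = exp (- (s * \<tau>\<^sup>2)) * exp (- \<rho>\<^sup>2 / (4 * s)) * ((\<tau> + \<rho> / (2 * s)) / (2 * q))"
    proof -
      have "- (\<tau> * \<rho>) + - (\<tau> * q - \<rho> / (2 * q))\<^sup>2 = - (s * \<tau>\<^sup>2) + - \<rho>\<^sup>2 / (4 * s)"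
        using q by (simp add: power2_diff power_mult_distrib power_divide)
      then show ?thesis by (simp only: mult.assoc[symmetric] exp_add[symmetric])
    qed
    also have "(e * ((\<tau> - \<rho> / (2 * s)) / (2 * q)) + e * ((\<tau> + \<rho> / (2 * s)) / (2 * q))) / \<tau> = e / q" for e
      using \<tau> q(1) by (simp add: field_simps)
    finally show ?thesis by (simp add: f_def q(3))
  qed
  have lim0: "(F \<longlongrightarrow> A) (at_right 0)"
  proof (cases "\<rho> = 0")
    case True
    have "((\<lambda>s. E (\<tau> * sqrt s)) \<longlongrightarrow> E 0) (at_right 0)"
      by (rule isCont_tendsto_compose[OF DERIV_isCont[OF E(1)]]) real_asymp
    then have "((\<lambda>s. (E (\<tau> * sqrt s) + E (\<tau> * sqrt s)) / \<tau>) \<longlongrightarrow> (0 + 0) / \<tau>) (at_right 0)"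
      unfolding E(2) using \<tau> by (intro tendsto_intros) auto
    then show ?thesis using True by (simp add: F_def[abs_def] A_def)
  next
    case False
    then have "0 < \<rho>" using \<rho> by simp
    have "LIM s at_right 0. \<tau> * sqrt s + \<rho> / (2 * sqrt s) :> at_top" using \<tau> \<open>0 < \<rho>\<close> by real_asymp
    note 1 = filterlim_compose[OF E(3) this]
    have "LIM s at_right 0. \<tau> * sqrt s - \<rho> / (2 * sqrt s) :> at_bot" using \<tau> \<open>0 < \<rho>\<close> by real_asymp
    note 2 = filterlim_compose[OF E(4) this]
    have "(F \<longlongrightarrow> (exp (\<tau> * \<rho>) * (sqrt pi / 2) + exp (- (\<tau> * \<rho>)) * (- (sqrt pi / 2))) / \<tau>) (at_right 0)"
      unfolding F_def[abs_def] using \<tau> by (intro tendsto_intros 1 2) auto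
    then show ?thesis using False by (simp only: A_def if_False)
  qed
  have lim1: "(F \<longlongrightarrow> B) at_top"
  proof -
    have "LIM s at_top. \<tau> * sqrt s + \<rho> / (2 * sqrt s) :> at_top" "LIM s at_top. \<tau> * sqrt s - \<rho> / (2 * sqrt s) :> at_top"
      using \<tau> by real_asymp+
    note 1 = this[THEN filterlim_compose[OF E(3)]]
    show ?thesis unfolding F_def[abs_def] B_def using \<tau> by (intro tendsto_intros 1) auto
  qed
  have cont: "isCont f s" if "0 < s" for s
    unfolding f_def using that by (intro continuous_intros) auto
  have f0: "0 \<le> f s" if "0 < s" for s using that by (simp add: f_def)
  have c: "(0::ereal) < \<infinity>"
    "\<And>x. 0 < ereal x \<Longrightarrow> ereal x < \<infinity> \<Longrightarrow> (F has_real_derivative f x) (at x)"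
    "\<And>x. 0 < ereal x \<Longrightarrow> ereal x < \<infinity> \<Longrightarrow> isCont f x"
    "AE x in lborel. 0 < ereal x \<longrightarrow> ereal x < \<infinity> \<longrightarrow> 0 \<le> f x"
    using dF cont f0 by auto
  have l0: "((F \<circ> real_of_ereal) \<longlongrightarrow> A) (at_right 0)" using lim0 by (simp add: zero_ereal_def ereal_tendsto_simps)
  have l1: "((F \<circ> real_of_ereal) \<longlongrightarrow> B) (at_left \<infinity>)" using lim1 by (simp add: ereal_tendsto_simps)
  \<comment> \<open>For a nonnegative integrand the fundamental theorem yields integrability along
    with the value.\<close>
  have "set_integrable lborel (einterval 0 \<infinity>) f" "(LBINT s=0..\<infinity>. f s) = B - A"
    using interval_integral_FTC_nonneg[where F = F and f = f, OF c l0 l1] by blast+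
  moreover have "einterval 0 \<infinity> = {0<..}" by (auto simp: einterval_def)
  moreover have "B - A = sqrt pi / \<tau> * exp (- (\<tau> * \<rho>))"
  proof (cases "\<rho> = 0")
    case False
    have "(a + b) / \<tau> - (a + - b) / \<tau> = 2 * b / \<tau>" for a b :: real
      by (simp add: diff_divide_distrib[symmetric])
    from this[of "exp (\<tau> * \<rho>) * (sqrt pi / 2)" "exp (- (\<tau> * \<rho>)) * (sqrt pi / 2)"] False
    show ?thesis by (simp add: A_def B_def mult_ac)
  qed (simp add: A_def B_def)
  ultimately show "set_integrable lborel {0<..} (\<lambda>s. subordinator \<tau> \<rho> s)"
    "(LINT s:{0<..}|lborel. subordinator \<tau> \<rho> s) = sqrt pi / \<tau> * exp (- (\<tau> * \<rho>))"
    by (simp_all add: f_def[abs_def] interval_lebesgue_integral_0_infty)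
qed

text \<open>For a nonnegative family Fubini only asks that the total masses be integrable.
  Superposing Gaussians in this way gives the Poisson kernel, superposing Poisson kernels the
  resolvent kernel; each time the masses are read off from the Fourier transform at frequency
  0.\<close>

lemma
  fixes k :: "real \<Rightarrow> 'a::euclidean_space \<Rightarrow> real"
  assumes meas[measurable]: "(\<lambda>(t, x). k t x) \<in> borel_measurable (borel \<Otimes>\<^sub>M borel)"
    and nonneg: "\<And>t x. 0 \<le> k t x" and int: "\<And>t. integrable lborel (k t)"
    and tot: "integrable lborel (\<lambda>t. LINT x|lborel. k t x)"
  shows integrable_superposition: "integrable lborel (\<lambda>x. LINT t|lborel. k t x)"
    and fourier_superposition: "(LINT x|lborel. wave \<xi> x * of_real (LINT t|lborel. k t x))
      = (LINT t|lborel. LINT x|lborel. wave \<xi> x * of_real (k t x))"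
proof -
  have k: "integrable (lborel \<Otimes>\<^sub>M lborel) (\<lambda>(t, x). k t x)"
    by (rule lborel_pair.Fubini_integrable) (use nonneg int tot in auto)
  then show "integrable lborel (\<lambda>x. LINT t|lborel. k t x)"
    by (rule lborel_pair.integrable_snd)
  have "integrable (lborel \<Otimes>\<^sub>M lborel) (\<lambda>(t, x). wave \<xi> x * complex_of_real (k t x))"
    by (rule Bochner_Integration.integrable_bound[OF k]) (auto simp: norm_mult nonneg)
  then have "(LINT x|lborel. LINT t|lborel. wave \<xi> x * complex_of_real (k t x)) =
     (LINT t|lborel. LINT x|lborel. wave \<xi> x * of_real (k t x))"
    by (rule lborel_pair.Fubini_integral)
  then show "(LINT x|lborel. wave \<xi> x * of_real (LINT t|lborel. k t x))
      = (LINT t|lborel. LINT x|lborel. wave \<xi> x * of_real (k t x))"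
    by simp
qed

text \<open>The Poisson kernel of the half-space over three-dimensional space; the constant
  \<open>1 / pi^2\<close> gives it mass 1.\<close>

definition poisson_kernel :: "real \<Rightarrow> real^3 \<Rightarrow> real" where
  "poisson_kernel t x = t / (pi\<^sup>2 * (t\<^sup>2 + (norm x)\<^sup>2)\<^sup>2)"

lemma integral_times_exp:
  fixes a :: real
  assumes a: "0 < a"
  shows "(LINT s|lborel. indicator {0<..} s * (s * exp (- (a * s)))) = 1 / a\<^sup>2"
proof -
  have "1 = (LINT s|lborel. s ^ 1 * exp (- s) * indicator {0<..} s :: real)"
    using has_bochner_integral_I0i_power_exp_m[of 1] by (simp add: has_bochner_integral_iff)
  also have "\<dots> = \<bar>a\<bar> *\<^sub>R (LINT s|lborel. (0 + a * s) ^ 1 * exp (- (0 + a * s)) * indicator {0<..} (0 + a * s))"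
    by (rule lborel_integral_real_affine) (use a in auto)
  also have "(\<lambda>s. (0 + a * s) ^ 1 * exp (- (0 + a * s)) * indicator {0<..} (0 + a * s)) = (\<lambda>s. a * (indicator {0<..} s * (s * exp (- (a * s)))))"
    using a by (auto simp: indicator_def zero_less_mult_iff)
  finally have "1 = a * (a * (LINT s|lborel. indicator {0<..} s * (s * exp (- (a * s)))))"
    using a by (simp only: integral_mult_right_zero) simp
  then show ?thesis using a by (simp add: field_simps power2_eq_square)
qed

text \<open>With \<open>b = t^2 + (norm x)^2\<close>, the integral of \<open>s * exp (- b s)\<close>
  over \<open>s > 0\<close> is \<open>1 / b^2\<close>, which exhibits the kernel as a superposition
  of Gaussians. Their transforms contribute \<open>s powr (- 3/2)\<close>, which together with the
  weight \<open>s\<close> leaves the \<open>1 / sqrt s\<close> of \<open>subordinator\<close>; the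
  remaining factor \<open>t / sqrt pi\<close> cancels against
  \<open>integral_subordination\<close>.\<close>

lemma
  assumes t: "0 < t"
  shows poisson_kernel_integrable: "integrable lborel (poisson_kernel t)"
    and poisson_kernel_fourier: "(LINT x|lborel. wave \<xi> x * of_real (poisson_kernel t x)) = complex_of_real (exp (- (t * norm \<xi>)))"
proof -
  define k where "k s x = indicator {0<..} s * (t / pi\<^sup>2 * s * exp (- (s * t\<^sup>2)) * gauss s x)" for s and x :: "real^3"
  have P: "(LINT s|lborel. k s x) = poisson_kernel t x" for x
  proof -
    have pos: "0 < t\<^sup>2 + (norm x)\<^sup>2" using t by (simp add: add_pos_nonneg)
    have "(LINT s|lborel. k s x) = (LINT s|lborel. t / pi\<^sup>2 * (indicator {0<..} s * (s * exp (- ((t\<^sup>2 + (norm x)\<^sup>2) * s)))))"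
      by (intro Bochner_Integration.integral_cong refl) (simp add: k_def exp_add[symmetric] algebra_simps)
    also have "\<dots> = t / pi\<^sup>2 * (1 / (t\<^sup>2 + (norm x)\<^sup>2)\<^sup>2)"
      by (simp only: integral_mult_right_zero integral_times_exp[OF pos])
    finally show ?thesis by (simp add: poisson_kernel_def)
  qed
  have fk: "(LINT x|lborel. wave \<xi> x * complex_of_real (k s x))
     = of_real (indicator {0<..} s *\<^sub>R (subordinator t (norm \<xi>) s) * (t / sqrt pi))" for s \<xi>
  proof (cases "0 < s")
    case True
    have "(LINT x|lborel. wave \<xi> x * complex_of_real (k s x))
      = (LINT x|lborel. of_real (t / pi\<^sup>2 * s * exp (- (s * t\<^sup>2))) * (wave \<xi> x * of_real (gauss s x)))"
      using True by (intro Bochner_Integration.integral_cong refl) (simp add: k_def mult_ac)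
    also have "\<dots> = of_real (t / pi\<^sup>2 * s * exp (- (s * t\<^sup>2)) * (sqrt (pi / s) ^ 3 * exp (- (norm \<xi>)\<^sup>2 / (4 * s))))"
      by (simp only: integral_mult_right_zero gaussian_fourier[OF True] of_real_mult) simp
    also have "t / pi\<^sup>2 * s * exp (- (s * t\<^sup>2)) * (sqrt (pi / s) ^ 3 * exp (- (norm \<xi>)\<^sup>2 / (4 * s)))
       = indicator {0<..} s *\<^sub>R (subordinator t (norm \<xi>) s) * (t / sqrt pi)"
    proof -
      define u v where "u = sqrt s" and "v = sqrt pi"
      have uv: "0 < u" "0 < v" "s = u * u" "pi = v * v" using True by (auto simp: u_def v_def)
      have "s / pi\<^sup>2 * sqrt (pi / s) ^ 3 = (u * u) / (v * v)\<^sup>2 * (v / u) ^ 3"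
        using uv by (simp add: real_sqrt_divide u_def[symmetric] v_def[symmetric])
      also have "\<dots> = 1 / (u * v)"
        using uv(1,2) by (simp add: field_simps power2_eq_square power3_eq_cube)
      finally have "s / pi\<^sup>2 * sqrt (pi / s) ^ 3 = 1 / (sqrt s * sqrt pi)" by (simp add: u_def v_def)
      then have "s / pi\<^sup>2 * sqrt (pi / s) ^ 3 * y = 1 / (sqrt s * sqrt pi) * y" for y by simp
      from this[of "t * exp (- (s * t\<^sup>2)) * exp (- (norm \<xi>)\<^sup>2 / (4 * s))"] show ?thesis using True by (simp add: mult_ac)
    qed
    finally show ?thesis .
  qed (simp add: k_def)
  have int: "integrable lborel (k s)" for s
    using gaussian_integrable[where 'a="real^3", of s] by (cases "0 < s") (auto simp: k_def[abs_def])
  have nonneg: "0 \<le> k s x" for s x using t by (auto simp: k_def indicator_def)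
  have meas: "(\<lambda>(s, x). k s x) \<in> borel_measurable (borel \<Otimes>\<^sub>M borel)" unfolding k_def by measurable
  have kx: "(LINT x|lborel. k s x) = indicator {0<..} s *\<^sub>R (exp (- (s * t\<^sup>2)) * exp (- 0\<^sup>2 / (4 * s)) / sqrt s) * (t / sqrt pi)" for s
  proof -
    have "complex_of_real (LINT x|lborel. k s x) = of_real (indicator {0<..} s *\<^sub>R (exp (- (s * t\<^sup>2)) * exp (- 0\<^sup>2 / (4 * s)) / sqrt s) * (t / sqrt pi))"
      using fk[of 0 s] by simp
    then show ?thesis by (simp only: of_real_eq_iff)
  qed
  have tot: "integrable lborel (\<lambda>s. LINT x|lborel. k s x)"
    unfolding kx using set_integrable_subordination[OF t order.refl]
    unfolding set_integrable_def by (rule integrable_mult_left)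
  show "integrable lborel (poisson_kernel t)"
    using integrable_superposition[OF meas nonneg int tot] by (simp only: P[abs_def])
  have "(LINT x|lborel. wave \<xi> x * of_real (poisson_kernel t x)) =
    (LINT s|lborel. complex_of_real (indicator {0<..} s *\<^sub>R (subordinator t (norm \<xi>) s) * (t / sqrt pi)))"
    using fourier_superposition[OF meas nonneg int tot, of \<xi>] by (simp only: P fk)
  also have "\<dots> = of_real ((LINT s:{0<..}|lborel. subordinator t (norm \<xi>) s) * (t / sqrt pi))"
    by (simp only: integral_complex_of_real integral_mult_left_zero set_lebesgue_integral_def)
  also have "\<dots> = of_real (exp (- (t * norm \<xi>)))"
    using t by (subst integral_subordination[OF t]) auto
  finally show "(LINT x|lborel. wave \<xi> x * of_real (poisson_kernel t x)) = complex_of_real (exp (- (t * norm \<xi>)))" .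
qed

text \<open>The resolvent as Laplace transform of the semigroup: integrating
  \<open>exp (- t (norm \<xi> + a))\<close> over \<open>t > 0\<close> gives the symbol at the
  spectral parameter \<open>- a\<close>.\<close>

lemma
  assumes a: "0 < a"
  shows poisson_laplace_integrable: "integrable lborel (\<lambda>x. LINT t|lborel. indicator {0<..} t * (exp (- (t * a)) * poisson_kernel t x))"
    and poisson_laplace_fourier: "(LINT x|lborel. wave \<xi> x *
      of_real (LINT t|lborel. indicator {0<..} t * (exp (- (t * a)) * poisson_kernel t x))) = complex_of_real (1 / (norm \<xi> + a))"
proof -
  define k where "k t x = indicator {0<..} t * (exp (- (t * a)) * poisson_kernel t x)" for t x
  have expint: "set_integrable lborel {0<..} (\<lambda>t. exp (- (t * b)))" "(LINT t:{0<..}|lborel. exp (- (t * b))) = 1 / b" if "0 < b" for b :: real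
    using integrable_I0i_exp_mscale[OF that] LBINT_I0i_exp_mscale[OF that] by (simp_all add: interval_lebesgue_integral_0_infty)
  have fk: "(LINT x|lborel. wave \<xi> x * complex_of_real (k t x)) = of_real (indicator {0<..} t *\<^sub>R exp (- (t * (norm \<xi> + a))))" for t \<xi>
  proof (cases "0 < t")
    case True
    have "(LINT x|lborel. wave \<xi> x * complex_of_real (k t x)) =
       (LINT x|lborel. of_real (exp (- (t * a))) * (wave \<xi> x * complex_of_real (poisson_kernel t x)))"
      using True by (intro Bochner_Integration.integral_cong refl) (simp add: k_def mult_ac)
    also have "\<dots> = of_real (exp (- (t * a)) * exp (- (t * norm \<xi>)))"
      by (simp only: integral_mult_right_zero poisson_kernel_fourier[OF True] of_real_mult)
    also have "exp (- (t * a)) * exp (- (t * norm \<xi>)) = indicator {0<..} t *\<^sub>R exp (- (t * (norm \<xi> + a)))"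
      using True by (simp add: exp_add[symmetric] algebra_simps)
    finally show ?thesis .
  qed (simp add: k_def)
  have int: "integrable lborel (k t)" for t
    using poisson_kernel_integrable[of t] by (cases "0 < t") (auto simp: k_def[abs_def])
  have nonneg: "0 \<le> k t x" for t x by (auto simp: k_def indicator_def poisson_kernel_def)
  have meas: "(\<lambda>(s, x). k s x) \<in> borel_measurable (borel \<Otimes>\<^sub>M borel)" unfolding k_def poisson_kernel_def by measurable
  have kx: "(LINT x|lborel. k t x) = indicator {0<..} t *\<^sub>R exp (- (t * a))" for t
  proof -
    have "complex_of_real (LINT x|lborel. k t x) = of_real (indicator {0<..} t *\<^sub>R exp (- (t * a)))"
      using fk[of 0 t] by simp
    then show ?thesis by (simp only: of_real_eq_iff)
  qed
  have tot: "integrable lborel (\<lambda>s. LINT x|lborel. k s x)"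
    unfolding kx using expint(1)[OF a] by (simp add: set_integrable_def)
  show "integrable lborel (\<lambda>x. LINT t|lborel. indicator {0<..} t * (exp (- (t * a)) * poisson_kernel t x))"
    using integrable_superposition[OF meas nonneg int tot] by (simp only: k_def)
  have "(LINT x|lborel. wave \<xi> x * complex_of_real (LINT t|lborel. k t x)) =
    of_real (LINT t:{0<..}|lborel. exp (- (t * (norm \<xi> + a))))"
    using fourier_superposition[OF meas nonneg int tot, of \<xi>] by (simp only: fk integral_complex_of_real set_lebesgue_integral_def)
  also have "(LINT t:{0<..}|lborel. exp (- (t * (norm \<xi> + a)))) = 1 / (norm \<xi> + a)"
    using a by (intro expint(2)) (simp add: add_nonneg_pos)
  finally show "(LINT x|lborel. wave \<xi> x *
      of_real (LINT t|lborel. indicator {0<..} t * (exp (- (t * a)) * poisson_kernel t x))) = complex_of_real (1 / (norm \<xi> + a))"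
    by (simp only: k_def)
qed

section \<open>The Fourier transform of the resolvent kernel\<close>

text \<open>A real-valued copy of \<open>resolvent_profile\<close> at a real parameter, so that it
  can serve as a majorant.\<close>

definition real_profile :: "real \<Rightarrow> real \<Rightarrow> real" where
  "real_profile \<kappa> r = (LINT s:{0..}|lborel. real_integrand \<kappa> r s)"

lemma resolvent_profile_of_real: "resolvent_profile (of_real \<kappa>) r = of_real (real_profile \<kappa> r)"
  unfolding resolvent_profile_def real_profile_def set_integral_complex_of_real[symmetric]
  by (intro set_lebesgue_integral_cong) (auto simp flip: exp_of_real)

lemma measurable_resolvent_profile [measurable]: "resolvent_profile p \<in> borel_measurable borel"
  unfolding resolvent_profile_def[abs_def] set_lebesgue_integral_def by measurable

lemma measurable_real_profile [measurable]: "real_profile \<kappa> \<in> borel_measurable borel"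
  unfolding real_profile_def[abs_def] set_lebesgue_integral_def by measurable

abbreviation real_radial :: "real \<Rightarrow> real \<Rightarrow> real" where
  "real_radial \<kappa> r \<equiv> real_profile \<kappa> r / (pi\<^sup>2 * r\<^sup>2)"

text \<open>The substitution \<open>t = r s / \<kappa>\<close> turns \<open>t * \<kappa>^2\<close>
  into \<open>\<kappa> r s\<close>, and \<open>t^2 + r^2\<close> into
  \<open>r^2 (\<kappa>^2 + s^2) / \<kappa>^2\<close>, which reproduces the density of the
  profile.\<close>

lemma real_profile_eq_laplace:
  assumes \<kappa>: "0 < \<kappa>" and x: "x \<noteq> (0 :: real^3)"
  shows "real_radial \<kappa> (norm x)
      = (LINT t|lborel. indicator {0<..} t * (exp (- (t * \<kappa>\<^sup>2)) * poisson_kernel t x))"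
proof -
  define r where "r = norm x"
  have r: "0 < r" using x by (simp add: r_def)
  have "(LINT t|lborel. indicator {0<..} t * (exp (- (t * \<kappa>\<^sup>2)) * poisson_kernel t x)) = \<bar>r / \<kappa>\<bar> *\<^sub>R
     (LINT s|lborel. indicator {0<..} (0 + r / \<kappa> * s) * (exp (- ((0 + r / \<kappa> * s) * \<kappa>\<^sup>2)) * poisson_kernel (0 + r / \<kappa> * s) x))"
    by (rule lborel_integral_real_affine) (use r \<kappa> in auto)
  also have "\<dots> = (LINT s|lborel. \<bar>r / \<kappa>\<bar> *\<^sub>R
     (indicator {0<..} (0 + r / \<kappa> * s) * (exp (- ((0 + r / \<kappa> * s) * \<kappa>\<^sup>2)) * poisson_kernel (0 + r / \<kappa> * s) x)))"
    by (simp only: integral_scaleR_right)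
  also have "\<dots> = (LINT s|lborel. indicator {0..} s *\<^sub>R (real_integrand \<kappa> r s) / (pi\<^sup>2 * r\<^sup>2))"
  proof (rule Bochner_Integration.integral_cong[OF refl])
    fix s :: real
    show "\<bar>r / \<kappa>\<bar> *\<^sub>R (indicator {0<..} (0 + r / \<kappa> * s) * (exp (- ((0 + r / \<kappa> * s) * \<kappa>\<^sup>2)) * poisson_kernel (0 + r / \<kappa> * s) x))
      = indicator {0..} s *\<^sub>R (real_integrand \<kappa> r s) / (pi\<^sup>2 * r\<^sup>2)"
    \<comment> \<open>The sets \<open>{0<..}\<close> and \<open>{0..}\<close> differ only at
      \<open>s = 0\<close>, where the density on the right vanishes.\<close>
    proof (cases "0 < s")
      case True
      have pos: "0 < \<kappa>\<^sup>2 + s\<^sup>2" using \<kappa> by (simp add: add_pos_nonneg)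
      have "(r / \<kappa> * s)\<^sup>2 + r\<^sup>2 = r\<^sup>2 * (\<kappa>\<^sup>2 + s\<^sup>2) / \<kappa>\<^sup>2"
        using \<kappa> by (simp add: power_mult_distrib power_divide field_simps)
      then have "r / \<kappa> * poisson_kernel (r / \<kappa> * s) x = r / \<kappa> * ((r / \<kappa> * s) / (pi\<^sup>2 * (r\<^sup>2 * (\<kappa>\<^sup>2 + s\<^sup>2) / \<kappa>\<^sup>2)\<^sup>2))"
        by (simp add: poisson_kernel_def r_def)
      also have "\<dots> = \<kappa>\<^sup>2 * s / (\<kappa>\<^sup>2 + s\<^sup>2)\<^sup>2 / (pi\<^sup>2 * r\<^sup>2)"
      proof -
        have "r / \<kappa> * ((r / \<kappa> * s) / (pi\<^sup>2 * (r\<^sup>2 * u / \<kappa>\<^sup>2)\<^sup>2)) = \<kappa>\<^sup>2 * s / u\<^sup>2 / (pi\<^sup>2 * r\<^sup>2)" if "0 < u" for u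
          using \<kappa> r that by (simp add: power_divide power_mult_distrib field_simps) (simp add: power2_eq_square power4_eq_xxxx)
        then show ?thesis using pos .
      qed
      finally have "r / \<kappa> * poisson_kernel (r / \<kappa> * s) x = \<kappa>\<^sup>2 * s / (\<kappa>\<^sup>2 + s\<^sup>2)\<^sup>2 / (pi\<^sup>2 * r\<^sup>2)" .
      then have "e * (r / \<kappa> * poisson_kernel (r / \<kappa> * s) x) = e * (\<kappa>\<^sup>2 * s / (\<kappa>\<^sup>2 + s\<^sup>2)\<^sup>2) / (pi\<^sup>2 * r\<^sup>2)" for e
        by simp
      from this[of "exp (- (\<kappa> * (r * s)))"] show ?thesis
        using True \<kappa> r by (simp add: power2_eq_square[of \<kappa>] mult_ac)
    qed (use \<kappa> r in \<open>auto simp: indicator_def zero_less_mult_iff zero_less_divide_iff\<close>)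
  qed
  also have "\<dots> = real_radial \<kappa> r"
    unfolding real_profile_def set_lebesgue_integral_def by (rule integral_divide_zero)
  finally show ?thesis by (simp add: r_def)
qed

lemma
  assumes \<kappa>: "0 < \<kappa>"
  shows real_kernel_integrable: "integrable lborel (\<lambda>x::real^3. real_radial \<kappa> (norm x))"
    and real_kernel_fourier: "(LINT x|lborel. wave \<xi> x * of_real (real_radial \<kappa> (norm (x :: real^3))))
      = of_real (1 / (norm \<xi> + \<kappa>\<^sup>2))"
proof -
  have \<kappa>2: "0 < \<kappa>\<^sup>2" using \<kappa> by simp
  let ?P = "\<lambda>x::real^3. LINT t|lborel. indicator {0<..} t * (exp (- (t * \<kappa>\<^sup>2)) * poisson_kernel t x)"
  have ae: "AE x::real^3 in lborel. ?P x = real_radial \<kappa> (norm x)"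
    using AE_lborel_singleton[of 0] by eventually_elim (simp add: real_profile_eq_laplace[OF \<kappa>])
  have [measurable]: "?P \<in> borel_measurable borel"
    using poisson_laplace_integrable[OF \<kappa>2] borel_measurable_integrable by fastforce
  show "integrable lborel (\<lambda>x::real^3. real_radial \<kappa> (norm x))"
    using poisson_laplace_integrable[OF \<kappa>2] ae by (subst integrable_cong_AE[symmetric]) auto
  have "(LINT x|lborel. wave \<xi> x * of_real (real_radial \<kappa> (norm (x :: real^3))))
     = (LINT x|lborel. wave \<xi> x * of_real (?P x))"
    using ae by (intro integral_cong_AE) (measurable, auto)
  then show "(LINT x|lborel. wave \<xi> x * of_real (real_radial \<kappa> (norm (x :: real^3))))
      = of_real (1 / (norm \<xi> + \<kappa>\<^sup>2))"
    using poisson_laplace_fourier[OF \<kappa>2] by simp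
qed

text \<open>The majorant is the kernel at the real parameter \<open>\<kappa>\<close>, whose
  integrability comes from the Poisson kernel. It serves a whole ball of parameters, as
  differentiation under the integral requires; at \<open>r = 0\<close> both sides are 0 by division
  by 0.\<close>

lemma resolvent_kernel_dominated:
  assumes p: "0 < Re p"
  obtains C \<kappa> R where "0 < R" "0 < \<kappa>" "\<And>q. q \<in> ball p R \<Longrightarrow> 0 < Re q"
    "\<And>q r. q \<in> ball p R \<Longrightarrow> 0 \<le> r \<Longrightarrow> norm (resolvent_radial q r) \<le> C * (real_radial \<kappa> r)"
proof -
  obtain c M \<kappa> R where b: "0 < c" "0 < \<kappa>" "0 < R"
    "\<And>q. q \<in> ball p R \<Longrightarrow> \<kappa> \<le> Re q"  "\<And>q. q \<in> ball p R \<Longrightarrow> norm q \<le> M"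
    "\<And>q s. q \<in> ball p R \<Longrightarrow> c * (\<kappa>\<^sup>2 + s\<^sup>2) \<le> norm (q\<^sup>2 + (complex_of_real s)\<^sup>2)"
    by (rule right_half_plane_bound[OF p]) (rule that)
  define C where "C = M\<^sup>2 / (c\<^sup>2 * \<kappa>\<^sup>2)"
  have "norm (resolvent_radial q r) \<le> C * (real_radial \<kappa> r)"
    if q: "q \<in> ball p R" and r: "0 < r" for q r
  proof -
    have int: "set_integrable lborel {0..} (\<lambda>s. C * (real_integrand \<kappa> r s))"
      by (intro set_integrable_mult_right set_integrable_real_profile b r)
    have bound: "norm (profile_integrand q r s) \<le> C * (real_integrand \<kappa> r s)" if "0 \<le> s" for s
      unfolding C_def using r that by (intro profile_integrand_bound b q) auto
    have "norm (resolvent_profile q r) \<le> (LINT s:{0..}|lborel. C * (real_integrand \<kappa> r s))"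
      unfolding resolvent_profile_def set_lebesgue_integral_def
    proof (rule Bochner_Integration.integral_norm_bound_integral)
      show "integrable lborel (\<lambda>s. indicator {0..} s *\<^sub>R (C * (real_integrand \<kappa> r s)))"
        using int by (simp add: set_integrable_def)
      have nn: "norm (indicator {0..} s *\<^sub>R profile_integrand q r s) \<le> indicator {0..} s *\<^sub>R (C * (real_integrand \<kappa> r s))" for s
        using bound[of s] by (cases "0 \<le> s") auto
      then show "norm (indicator {0..} s *\<^sub>R profile_integrand q r s) \<le> indicator {0..} s *\<^sub>R (C * (real_integrand \<kappa> r s))" for s .
      show "integrable lborel (\<lambda>s. indicator {0..} s *\<^sub>R profile_integrand q r s)"
      proof (rule Bochner_Integration.integrable_bound[OF int[unfolded set_integrable_def]])
        have *: "x \<le> norm x" for x :: real by simp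
        show "AE s in lborel. norm (indicator {0..} s *\<^sub>R profile_integrand q r s) \<le> norm (indicator {0..} s *\<^sub>R (C * (real_integrand \<kappa> r s)))"
          by (intro AE_I2 order_trans[OF nn *])
      qed measurable
    qed
    then have "norm (resolvent_profile q r) \<le> C * real_profile \<kappa> r"
      by (simp only: real_profile_def set_integral_mult_right)
    then have "norm (resolvent_profile q r) / (pi\<^sup>2 * r\<^sup>2) \<le> C * real_profile \<kappa> r / (pi\<^sup>2 * r\<^sup>2)"
      by (rule divide_right_mono) simp
    then show ?thesis by (simp add: norm_divide norm_mult norm_power)
  qed
  then have "norm (resolvent_radial q r) \<le> C * (real_radial \<kappa> r)"
    if "q \<in> ball p R" "0 \<le> r" for q r
    using that by (cases "r = 0") auto
  moreover have "0 < Re q" if "q \<in> ball p R" for q using b(2) b(4)[OF that] by linarith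
  ultimately show thesis using b(2,3) by (intro that[of R \<kappa> C])
qed

text \<open>For fixed \<open>\<xi>\<close> both sides of the transform formula are holomorphic in
  \<open>p\<close>, the left one by differentiation under the integral, and they agree for real
  \<open>p\<close>.\<close>

lemma
  assumes p: "0 < Re p"
  shows resolvent_kernel_integrable: "integrable lborel (\<lambda>x::real^3. resolvent_radial p (norm x))"
    and resolvent_kernel_fourier: "(LINT x|lborel. wave \<xi> x * (resolvent_profile p (norm (x::real^3)) / of_real (pi\<^sup>2 * (norm x)\<^sup>2)))
      = 1 / (of_real (norm \<xi>) + p\<^sup>2)"
proof -
  define F where "F q x = wave \<xi> x * (resolvent_profile q (norm (x::real^3)) / of_real (pi\<^sup>2 * (norm x)\<^sup>2))" for q x
  have normF: "norm (F q x) = norm (resolvent_profile q (norm x) / of_real (pi\<^sup>2 * (norm x)\<^sup>2))" for q x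
    unfolding F_def norm_mult by simp
  have m[measurable]: "F q \<in> borel_measurable lborel" for q unfolding F_def by measurable
  show "integrable lborel (\<lambda>x::real^3. resolvent_radial p (norm x))"
  proof -
    obtain C \<kappa> R where b: "0 < R" "0 < \<kappa>"
      "\<And>q r. q \<in> ball p R \<Longrightarrow> 0 \<le> r \<Longrightarrow> norm (resolvent_radial q r) \<le> C * (real_radial \<kappa> r)"
      by (rule resolvent_kernel_dominated[OF p]) (rule that)
    show ?thesis
    proof (rule Bochner_Integration.integrable_bound)
      show "integrable lborel (\<lambda>x::real^3. C * (real_radial \<kappa> (norm x)))"
        by (intro integrable_mult_right real_kernel_integrable b)
      show "AE x in lborel. norm (resolvent_profile p (norm x) / of_real (pi\<^sup>2 * (norm (x::real^3))\<^sup>2)) \<le> norm (C * (real_radial \<kappa> (norm x)))"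
      proof (rule AE_I2)
        fix x :: "real^3"
        have "norm (resolvent_radial p (norm x)) \<le> C * (real_radial \<kappa> (norm x))"
          by (rule b(3)) (use b(1) in auto)
        also have "\<dots> \<le> norm (C * (real_radial \<kappa> (norm x)))"
          unfolding real_norm_def by (rule abs_ge_self)
        finally show "norm (resolvent_radial p (norm x)) \<le> norm (C * (real_radial \<kappa> (norm x)))" .
      qed
    qed measurable
  qed
  have "(LINT x|lborel. F p x) = 1 / (of_real (norm \<xi>) + p\<^sup>2)"
  proof (rule half_plane_identity[where f = "\<lambda>p. LINT x|lborel. F p x" and h = "\<lambda>p. 1 / (of_real (norm \<xi>) + p\<^sup>2)", OF _ _ _ p])
    show "(\<lambda>p. LINT x|lborel. F p x) holomorphic_on {p. 0 < Re p}"
    proof (rule holomorphic_onI)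
      fix p assume "p \<in> {p. 0 < Re p}"
      then have p: "0 < Re p" by simp
      obtain C \<kappa> R where b: "0 < R" "0 < \<kappa>" "\<And>q. q \<in> ball p R \<Longrightarrow> 0 < Re q"
        "\<And>q r. q \<in> ball p R \<Longrightarrow> 0 \<le> r \<Longrightarrow> norm (resolvent_radial q r) \<le> C * (real_radial \<kappa> r)"
        by (rule resolvent_kernel_dominated[OF p]) (rule that)
      have "((\<lambda>q. LINT x|lborel. F q x) has_field_derivative (LINT x|lborel. deriv (\<lambda>q. F q x) p)) (at p)"
      proof (rule has_field_derivative_integral[OF b(1)])
        show "integrable lborel (\<lambda>x::real^3. C * (real_radial \<kappa> (norm x)))"
          by (intro integrable_mult_right real_kernel_integrable b)
        show "norm (F q x) \<le> C * (real_radial \<kappa> (norm x))" if "q \<in> ball p R" for q x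
          unfolding normF by (rule b(4)[OF that]) simp
        show "(\<lambda>q. F q x) holomorphic_on ball p R" for x
        proof (cases "x = 0")
          case False
          have "(\<lambda>q. resolvent_profile q (norm x)) holomorphic_on ball p R"
            by (rule holomorphic_on_subset[OF holomorphic_resolvent_profile]) (use False b(3) in auto)
          then show ?thesis unfolding F_def using False by (intro holomorphic_intros) auto
        qed (simp add: F_def)
      qed (rule m)
      then show "(\<lambda>p. LINT x|lborel. F p x) field_differentiable at p within {p. 0 < Re p}"
        unfolding field_differentiable_def using has_field_derivative_at_within by blast
    qed
    \<comment> \<open>\<open>norm \<xi>\<close> is the square of the real number
      \<open>sqrt (norm \<xi>)\<close>, so this is the nonvanishing of
      \<open>p^2 + s^2\<close>.\<close>
    have nz: "of_real (norm \<xi>) + p\<^sup>2 \<noteq> 0" if "0 < Re p" for p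
      using sq_plus_sq_nonzero[OF that, of "sqrt (norm \<xi>)"] by (simp add: add.commute flip: of_real_power)
    then show "(\<lambda>p. 1 / (of_real (norm \<xi>) + p\<^sup>2)) holomorphic_on {p. 0 < Re p}"
      by (intro holomorphic_intros) auto
    show "(LINT x|lborel. F (of_real \<kappa>) x) = 1 / (of_real (norm \<xi>) + (of_real \<kappa>)\<^sup>2)" if "0 < \<kappa>" for \<kappa> :: real
      using real_kernel_fourier[OF that, of \<xi>] by (simp add: F_def resolvent_profile_of_real)
  qed
  then show "(LINT x|lborel. wave \<xi> x * (resolvent_profile p (norm (x::real^3)) / of_real (pi\<^sup>2 * (norm x)\<^sup>2)))
      = 1 / (of_real (norm \<xi>) + p\<^sup>2)"
    by (simp add: F_def)
qed

text \<open>The principal root of \<open>- z\<close> has nonnegative real part. If that part were 0,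
  then \<open>z\<close> would be the square of the imaginary part, hence a point of the
  spectrum.\<close>

lemma sqrt_in_right_half_plane:
  assumes "z \<notin> complex_of_real ` {0..}"
  obtains p where "0 < Re p" "z = - (p\<^sup>2)"
proof
  show z: "z = - ((csqrt (- z))\<^sup>2)" by simp
  have "Re (csqrt (- z)) \<noteq> 0"
  proof
    assume "Re (csqrt (- z)) = 0"
    then have "csqrt (- z) = \<i> * of_real (Im (csqrt (- z)))" by (simp add: complex_eq_iff)
    then have "(csqrt (- z))\<^sup>2 = (\<i> * of_real (Im (csqrt (- z))))\<^sup>2" by (rule arg_cong)
    then have "z = of_real ((Im (csqrt (- z)))\<^sup>2)" by (simp add: power_mult_distrib)
    then show False using assms by (metis atLeast_iff image_eqI zero_le_power2)
  qed
  moreover have "0 \<le> Re (csqrt (- z))" using csqrt_principal[of "- z"] by auto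
  ultimately show "0 < Re (csqrt (- z))" by simp
qed

lemma
  assumes z: "z \<notin> complex_of_real ` {0..}"
  shows g_integrable: "integrable lborel (g z)"
    and g_fourier: "(LINT x|lborel. wave \<xi> x * g z x) = 1 / (of_real (norm \<xi>) - z)"
proof -
  obtain p where p: "0 < Re p" "z = - (p\<^sup>2)" using sqrt_in_right_half_plane[OF z] .
  have eq: "g z = (\<lambda>x. resolvent_radial p (norm x))"
    using g_eq_resolvent_profile[OF p(1)] by (auto simp: p(2))
  show "integrable lborel (g z)" unfolding eq by (rule resolvent_kernel_integrable[OF p(1)])
  show "(LINT x|lborel. wave \<xi> x * g z x) = 1 / (of_real (norm \<xi>) - z)"
    unfolding eq using resolvent_kernel_fourier[OF p(1)] by (simp add: p(2))
qed

section \<open>Convolution and the Plancherel inequality\<close>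

lemma
  fixes f :: "'a::euclidean_space \<Rightarrow> 'b::{banach,second_countable_topology}"
  assumes c: "c \<noteq> 0"
  shows lborel_integral_affine: "integrable lborel f \<Longrightarrow> (LINT x|lborel. f x) = \<bar>c\<bar> ^ DIM('a) *\<^sub>R (LINT x|lborel. f (t + c *\<^sub>R x))"
    and lborel_integrable_affine: "integrable lborel f \<Longrightarrow> integrable lborel (\<lambda>x. f (t + c *\<^sub>R x))"
proof -
  assume f: "integrable lborel f"
  then have m[measurable]: "f \<in> borel_measurable borel" by (auto dest: borel_measurable_integrable)
  have eq: "lborel = density (distr lborel borel (\<lambda>x::'a. t + c *\<^sub>R x)) (\<lambda>_. \<bar>c\<bar>^DIM('a))"
    by (rule lborel_affine[OF c])
  have int: "integrable (density (distr lborel borel (\<lambda>x::'a. t + c *\<^sub>R x)) (\<lambda>_. \<bar>c\<bar>^DIM('a))) f"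
    using f eq by simp
  then have "integrable (distr lborel borel (\<lambda>x::'a. t + c *\<^sub>R x)) (\<lambda>x. \<bar>c\<bar>^DIM('a) *\<^sub>R f x)"
    by (subst (asm) integrable_density) auto
  then have "integrable lborel (\<lambda>x. \<bar>c\<bar>^DIM('a) *\<^sub>R f (t + c *\<^sub>R x))"
    by (subst (asm) integrable_distr_eq) auto
  then have "integrable lborel (\<lambda>x. inverse (\<bar>c\<bar>^DIM('a)) *\<^sub>R (\<bar>c\<bar>^DIM('a) *\<^sub>R f (t + c *\<^sub>R x)))"
    by (rule integrable_scaleR_right)
  then show "integrable lborel (\<lambda>x. f (t + c *\<^sub>R x))" using c by simp
  have "(LINT x|lborel. f x) = integral\<^sup>L (density (distr lborel borel (\<lambda>x::'a. t + c *\<^sub>R x)) (\<lambda>_. \<bar>c\<bar>^DIM('a))) f"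
    using eq by simp
  also have "\<dots> = integral\<^sup>L (distr lborel borel (\<lambda>x::'a. t + c *\<^sub>R x)) (\<lambda>x. \<bar>c\<bar>^DIM('a) *\<^sub>R f x)"
    by (rule integral_density) auto
  also have "\<dots> = (LINT x|lborel. \<bar>c\<bar>^DIM('a) *\<^sub>R f (t + c *\<^sub>R x))"
    by (rule integral_distr) auto
  finally show "(LINT x|lborel. f x) = \<bar>c\<bar> ^ DIM('a) *\<^sub>R (LINT x|lborel. f (t + c *\<^sub>R x))" by simp
qed

lemma nn_integral_lborel_translate:
  fixes f :: "'a::euclidean_space \<Rightarrow> ennreal"
  assumes [measurable]: "f \<in> borel_measurable borel"
  shows "(\<integral>\<^sup>+x. f (x - t) \<partial>lborel) = (\<integral>\<^sup>+x. f x \<partial>lborel)"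
    and "(\<integral>\<^sup>+x. f (t - x) \<partial>lborel) = (\<integral>\<^sup>+x. f x \<partial>lborel)"
proof -
  have *: "(\<integral>\<^sup>+x. f x \<partial>lborel) = (\<integral>\<^sup>+x. f (t + c *\<^sub>R x) \<partial>lborel)" if "\<bar>c\<bar> = 1" for c t
  proof -
    have "c \<noteq> 0" using that by auto
    then have "(\<integral>\<^sup>+x. f x \<partial>lborel) = (\<integral>\<^sup>+x. f x \<partial>density (distr lborel borel (\<lambda>x::'a. t + c *\<^sub>R x)) (\<lambda>_. \<bar>c\<bar>^DIM('a)))"
      using lborel_affine[of c t] by simp
    also have "\<dots> = (\<integral>\<^sup>+x. f (t + c *\<^sub>R x) \<partial>lborel)"
      by (simp add: that nn_integral_density nn_integral_distr)
    finally show ?thesis .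
  qed
  show "(\<integral>\<^sup>+x. f (x - t) \<partial>lborel) = (\<integral>\<^sup>+x. f x \<partial>lborel)" using *[of 1 "- t"] by simp
  show "(\<integral>\<^sup>+x. f (t - x) \<partial>lborel) = (\<integral>\<^sup>+x. f x \<partial>lborel)" using *[of "- 1" t] by simp
qed

lemma integrable_convolution_kernel:
  fixes k u :: "'a::euclidean_space \<Rightarrow> complex"
  assumes k: "integrable lborel k" and u: "integrable lborel u"
  shows "integrable (lborel \<Otimes>\<^sub>M lborel) (\<lambda>(y, x). k (x - y) * u y)"
proof (rule lborel_pair.Fubini_integrable)
  have [measurable]: "k \<in> borel_measurable borel" "u \<in> borel_measurable borel"
    using k u by (auto dest: borel_measurable_integrable)
  show "(\<lambda>(y, x). k (x - y) * u y) \<in> borel_measurable (lborel \<Otimes>\<^sub>M lborel)" by measurable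
  have kt: "integrable lborel (\<lambda>x. k (x - y))" for y
    using lborel_integrable_affine[of 1 k "- y"] k by simp
  then show "AE y in lborel. integrable lborel (\<lambda>x. case (y, x) of (y, x) \<Rightarrow> k (x - y) * u y)"
    by simp
  have "(LINT x|lborel. norm (k (x - y))) = (LINT x|lborel. norm (k x))" for y
    using lborel_integral_affine[of 1 "\<lambda>x. norm (k x)" "- y"] k by simp
  then show "integrable lborel (\<lambda>y. LINT x|lborel. norm (case (y, x) of (y, x) \<Rightarrow> k (x - y) * u y))"
    using u by (simp add: norm_mult)
qed

lemma
  fixes k u :: "'a::euclidean_space \<Rightarrow> complex"
  assumes k: "integrable lborel k" and u: "integrable lborel u"
  shows integrable_convolution: "integrable lborel (\<lambda>x. LINT y|lborel. k (x - y) * u y)"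
    and fourier_convolution: "(LINT x|lborel. wave \<xi> x * (LINT y|lborel. k (x - y) * u y))
       = (LINT x|lborel. wave \<xi> x * k x) * (LINT x|lborel. wave \<xi> x * u x)"
proof -
  have [measurable]: "k \<in> borel_measurable borel" "u \<in> borel_measurable borel"
    using k u by (auto dest: borel_measurable_integrable)
  let ?e = "\<lambda>x. wave \<xi> x"
  note ku = integrable_convolution_kernel[OF k u]
  show "integrable lborel (\<lambda>x. LINT y|lborel. k (x - y) * u y)"
    by (rule lborel_pair.integrable_snd[OF ku])
  have eku: "integrable (lborel \<Otimes>\<^sub>M lborel) (\<lambda>(y, x). ?e x * (k (x - y) * u y))"
    by (rule Bochner_Integration.integrable_bound[OF ku]) (auto simp: norm_mult)
  have "(LINT x|lborel. ?e x * (LINT y|lborel. k (x - y) * u y)) = (LINT x|lborel. LINT y|lborel. ?e x * (k (x - y) * u y))"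
    by simp
  also have "\<dots> = (LINT y|lborel. LINT x|lborel. ?e x * (k (x - y) * u y))"
    by (rule lborel_pair.Fubini_integral[OF eku])
  also have "\<dots> = (LINT y|lborel. (LINT x|lborel. ?e x * k x) * (?e y * u y))"
  proof (rule Bochner_Integration.integral_cong[OF refl])
    fix y
    have ek: "integrable lborel (\<lambda>x. ?e x * k x)"
      by (rule Bochner_Integration.integrable_bound[OF k]) (auto simp: norm_mult)
    have "(LINT x|lborel. ?e x * k x) = (LINT x|lborel. ?e (- y + 1 *\<^sub>R x) * k (- y + 1 *\<^sub>R x))"
      using lborel_integral_affine[of 1 "\<lambda>x. ?e x * k x" "- y"] ek by simp
    moreover have "?e x * (k (x - y) * u y) = (?e (- y + 1 *\<^sub>R x) * k (- y + 1 *\<^sub>R x)) * (?e y * u y)" for x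
    proof -
      have "?e x = ?e (- y + 1 *\<^sub>R x) * ?e y"
        by (simp add: exp_add[symmetric] inner_diff_right inner_add_right algebra_simps)
      then show ?thesis by simp
    qed
    ultimately show "(LINT x|lborel. ?e x * (k (x - y) * u y)) = (LINT x|lborel. ?e x * k x) * (?e y * u y)"
      by (simp only: integral_mult_left_zero)
  qed
  finally show "(LINT x|lborel. ?e x * (LINT y|lborel. k (x - y) * u y)) = (LINT x|lborel. ?e x * k x) * (LINT x|lborel. ?e x * u x)"
    by (simp only: integral_mult_right_zero)
qed

text \<open>Bounding \<open>u\<close> by \<open>B\<close> leaves a reflected translate of
  \<open>k\<close>, so convergence holds at every point rather than almost everywhere, with a bound
  uniform in \<open>x\<close>.\<close>

lemma integrable_convolution_pointwise:
  fixes k u :: "'a::euclidean_space \<Rightarrow> complex"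
  assumes k: "integrable lborel k" and [measurable]: "u \<in> borel_measurable borel" and B: "\<And>y. norm (u y) \<le> B"
  shows "integrable lborel (\<lambda>y. k (x - y) * u y)"
    and "norm (LINT y|lborel. k (x - y) * u y) \<le> B * (LINT y|lborel. norm (k y))"
proof -
  have [measurable]: "k \<in> borel_measurable borel" using k by (auto dest: borel_measurable_integrable)
  have kx: "integrable lborel (\<lambda>y. k (x - y))" using lborel_integrable_affine[of "- 1" k x] k by simp
  have le: "norm (k (x - y) * u y) \<le> B * norm (k (x - y))" for y
    using B[of y] by (simp add: norm_mult mult.commute mult_right_mono)
  have Bk: "integrable lborel (\<lambda>y. B * norm (k (x - y)))" using kx by simp
  show int: "integrable lborel (\<lambda>y. k (x - y) * u y)"
    by (rule Bochner_Integration.integrable_bound[OF Bk]) (use le order_trans[OF le abs_ge_self] in auto)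
  have "norm (LINT y|lborel. k (x - y) * u y) \<le> (LINT y|lborel. B * norm (k (x - y)))"
    by (rule Bochner_Integration.integral_norm_bound_integral[OF int Bk le])
  also have "\<dots> = B * (LINT y|lborel. norm (k y))"
    using lborel_integral_affine[of "- 1" "\<lambda>y. norm (k y)" x] k by simp
  finally show "norm (LINT y|lborel. k (x - y) * u y) \<le> B * (LINT y|lborel. norm (k y))" .
qed

section \<open>The multiplication formula and the Plancherel inequality\<close>

lemma fourier_multiplication_formula:
  fixes f \<phi> :: "'a::euclidean_space \<Rightarrow> complex"
  assumes f: "integrable lborel f" and \<phi>: "integrable lborel \<phi>"
  shows "(LINT \<xi>|lborel. (LINT x|lborel. wave \<xi> x * f x) * \<phi> \<xi>)
       = (LINT x|lborel. f x * (LINT \<xi>|lborel. wave x \<xi> * \<phi> \<xi>))"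
proof -
  have [measurable]: "f \<in> borel_measurable borel" "\<phi> \<in> borel_measurable borel"
    using f \<phi> by (auto dest: borel_measurable_integrable)
  have int: "integrable (lborel \<Otimes>\<^sub>M lborel) (\<lambda>(x, \<xi>). wave \<xi> x * f x * \<phi> \<xi>)"
  proof (rule lborel_pair.Fubini_integrable)
    show "AE x in lborel. integrable lborel (\<lambda>\<xi>. case (x, \<xi>) of (x, \<xi>) \<Rightarrow> wave \<xi> x * f x * \<phi> \<xi>)"
    proof (rule AE_I2)
      fix x :: 'a
      have "integrable lborel (\<lambda>\<xi>. f x * \<phi> \<xi>)" using \<phi> by simp
      then show "integrable lborel (\<lambda>\<xi>. case (x, \<xi>) of (x, \<xi>) \<Rightarrow> wave \<xi> x * f x * \<phi> \<xi>)"
        by (rule Bochner_Integration.integrable_bound) (auto simp: norm_mult)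
    qed
    show "integrable lborel (\<lambda>x. LINT \<xi>|lborel. norm (case (x, \<xi>) of (x, \<xi>) \<Rightarrow> wave \<xi> x * f x * \<phi> \<xi>))"
      using f by (simp add: norm_mult)
  qed measurable
  have "(LINT \<xi>|lborel. (LINT x|lborel. wave \<xi> x * f x) * \<phi> \<xi>) =
     (LINT \<xi>|lborel. LINT x|lborel. wave \<xi> x * f x * \<phi> \<xi>)"
    by (simp only: integral_mult_left_zero)
  also have "\<dots> = (LINT x|lborel. LINT \<xi>|lborel. wave \<xi> x * f x * \<phi> \<xi>)"
    by (rule lborel_pair.Fubini_integral[OF int])
  also have "\<dots> = (LINT x|lborel. LINT \<xi>|lborel. f x * (wave x \<xi> * \<phi> \<xi>))"
    by (simp only: inner_commute mult_ac)
  finally show ?thesis by (simp only: integral_mult_right_zero)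
qed

lemma gaussian_modulated_fourier:
  fixes x y :: "'a::euclidean_space"
  assumes s: "0 < s"
  shows "(LINT \<xi>|lborel. wave x \<xi> * (exp (\<i> * of_real (y \<bullet> \<xi>)) * of_real (gauss s \<xi>)))
    = of_real (heat s (x - y))"
proof -
  have "(LINT \<xi>|lborel. wave x \<xi> * (exp (\<i> * of_real (y \<bullet> \<xi>)) * of_real (gauss s \<xi>)))
    = (LINT \<xi>|lborel. wave (x - y) \<xi> * of_real (gauss s \<xi>))"
    by (intro Bochner_Integration.integral_cong refl) (simp add: mult.assoc[symmetric] exp_add[symmetric] inner_diff_left algebra_simps)
  then show ?thesis by (simp only: gaussian_fourier[OF s])
qed

lemma gaussian_modulated_integrable:
  fixes y :: "'a::euclidean_space"
  assumes s: "0 < s"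
  shows "integrable lborel (\<lambda>\<xi>::'a. exp (\<i> * of_real (y \<bullet> \<xi>)) * complex_of_real (gauss s \<xi>))"
  by (rule Bochner_Integration.integrable_bound[OF gaussian_integrable[OF s]]) (auto simp: norm_mult)

lemma gaussian_mass:
  assumes s: "0 < s"
  shows "(LINT v|lborel. sqrt (pi / s) ^ DIM('a) * exp (- (norm (v::'a::euclidean_space))\<^sup>2 / (4 * s))) = (2 * pi) ^ DIM('a)"
proof -
  have s4: "0 < 1 / (4 * s)" using s by simp
  have "complex_of_real (LINT v|lborel. exp (- (1 / (4 * s)) * (norm (v::'a))\<^sup>2)) = of_real (sqrt (pi / (1 / (4 * s))) ^ DIM('a))"
    using gaussian_fourier[OF s4, of "0::'a"] by simp
  then have "(LINT v|lborel. exp (- (1 / (4 * s)) * (norm (v::'a))\<^sup>2)) = sqrt (pi / (1 / (4 * s))) ^ DIM('a)"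
    by (simp only: of_real_eq_iff)
  moreover have "sqrt (pi / s) ^ DIM('a) * sqrt (pi / (1 / (4 * s))) ^ DIM('a) = (2 * pi) ^ DIM('a)"
  proof -
    have "sqrt (pi / s) * sqrt (pi / (1 / (4 * s))) = sqrt ((2 * pi)\<^sup>2)"
      using s by (simp add: real_sqrt_mult[symmetric] power2_eq_square)
    also have "\<dots> = 2 * pi" by (rule real_sqrt_unique) auto
    finally show ?thesis by (simp only: power_mult_distrib[symmetric])
  qed
  ultimately show ?thesis by simp
qed

text \<open>The factor \<open>gauss s \<xi>\<close> makes Fubini applicable; by \<open>gaussian_mass\<close> the mass of the resulting
  Gaussian does not depend on \<open>s\<close>, so \<open>s\<close> may tend to 0.\<close>
lemma plancherel_regularized:
  fixes u :: "'a::euclidean_space \<Rightarrow> complex"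
  assumes u: "integrable lborel u" and s: "0 < s"
  defines "U \<equiv> \<lambda>\<xi>. LINT x|lborel. wave \<xi> x * u x"
  shows "(LINT \<xi>|lborel. complex_of_real ((norm (U \<xi>))\<^sup>2 * gauss s \<xi>))
     = (LINT x|lborel. LINT y|lborel. u x * cnj (u y) * of_real (heat s (x - y)))"
    and "integrable lborel (\<lambda>\<xi>. (norm (U \<xi>))\<^sup>2 * gauss s \<xi>)"
proof -
  have [measurable]: "u \<in> borel_measurable borel" using u by (auto dest: borel_measurable_integrable)
  \<comment> \<open>\<open>U * \<phi>\<close> is the regularised square of the modulus of
    \<open>U\<close>. The multiplication formula moves the transform from \<open>u\<close> to
    \<open>\<phi>\<close>, and a second use of it evaluates the transform of
    \<open>\<phi>\<close>.\<close>
  define \<phi> where "\<phi> \<xi> = cnj (U \<xi>) * of_real (gauss s \<xi>)" for \<xi>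
  have mU[measurable]: "U \<in> borel_measurable borel" unfolding U_def by measurable
  have [measurable]: "cnj \<in> borel_measurable borel"
    by (intro borel_measurable_continuous_onI continuous_intros)
  have bU: "norm (U \<xi>) \<le> (LINT x|lborel. norm (u x))" for \<xi>
  proof -
    have "integrable lborel (\<lambda>x. wave \<xi> x * u x)"
      by (rule Bochner_Integration.integrable_bound[OF u]) (auto simp: norm_mult)
    then have "norm (U \<xi>) \<le> (LINT x|lborel. norm (wave \<xi> x * u x))"
      unfolding U_def by (intro integral_norm_bound)
    then show ?thesis by (simp add: norm_mult)
  qed
  let ?I = "LINT x|lborel. norm (u x)"
  have I: "0 \<le> ?I" by simp
  have gi: "integrable lborel (\<lambda>\<xi>::'a. gauss s \<xi>)" by (rule gaussian_integrable[OF s])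
  have \<phi>: "integrable lborel \<phi>"
  proof (rule Bochner_Integration.integrable_bound)
    show "integrable lborel (\<lambda>\<xi>::'a. ?I * gauss s \<xi>)" using gi by (rule integrable_mult_right)
    show "AE \<xi> in lborel. norm (\<phi> \<xi>) \<le> norm (?I * gauss s \<xi>)"
      using bU I by (intro AE_I2) (simp add: \<phi>_def norm_mult mult_right_mono)
  qed (unfold \<phi>_def[abs_def], measurable)
  show "integrable lborel (\<lambda>\<xi>. (norm (U \<xi>))\<^sup>2 * gauss s \<xi>)"
  proof (rule Bochner_Integration.integrable_bound)
    show "integrable lborel (\<lambda>\<xi>::'a. ?I\<^sup>2 * gauss s \<xi>)" using gi by (rule integrable_mult_right)
    show "AE \<xi> in lborel. norm ((norm (U \<xi>))\<^sup>2 * gauss s \<xi>) \<le> norm (?I\<^sup>2 * gauss s \<xi>)"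
      using bU I by (intro AE_I2) (simp add: mult_right_mono power_mono)
  qed simp
  have inner: "(LINT \<xi>|lborel. wave x \<xi> * \<phi> \<xi>) =
      (LINT y|lborel. cnj (u y) * of_real (heat s (x - y)))" for x
  proof -
    \<comment> \<open>The transform of \<open>w\<close> is the conjugate of \<open>U\<close>; the
      reflection compensates for conjugating the exponential.\<close>
    define w where "w y = cnj (u (- y))" for y
    define \<psi> where "\<psi> \<xi> = exp (\<i> * of_real ((- x) \<bullet> \<xi>)) * complex_of_real (gauss s \<xi>)" for \<xi>
    have un: "integrable lborel (\<lambda>y. u (- y))" using lborel_integrable_affine[of "- 1" u 0] u by simp
    then have w: "integrable lborel w" unfolding w_def by simp
    have \<psi>: "integrable lborel \<psi>" unfolding \<psi>_def by (rule gaussian_modulated_integrable[OF s])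
    have refl: "(LINT y|lborel. h y) = (LINT y|lborel. h (- y))" if "integrable lborel h" for h :: "'a \<Rightarrow> complex"
      using lborel_integral_affine[of "- 1" h 0] that by simp
    have Uw: "cnj (U \<xi>) = (LINT y|lborel. wave \<xi> y * w y)" for \<xi>
    proof -
      have ei: "integrable lborel (\<lambda>x. wave \<xi> x * u x)"
        by (rule Bochner_Integration.integrable_bound[OF u]) (auto simp: norm_mult)
      have "cnj (U \<xi>) = cnj (LINT x|lborel. wave \<xi> (- x) * u (- x))"
        unfolding U_def by (subst refl[OF ei]) simp
      also have "\<dots> = (LINT x|lborel. cnj (wave \<xi> (- x) * u (- x)))"
        by (rule Bochner_Integration.integral_cnj[symmetric])
      finally show ?thesis by (simp add: w_def exp_cnj)
    qed
    have "(LINT \<xi>|lborel. wave x \<xi> * \<phi> \<xi>) = (LINT \<xi>|lborel. (LINT y|lborel. wave \<xi> y * w y) * \<psi> \<xi>)"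
      unfolding \<phi>_def \<psi>_def Uw by (simp add: mult_ac)
    also have "\<dots> = (LINT y|lborel. w y * (LINT \<xi>|lborel. wave y \<xi> * \<psi> \<xi>))"
      by (rule fourier_multiplication_formula[OF w \<psi>])
    also have "\<dots> = (LINT y|lborel. w y * of_real (sqrt (pi / s) ^ DIM('a) * exp (- (norm (y - (- x)))\<^sup>2 / (4 * s))))"
      unfolding \<psi>_def gaussian_modulated_fourier[OF s] ..
    also have "\<dots> = (LINT y|lborel. w (- y) * of_real (sqrt (pi / s) ^ DIM('a) * exp (- (norm (- y - (- x)))\<^sup>2 / (4 * s))))"
    proof (rule refl)
      show "integrable lborel (\<lambda>y. w y * of_real (sqrt (pi / s) ^ DIM('a) * exp (- (norm (y - (- x)))\<^sup>2 / (4 * s))))"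
      proof (rule Bochner_Integration.integrable_bound)
        show "integrable lborel (\<lambda>y. of_real (sqrt (pi / s) ^ DIM('a)) * w y)" using w by (rule integrable_mult_right)
        have "norm (w y) * ((sqrt (pi / s)) ^ DIM('a) * exp (- (norm (y + x))\<^sup>2 / (4 * s))) \<le> norm (w y) * ((sqrt (pi / s)) ^ DIM('a) * 1)" for y
          using s by (intro mult_left_mono) (auto intro!: mult_nonneg_nonneg)
        then show "AE y in lborel. norm (w y * of_real (sqrt (pi / s) ^ DIM('a) * exp (- (norm (y - (- x)))\<^sup>2 / (4 * s)))) \<le> norm (of_real (sqrt (pi / s) ^ DIM('a)) * w y)"
          using s by (intro AE_I2) (simp add: norm_mult norm_power mult_ac)
      qed (simp add: w_def)
    qed
    also have "\<dots> = (LINT y|lborel. cnj (u y) * of_real (heat s (x - y)))"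
      by (simp add: w_def norm_minus_commute)
    finally show ?thesis .
  qed
  have "(LINT \<xi>|lborel. complex_of_real ((norm (U \<xi>))\<^sup>2 * gauss s \<xi>)) = (LINT \<xi>|lborel. U \<xi> * \<phi> \<xi>)"
    by (intro Bochner_Integration.integral_cong refl) (simp only: \<phi>_def of_real_mult mult.assoc[symmetric] complex_norm_square)
  also have "\<dots> = (LINT x|lborel. u x * (LINT \<xi>|lborel. wave x \<xi> * \<phi> \<xi>))"
    unfolding U_def by (rule fourier_multiplication_formula[OF u \<phi>])
  also have "\<dots> = (LINT x|lborel. LINT y|lborel. u x * cnj (u y) * of_real (heat s (x - y)))"
    unfolding inner by (simp only: integral_mult_right_zero mult.assoc)
  finally show "(LINT \<xi>|lborel. complex_of_real ((norm (U \<xi>))\<^sup>2 * gauss s \<xi>))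
     = (LINT x|lborel. LINT y|lborel. u x * cnj (u y) * of_real (heat s (x - y)))" .
qed

text \<open>A non-integrable \<open>f\<close> has integral 0, so the bound holds in that case as
  well. Iterated integrals can therefore be estimated from the outside inwards.\<close>

lemma norm_integral_le_nn_integral:
  fixes f :: "'a \<Rightarrow> 'b::{banach,second_countable_topology}"
  shows "ennreal (norm (LINT x|M. f x)) \<le> (\<integral>\<^sup>+x. ennreal (norm (f x)) \<partial>M)"
  by (cases "integrable M f") (auto intro: integral_norm_bound_ennreal simp: not_integrable_integral_eq)

lemma gaussian_nn_mass:
  assumes s: "0 < s"
  shows "(\<integral>\<^sup>+v. ennreal (sqrt (pi / s) ^ DIM('a) * exp (- (norm (v::'a::euclidean_space))\<^sup>2 / (4 * s))) \<partial>lborel) = ennreal ((2 * pi) ^ DIM('a))"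
proof -
  have s4: "0 < 1 / (4 * s)" using s by simp
  have "integrable lborel (\<lambda>v::'a. sqrt (pi / s) ^ DIM('a) * exp (- (1 / (4 * s)) * (norm v)\<^sup>2))"
    by (intro integrable_mult_right gaussian_integrable s4)
  then have int: "integrable lborel (\<lambda>v::'a. heat s v)" by simp
  have "0 \<le> heat s v" for v :: 'a
    using s by simp
  then show ?thesis
    using nn_integral_eq_integral[OF int] gaussian_mass[OF s, where 'a='a] by simp
qed

text \<open>In the regularised identity \<open>norm (u x) * norm (u y)\<close> is at most half the
  sum of the squares, and in each of the two terms the heat kernel integrates to
  \<open>(2 * pi) ^ DIM('a)\<close> in the free variable. The bound is independent of
  \<open>s\<close>, and Fatou's lemma removes the regularisation.\<close>

lemma plancherel_inequality:
  fixes u :: "'a::euclidean_space \<Rightarrow> complex"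
  assumes u: "integrable lborel u"
  shows "(\<integral>\<^sup>+\<xi>. ennreal ((norm (LINT x|lborel. wave \<xi> x * u x))\<^sup>2) \<partial>lborel)
     \<le> ennreal ((2 * pi) ^ DIM('a)) * (\<integral>\<^sup>+x. ennreal ((norm (u x))\<^sup>2) \<partial>lborel)"
proof -
  have [measurable]: "u \<in> borel_measurable borel" using u by (auto dest: borel_measurable_integrable)
  define U where "U \<xi> = (LINT x|lborel. wave \<xi> x * u x)" for \<xi>
  have mU[measurable]: "U \<in> borel_measurable borel" unfolding U_def by measurable
  define C where "C = ennreal ((2 * pi) ^ DIM('a)) * (\<integral>\<^sup>+x. ennreal ((norm (u x))\<^sup>2) \<partial>lborel)"
  have reg: "(\<integral>\<^sup>+\<xi>. ennreal ((norm (U \<xi>))\<^sup>2 * gauss s \<xi>) \<partial>lborel) \<le> C" if s: "0 < s" for s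
  proof -
    define \<gamma> where "\<gamma> v = heat s v" for v :: 'a
    have \<gamma>0: "0 \<le> \<gamma> v" for v using s by (simp add: \<gamma>_def)
    have m\<gamma>[measurable]: "\<gamma> \<in> borel_measurable borel" unfolding \<gamma>_def by measurable
    have mass: "(\<integral>\<^sup>+v. ennreal (\<gamma> v) \<partial>lborel) = ennreal ((2 * pi) ^ DIM('a))"
      unfolding \<gamma>_def by (rule gaussian_nn_mass[OF s])
    let ?N = "\<lambda>x. ennreal ((norm (u x))\<^sup>2)"
    have "(\<integral>\<^sup>+\<xi>. ennreal ((norm (U \<xi>))\<^sup>2 * gauss s \<xi>) \<partial>lborel) =
        ennreal (LINT \<xi>|lborel. (norm (U \<xi>))\<^sup>2 * gauss s \<xi>)"
      using plancherel_regularized(2)[OF u s] unfolding U_def by (intro nn_integral_eq_integral) auto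
    also have "\<dots> = ennreal (norm (LINT \<xi>|lborel. complex_of_real ((norm (U \<xi>))\<^sup>2 * gauss s \<xi>)))"
      unfolding integral_complex_of_real norm_of_real by (subst abs_of_nonneg) (auto intro!: Bochner_Integration.integral_nonneg)
    also have "\<dots> = ennreal (norm (LINT x|lborel. LINT y|lborel. u x * cnj (u y) * of_real (\<gamma> (x - y))))"
      unfolding U_def \<gamma>_def plancherel_regularized(1)[OF u s] ..
    also have "\<dots> \<le> (\<integral>\<^sup>+x. ennreal (norm (LINT y|lborel. u x * cnj (u y) * of_real (\<gamma> (x - y)))) \<partial>lborel)"
      by (rule norm_integral_le_nn_integral)
    also have "\<dots> \<le> (\<integral>\<^sup>+x. (\<integral>\<^sup>+y. ennreal (norm (u x * cnj (u y) * of_real (\<gamma> (x - y)))) \<partial>lborel) \<partial>lborel)"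
      by (intro nn_integral_mono norm_integral_le_nn_integral)
    also have "\<dots> \<le> (\<integral>\<^sup>+x. (\<integral>\<^sup>+y. (ennreal (1/2) * (?N x * ennreal (\<gamma> (x - y))) + ennreal (1/2) * (?N y * ennreal (\<gamma> (x - y)))) \<partial>lborel) \<partial>lborel)"
    proof (intro nn_integral_mono)
      fix x y :: 'a
      have "2 * norm (u x) * norm (u y) \<le> (norm (u x))\<^sup>2 + (norm (u y))\<^sup>2" by (rule sum_squares_bound)
      then have "norm (u x) * norm (u y) * \<gamma> (x - y) \<le> (1/2 * (norm (u x))\<^sup>2 + 1/2 * (norm (u y))\<^sup>2) * \<gamma> (x - y)"
        using \<gamma>0 by (intro mult_right_mono) auto
      then have "norm (u x * cnj (u y) * of_real (\<gamma> (x - y))) \<le> 1/2 * ((norm (u x))\<^sup>2 * \<gamma> (x - y)) + 1/2 * ((norm (u y))\<^sup>2 * \<gamma> (x - y))"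
        using \<gamma>0[of "x - y"] by (simp add: norm_mult distrib_right)
      then have "ennreal (norm (u x * cnj (u y) * of_real (\<gamma> (x - y)))) \<le> ennreal (1/2 * ((norm (u x))\<^sup>2 * \<gamma> (x - y)) + 1/2 * ((norm (u y))\<^sup>2 * \<gamma> (x - y)))"
        by (rule ennreal_leI)
      also have "\<dots> = ennreal (1/2) * (?N x * ennreal (\<gamma> (x - y))) + ennreal (1/2) * (?N y * ennreal (\<gamma> (x - y)))"
      proof -
        have "ennreal (1/2 * (p * q)) = ennreal (1/2) * (ennreal p * ennreal q)" if "0 \<le> p" "0 \<le> q" for p q
          using that by (simp only: ennreal_mult mult_nonneg_nonneg zero_le_divide_1_iff zero_le_numeral)
        then show ?thesis using \<gamma>0[of "x - y"] by (subst ennreal_plus) (simp_all only: mult_nonneg_nonneg zero_le_power2 zero_le_divide_1_iff zero_le_numeral)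
      qed
      finally show "ennreal (norm (u x * cnj (u y) * of_real (\<gamma> (x - y)))) \<le> ennreal (1/2) * (?N x * ennreal (\<gamma> (x - y))) + ennreal (1/2) * (?N y * ennreal (\<gamma> (x - y)))" .
    qed
    also have "\<dots> = ennreal (1/2) * (\<integral>\<^sup>+x. (\<integral>\<^sup>+y. ?N x * ennreal (\<gamma> (x - y)) \<partial>lborel) \<partial>lborel)
        + ennreal (1/2) * (\<integral>\<^sup>+x. (\<integral>\<^sup>+y. ?N y * ennreal (\<gamma> (x - y)) \<partial>lborel) \<partial>lborel)"
      by (simp add: nn_integral_add nn_integral_cmult)
    also have "(\<integral>\<^sup>+x. (\<integral>\<^sup>+y. ?N y * ennreal (\<gamma> (x - y)) \<partial>lborel) \<partial>lborel) = (\<integral>\<^sup>+y. (\<integral>\<^sup>+x. ?N y * ennreal (\<gamma> (x - y)) \<partial>lborel) \<partial>lborel)"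
      by (rule lborel_pair.Fubini'[symmetric, of "\<lambda>x y. ?N y * ennreal (\<gamma> (x - y))"]) measurable
    also have "(\<integral>\<^sup>+y. (\<integral>\<^sup>+x. ?N y * ennreal (\<gamma> (x - y)) \<partial>lborel) \<partial>lborel) = C"
      using nn_integral_lborel_translate(1)[of "\<lambda>x. ennreal (\<gamma> x)"]
      by (simp add: nn_integral_cmult nn_integral_multc mass C_def mult.commute)
    also have "(\<integral>\<^sup>+x. (\<integral>\<^sup>+y. ?N x * ennreal (\<gamma> (x - y)) \<partial>lborel) \<partial>lborel) = C"
      using nn_integral_lborel_translate(2)[of "\<lambda>x. ennreal (\<gamma> x)"]
      by (simp add: nn_integral_cmult nn_integral_multc mass C_def mult.commute)
    also have "ennreal (1/2) * C + ennreal (1/2) * C = C"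
    proof -
      have "ennreal (1/2) + ennreal (1/2) = 1" by (subst ennreal_plus[symmetric]) auto
      then show ?thesis by (simp only: distrib_right[symmetric] mult_1)
    qed
    finally show ?thesis .
  qed
  have "(\<integral>\<^sup>+\<xi>. ennreal ((norm (U \<xi>))\<^sup>2) \<partial>lborel) =
      (\<integral>\<^sup>+\<xi>. liminf (\<lambda>n. ennreal ((norm (U \<xi>))\<^sup>2 * exp (- inverse (real (Suc n)) * (norm \<xi>)\<^sup>2))) \<partial>lborel)"
  proof (rule nn_integral_cong)
    fix \<xi> :: 'a
    have "(\<lambda>n. (norm (U \<xi>))\<^sup>2 * exp (- inverse (real (Suc n)) * (norm \<xi>)\<^sup>2)) \<longlonglongrightarrow> (norm (U \<xi>))\<^sup>2 * gauss 0 \<xi>"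
      by (intro tendsto_intros LIMSEQ_inverse_real_of_nat)
    then have "(\<lambda>n. ennreal ((norm (U \<xi>))\<^sup>2 * exp (- inverse (real (Suc n)) * (norm \<xi>)\<^sup>2))) \<longlonglongrightarrow> ennreal ((norm (U \<xi>))\<^sup>2)"
      by (intro tendsto_ennrealI) simp
    then show "ennreal ((norm (U \<xi>))\<^sup>2) = liminf (\<lambda>n. ennreal ((norm (U \<xi>))\<^sup>2 * exp (- inverse (real (Suc n)) * (norm \<xi>)\<^sup>2)))"
      by (intro lim_imp_Liminf[symmetric]) auto
  qed
  also have "\<dots> \<le> liminf (\<lambda>n. (\<integral>\<^sup>+\<xi>. ennreal ((norm (U \<xi>))\<^sup>2 * exp (- inverse (real (Suc n)) * (norm \<xi>)\<^sup>2)) \<partial>lborel))"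
    by (rule nn_integral_liminf) measurable
  also have "\<dots> \<le> C"
    by (rule order_trans[OF Liminf_le_Limsup Limsup_bounded]) (simp, intro always_eventually allI reg, simp)
  finally show ?thesis by (simp add: U_def C_def)
qed

section \<open>Gaussian averages determine an integrable function\<close>

lemma integral_mult_continuous_eq_0:
  fixes \<kappa> :: "'a::euclidean_space \<Rightarrow> complex"
  assumes \<kappa>: "integrable lborel \<kappa>"
    and gauss: "\<And>a y. 0 < a \<Longrightarrow> (LINT x|lborel. \<kappa> x * of_real (gauss a (x - y))) = 0"
    and \<psi>: "continuous_on UNIV \<psi>" and bd: "\<And>x. \<bar>\<psi> x\<bar> \<le> (1::real)"
  shows "(LINT x|lborel. \<kappa> x * of_real (\<psi> x)) = 0"
proof -
  have [measurable]: "\<kappa> \<in> borel_measurable borel" using \<kappa> by (auto dest: borel_measurable_integrable)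
  have [measurable]: "\<psi> \<in> borel_measurable borel" using \<psi> by (rule borel_measurable_continuous_onI)
  \<comment> \<open>The average of \<open>\<psi>\<close> against a Gaussian of width
    \<open>\<delta>\<close>. Being a superposition of translated Gaussians, it integrates to 0
    against \<open>\<kappa>\<close>; as \<open>\<delta>\<close> tends to 0 it converges boundedly to
    \<open>m * \<psi>\<close>.\<close>
  define H where "H \<delta> x = (LINT t|lborel. \<psi> (x + \<delta> *\<^sub>R t) * gauss 1 t)" for \<delta> x
  define m where "m = (LINT t|lborel. exp (- 1 * (norm (t::'a))\<^sup>2))"
  have g1: "integrable lborel (\<lambda>t::'a. gauss 1 t)" by (rule gaussian_integrable) simp
  have m: "m \<noteq> 0"
  proof -
    have "complex_of_real m = of_real (sqrt (pi / 1) ^ DIM('a))"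
      using gaussian_fourier[of 1 "0::'a"] unfolding m_def by simp
    then show ?thesis by (simp only: of_real_eq_iff) simp
  qed
  have gb: "norm (\<psi> z * gauss a v) \<le> gauss a v" for z v :: 'a and a
    using bd[of z] by (simp add: abs_mult mult_left_le_one_le)
  have Hm[measurable]: "H \<delta> \<in> borel_measurable borel" for \<delta> unfolding H_def by measurable
  have Hi: "integrable lborel (\<lambda>t. \<psi> (x + \<delta> *\<^sub>R t) * gauss 1 t)" for x \<delta>
    by (rule Bochner_Integration.integrable_bound[OF g1]) (use gb[where a=1] in auto)
  have Hb: "\<bar>H \<delta> x\<bar> \<le> m" for \<delta> x
    using Bochner_Integration.integral_norm_bound_integral[OF Hi[of x \<delta>] g1 gb] by (simp add: H_def m_def)
  have zero: "(LINT x|lborel. \<kappa> x * of_real (H \<delta> x)) = 0" if \<delta>: "0 < \<delta>" for \<delta>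
  proof -
    \<comment> \<open>The substitution \<open>y = x + \<delta> t\<close> turns
      \<open>gauss 1 t\<close> into \<open>gauss a (x - y)\<close> for this value.\<close>
    define a where "a = 1 / \<delta>\<^sup>2"
    have a: "0 < a" using \<delta> by (simp add: a_def)
    have ga: "integrable lborel (\<lambda>v::'a. gauss a v)" by (rule gaussian_integrable[OF a])
    have Heq: "\<delta> ^ DIM('a) * H \<delta> x = (LINT y|lborel. \<psi> y * gauss a (x - y))" for x
    proof -
      have gx: "integrable lborel (\<lambda>y. gauss a (x - y))"
        using lborel_integrable_affine[of "- 1" "\<lambda>v. gauss a v" x] ga by simp
      have "integrable lborel (\<lambda>y. \<psi> y * gauss a (x - y))"
        by (rule Bochner_Integration.integrable_bound[OF gx]) (use gb[of _ a "x - _"] in auto)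
      from lborel_integral_affine[OF _ this, of \<delta> x] \<delta> show ?thesis
        by (simp add: H_def a_def power_mult_distrib)
    qed
    have "integrable (lborel \<Otimes>\<^sub>M lborel) (\<lambda>(y, x). complex_of_real (gauss a (x - y)) * \<kappa> y)"
      using integrable_convolution_kernel[of "\<lambda>v. complex_of_real (gauss a v)" \<kappa>] ga \<kappa> by simp
    then have int: "integrable (lborel \<Otimes>\<^sub>M lborel) (\<lambda>(x, y). \<kappa> x * of_real (\<psi> y * gauss a (x - y)))"
    proof (rule Bochner_Integration.integrable_bound)
      have "norm (\<kappa> x * of_real (\<psi> y * gauss a (x - y))) \<le> norm (complex_of_real (gauss a (y - x)) * \<kappa> x)" for x y
        using mult_left_mono[OF gb[of y a "x - y"], of "norm (\<kappa> x)"] unfolding norm_mult norm_of_real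
        by (simp add: norm_minus_commute mult_ac abs_mult)
      then show "AE z in lborel \<Otimes>\<^sub>M lborel. norm (case z of (x, y) \<Rightarrow> \<kappa> x * of_real (\<psi> y * gauss a (x - y)))
          \<le> norm (case z of (y, x) \<Rightarrow> complex_of_real (gauss a (x - y)) * \<kappa> y)"
        by (intro AE_I2) (auto split: prod.split)
    qed measurable
    have "of_real (\<delta> ^ DIM('a)) * (LINT x|lborel. \<kappa> x * of_real (H \<delta> x)) = (LINT x|lborel. \<kappa> x * of_real (\<delta> ^ DIM('a) * H \<delta> x))"
      by (simp only: integral_mult_right_zero[symmetric] of_real_mult mult_ac)
    also have "\<dots> = (LINT x|lborel. LINT y|lborel. \<kappa> x * of_real (\<psi> y * gauss a (x - y)))"
      unfolding Heq by (simp only: integral_mult_right_zero integral_complex_of_real)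
    also have "\<dots> = (LINT y|lborel. LINT x|lborel. \<kappa> x * of_real (\<psi> y * gauss a (x - y)))"
      by (rule lborel_pair.Fubini_integral[symmetric, OF int])
    also have "\<dots> = (LINT y|lborel. of_real (\<psi> y) * (LINT x|lborel. \<kappa> x * of_real (gauss a (x - y))))"
      by (simp only: integral_mult_right_zero[symmetric] of_real_mult mult_ac)
    also have "\<dots> = 0" by (simp only: gauss[OF a]) simp
    finally show ?thesis using \<delta> by simp
  qed
  define d where "d n = inverse (real (Suc n))" for n
  have "d \<longlonglongrightarrow> 0" unfolding d_def by (rule LIMSEQ_inverse_real_of_nat)
  then have d: "d \<longlonglongrightarrow> 0" "0 < d n" for n by (auto simp: d_def)
  have Hlim: "(\<lambda>n. H (d n) x) \<longlonglongrightarrow> \<psi> x * m" for x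
  proof -
    have "(\<lambda>n. H (d n) x) \<longlonglongrightarrow> (LINT t|lborel. \<psi> x * exp (- 1 * (norm (t::'a))\<^sup>2))"
      unfolding H_def
    proof (rule integral_dominated_convergence[OF _ _ g1])
      show "AE t in lborel. (\<lambda>n. \<psi> (x + d n *\<^sub>R t) * gauss 1 t) \<longlonglongrightarrow> \<psi> x * gauss 1 t"
      proof (rule AE_I2)
        fix t :: 'a
        have "(\<lambda>n. x + d n *\<^sub>R t) \<longlonglongrightarrow> x + 0 *\<^sub>R t" by (intro tendsto_intros d)
        then have "(\<lambda>n. \<psi> (x + d n *\<^sub>R t)) \<longlonglongrightarrow> \<psi> x"
          using \<psi> by (intro continuous_on_tendsto_compose[OF \<psi>]) auto
        then show "(\<lambda>n. \<psi> (x + d n *\<^sub>R t) * gauss 1 t) \<longlonglongrightarrow> \<psi> x * gauss 1 t"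
          by (intro tendsto_intros)
      qed
      show "AE t in lborel. norm (\<psi> (x + d n *\<^sub>R t) * gauss 1 t) \<le> gauss 1 t" for n
        by (intro AE_I2 gb)
    qed measurable
    then show ?thesis by (simp add: m_def)
  qed
  have "(\<lambda>n. LINT x|lborel. \<kappa> x * of_real (H (d n) x)) \<longlonglongrightarrow> (LINT x|lborel. \<kappa> x * of_real (\<psi> x * m))"
  proof (rule integral_dominated_convergence)
    show "integrable lborel (\<lambda>x. norm (\<kappa> x) * m)" using \<kappa> by simp
    show "AE x in lborel. (\<lambda>n. \<kappa> x * of_real (H (d n) x)) \<longlonglongrightarrow> \<kappa> x * of_real (\<psi> x * m)"
      by (intro AE_I2 tendsto_intros Hlim)
    show "AE x in lborel. norm (\<kappa> x * of_real (H (d n) x)) \<le> norm (\<kappa> x) * m" for n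
      unfolding norm_mult norm_of_real by (intro AE_I2 mult_left_mono Hb) auto
  qed measurable
  then have "(\<lambda>n. 0) \<longlonglongrightarrow> (LINT x|lborel. \<kappa> x * of_real (\<psi> x * m))" using zero[OF d(2)] by simp
  then have "(LINT x|lborel. \<kappa> x * of_real (\<psi> x * m)) = 0" by (simp add: LIMSEQ_const_iff)
  moreover have "(LINT x|lborel. \<kappa> x * of_real (\<psi> x * m)) = (LINT x|lborel. \<kappa> x * of_real (\<psi> x)) * of_real m"
    by (simp only: of_real_mult mult.assoc[symmetric] integral_mult_left_zero)
  ultimately show ?thesis using m by simp
qed

text \<open>Indicators of closed sets are bounded limits of continuous functions, so
  \<open>\<kappa>\<close> integrates to 0 over closed sets. These are stable under intersection and
  generate the Borel sets, which extends the claim to all of them and makes the density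
  vanish.\<close>

lemma AE_eq_0_of_integral_continuous:
  fixes \<kappa> :: "'a::euclidean_space \<Rightarrow> complex"
  assumes \<kappa>: "integrable lborel \<kappa>"
    and test: "\<And>\<psi>. continuous_on UNIV \<psi> \<Longrightarrow> (\<And>x. \<bar>\<psi> x\<bar> \<le> (1::real)) \<Longrightarrow> (LINT x|lborel. \<kappa> x * of_real (\<psi> x)) = 0"
  shows "AE x in lborel. \<kappa> x = 0"
proof -
  have [measurable]: "\<kappa> \<in> borel_measurable borel" using \<kappa> by (auto dest: borel_measurable_integrable)
  have int: "set_integrable lborel A \<kappa>" if "A \<in> sets borel" for A
    unfolding set_integrable_def using \<kappa> that by (intro integrable_mult_indicator) auto
  have closed: "(LINT x:S|lborel. \<kappa> x) = 0" if S: "closed S" for S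
  proof (cases "S = {}")
    case False
    \<comment> \<open>Continuous cut-offs equal to 1 on \<open>S\<close>. At a point
      \<open>x\<close> outside they vanish once \<open>n\<close> exceeds
      \<open>1 / infdist x S\<close>, the distance being positive because \<open>S\<close> is
      closed.\<close>
    define \<psi> where "\<psi> n x = max 0 (1 - real n * infdist x S)" for n x
    have c\<psi>: "continuous_on UNIV (\<psi> n)" for n unfolding \<psi>_def by (intro continuous_intros)
    then have [measurable]: "\<psi> n \<in> borel_measurable borel" for n by (rule borel_measurable_continuous_onI)
    have z: "(LINT x|lborel. \<kappa> x * of_real (\<psi> n x)) = 0" for n
    proof (rule test[OF c\<psi>])
      show "\<bar>\<psi> n x\<bar> \<le> 1" for x by (auto simp: \<psi>_def max_def infdist_nonneg)
    qed
    have [measurable]: "S \<in> sets borel" using S by simp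
    have "(\<lambda>n. LINT x|lborel. \<kappa> x * of_real (\<psi> n x)) \<longlonglongrightarrow> (LINT x|lborel. indicator S x *\<^sub>R \<kappa> x)"
    proof (rule integral_dominated_convergence)
      show "integrable lborel (\<lambda>x. norm (\<kappa> x))" using \<kappa> by simp
      have "\<bar>\<psi> n x\<bar> \<le> 1" for n x by (auto simp: \<psi>_def max_def infdist_nonneg)
      then show "AE x in lborel. norm (\<kappa> x * of_real (\<psi> n x)) \<le> norm (\<kappa> x)" for n
        by (intro AE_I2) (simp add: norm_mult mult_left_le)
      show "AE x in lborel. (\<lambda>n. \<kappa> x * of_real (\<psi> n x)) \<longlonglongrightarrow> indicator S x *\<^sub>R \<kappa> x"
      proof (rule AE_I2)
        fix x
        show "(\<lambda>n. \<kappa> x * of_real (\<psi> n x)) \<longlonglongrightarrow> indicator S x *\<^sub>R \<kappa> x"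
        proof (cases "x \<in> S")
          case True
          then show ?thesis by (simp add: \<psi>_def)
        next
          case False
          then have "0 < infdist x S" using S \<open>S \<noteq> {}\<close> infdist_nonneg[of x S] in_closed_iff_infdist_zero by fastforce
          moreover obtain N where "1 / infdist x S < real N" using reals_Archimedean2 by blast
          ultimately have N: "1 < real N * infdist x S" by (simp add: divide_less_eq)
          have "\<psi> n x = 0" if "n \<ge> N" for n
          proof -
            have "real N * infdist x S \<le> real n * infdist x S" using that by (intro mult_right_mono infdist_nonneg) auto
            then show ?thesis using N by (simp add: \<psi>_def)
          qed
          then have "\<forall>\<^sub>F n in sequentially. 0 = \<kappa> x * of_real (\<psi> n x)" unfolding eventually_sequentially by auto
          then have "(\<lambda>n. \<kappa> x * of_real (\<psi> n x)) \<longlonglongrightarrow> 0" by (rule Lim_transform_eventually[OF tendsto_const])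
          then show ?thesis using False by simp
        qed
      qed
    qed measurable
    then show ?thesis unfolding z set_lebesgue_integral_def by (simp add: LIMSEQ_const_iff)
  qed (simp add: set_lebesgue_integral_def)
  have "(LINT x:A|lborel. \<kappa> x) = 0" if "A \<in> sets lborel" for A
  proof -
    have "Int_stable (Collect closed :: 'a set set)" "Collect closed \<subseteq> Pow (UNIV :: 'a set)"
      "A \<in> sigma_sets UNIV (Collect closed)"
      using that by (auto simp: Int_stable_def borel_eq_closed)
    then show ?thesis
    proof (induction rule: sigma_sets_induct_disjoint)
      case (compl A)
      then have A: "A \<in> sets borel" by (simp add: borel_eq_closed)
      have "(LINT x:A \<union> (UNIV - A)|lborel. \<kappa> x) = (LINT x:A|lborel. \<kappa> x) + (LINT x:(UNIV - A)|lborel. \<kappa> x)"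
        using A by (intro set_integral_Un int) auto
      then show ?case using compl closed[of UNIV] by simp
    next
      case (union A)
      then have A: "A i \<in> sets borel" for i by (auto simp: borel_eq_closed)
      have "(LINT x:(\<Union>i. A i)|lborel. \<kappa> x) = (\<Sum>i. LINT x:A i|lborel. \<kappa> x)"
        using A union(1) by (intro lebesgue_integral_countable_add int) (auto simp: disjoint_family_on_def)
      then show ?case using union by simp
    next
      case empty
      then show ?case by (simp add: set_lebesgue_integral_def)
    qed (simp_all add: closed)
  qed
  then show ?thesis by (rule sigma_finite_measure.density_zero[OF sigma_finite_lborel \<kappa>])
qed

section \<open>The Fourier transform of square-integrable functions\<close>

lemma norm_add_sq_le: "(norm (a + b))\<^sup>2 \<le> 2 * (norm a)\<^sup>2 + 2 * (norm b)\<^sup>2" for a b :: "'a::real_normed_vector"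
proof -
  have "(norm (a + b))\<^sup>2 \<le> (norm a + norm b)\<^sup>2" by (intro power_mono norm_triangle_ineq) simp
  also have "\<dots> \<le> 2 * (norm a)\<^sup>2 + 2 * (norm b)\<^sup>2"
    using sum_squares_bound[of "norm a" "norm b"] by (simp add: power2_sum)
  finally show ?thesis .
qed

lemma L2_measurable: "f \<in> L2 \<Longrightarrow> f \<in> borel_measurable borel"
  by (simp add: L2_def)

lemma L2_dominated:
  assumes "f \<in> L2" "h \<in> borel_measurable borel" "\<And>x. norm (h x) \<le> C * norm (f x)"
  shows "h \<in> L2"
proof -
  have "integrable lborel (\<lambda>x. C\<^sup>2 * (norm (f x))\<^sup>2)" using assms(1) by (simp add: L2_def)
  then have "integrable lborel (\<lambda>x. (norm (h x))\<^sup>2)"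
  proof (rule Bochner_Integration.integrable_bound)
    have "(norm (h x))\<^sup>2 \<le> (C * norm (f x))\<^sup>2" for x by (intro power_mono assms) simp
    then show "AE x in lborel. norm ((norm (h x))\<^sup>2) \<le> norm (C\<^sup>2 * (norm (f x))\<^sup>2)"
      by (intro AE_I2) (simp add: power_mult_distrib)
  qed (use assms(2) in measurable)
  then show ?thesis using assms(2) by (simp add: L2_def)
qed

lemma L2_add_scaled:
  assumes "f \<in> L2" "h \<in> L2" shows "(\<lambda>x. f x + c * h x) \<in> L2"
proof -
  have [measurable]: "f \<in> borel_measurable borel" "h \<in> borel_measurable borel" using assms by (auto simp: L2_def)
  have "integrable lborel (\<lambda>x. 2 * (norm (f x))\<^sup>2 + 2 * ((norm c)\<^sup>2 * (norm (h x))\<^sup>2))"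
    using assms by (simp add: L2_def)
  then have "integrable lborel (\<lambda>x. (norm (f x + c * h x))\<^sup>2)"
  proof (rule Bochner_Integration.integrable_bound)
    show "AE x in lborel. norm ((norm (f x + c * h x))\<^sup>2) \<le> norm (2 * (norm (f x))\<^sup>2 + 2 * ((norm c)\<^sup>2 * (norm (h x))\<^sup>2))"
      using norm_add_sq_le[of "f x" "c * h x" for x] by (intro AE_I2) (simp add: norm_mult power_mult_distrib)
  qed measurable
  then show ?thesis by (simp add: L2_def)
qed

lemma L2_mult_integrable:
  assumes "f \<in> L2" "h \<in> L2" shows "integrable lborel (\<lambda>x. f x * h x)"
proof (rule Bochner_Integration.integrable_bound)
  have [measurable]: "f \<in> borel_measurable borel" "h \<in> borel_measurable borel" using assms by (auto simp: L2_def)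
  show "(\<lambda>x. f x * h x) \<in> borel_measurable lborel" by measurable
  show "integrable lborel (\<lambda>x. (norm (f x))\<^sup>2 + (norm (h x))\<^sup>2)" using assms by (simp add: L2_def)
  have "norm (f x) * norm (h x) \<le> (norm (f x))\<^sup>2 + (norm (h x))\<^sup>2" for x
    using sum_squares_bound[of "norm (f x)" "norm (h x)"] mult_nonneg_nonneg[OF norm_ge_zero[of "f x"] norm_ge_zero[of "h x"]] by linarith
  then show "AE x in lborel. norm (f x * h x) \<le> norm ((norm (f x))\<^sup>2 + (norm (h x))\<^sup>2)"
    by (intro AE_I2) (simp add: norm_mult)
qed

lemma L2_iff_nn_integral:
  assumes "f \<in> borel_measurable borel"
  shows "f \<in> L2 \<longleftrightarrow> (\<integral>\<^sup>+x. ennreal ((norm (f x))\<^sup>2) \<partial>lborel) < \<infinity>"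
  using assms by (simp add: L2_def integrable_iff_bounded)

lemma L2_tendsto_add_scaled:
  assumes t: "L2_tendsto fs f" "L2_tendsto hs h"
    and m: "\<And>n. fs n \<in> borel_measurable borel" "\<And>n. hs n \<in> borel_measurable borel" "f \<in> borel_measurable borel" "h \<in> borel_measurable borel"
  shows "L2_tendsto (\<lambda>n x. fs n x + c * hs n x) (\<lambda>x. f x + c * h x)"
  unfolding L2_tendsto_def
proof (rule tendsto_sandwich[OF _ _ tendsto_const])
  note m[measurable]
  let ?f = "\<lambda>n. \<integral>\<^sup>+x. ennreal ((norm (fs n x - f x))\<^sup>2) \<partial>lborel"
  let ?h = "\<lambda>n. \<integral>\<^sup>+x. ennreal ((norm (hs n x - h x))\<^sup>2) \<partial>lborel"
  have "(\<integral>\<^sup>+x. ennreal ((norm (fs n x + c * hs n x - (f x + c * h x)))\<^sup>2) \<partial>lborel) \<le> 2 * ?f n + ennreal (2 * (norm c)\<^sup>2) * ?h n" for n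
  proof -
    have "(norm (fs n x + c * hs n x - (f x + c * h x)))\<^sup>2 \<le> 2 * (norm (fs n x - f x))\<^sup>2 + 2 * (norm c)\<^sup>2 * (norm (hs n x - h x))\<^sup>2" for x
    proof -
      have eq: "fs n x + c * hs n x - (f x + c * h x) = (fs n x - f x) + c * (hs n x - h x)" by (simp add: algebra_simps)
      show ?thesis unfolding eq using norm_add_sq_le[of "fs n x - f x" "c * (hs n x - h x)"]
        by (simp only: norm_mult power_mult_distrib mult.assoc)
    qed
    then have "(\<integral>\<^sup>+x. ennreal ((norm (fs n x + c * hs n x - (f x + c * h x)))\<^sup>2) \<partial>lborel)
      \<le> (\<integral>\<^sup>+x. ennreal (2 * (norm (fs n x - f x))\<^sup>2 + 2 * (norm c)\<^sup>2 * (norm (hs n x - h x))\<^sup>2) \<partial>lborel)"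
      by (intro nn_integral_mono ennreal_leI)
    also have "\<dots> = (\<integral>\<^sup>+x. 2 * ennreal ((norm (fs n x - f x))\<^sup>2) + ennreal (2 * (norm c)\<^sup>2) * ennreal ((norm (hs n x - h x))\<^sup>2) \<partial>lborel)"
      by (intro nn_integral_cong) (simp add: ennreal_mult ennreal_mult')
    also have "\<dots> = 2 * ?f n + ennreal (2 * (norm c)\<^sup>2) * ?h n"
      by (subst nn_integral_add) (auto simp: nn_integral_cmult)
    finally show ?thesis .
  qed
  then show "\<forall>\<^sub>F n in sequentially. (\<integral>\<^sup>+x. ennreal ((norm (fs n x + c * hs n x - (f x + c * h x)))\<^sup>2) \<partial>lborel) \<le> 2 * ?f n + ennreal (2 * (norm c)\<^sup>2) * ?h n"
    by simp
  have "(\<lambda>n. 2 * ?f n + ennreal (2 * (norm c)\<^sup>2) * ?h n) \<longlonglongrightarrow> 2 * 0 + ennreal (2 * (norm c)\<^sup>2) * 0"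
    using t unfolding L2_tendsto_def by (intro tendsto_add ennreal_tendsto_cmult) auto
  then show "(\<lambda>n. 2 * ?f n + ennreal (2 * (norm c)\<^sup>2) * ?h n) \<longlonglongrightarrow> 0" by simp
qed simp

text \<open>Cauchy-Schwarz in the extended nonnegative reals, where \<open>L2_tendsto\<close> lives.
  The pairing is bilinear, without conjugation, to match the multiplication formula.\<close>

lemma L2_tendsto_pairing:
  assumes t: "L2_tendsto hs h" and hs: "\<And>n. hs n \<in> L2" and h: "h \<in> L2" and \<psi>: "\<psi> \<in> L2"
  shows "(\<lambda>n. LINT x|lborel. hs n x * \<psi> x) \<longlonglongrightarrow> (LINT x|lborel. h x * \<psi> x)"
proof -
  note [measurable] = L2_measurable[OF hs] L2_measurable[OF h] L2_measurable[OF \<psi>]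
  let ?d = "\<lambda>n. \<integral>\<^sup>+x. ennreal ((norm (hs n x - h x))\<^sup>2) \<partial>lborel"
  let ?P = "\<integral>\<^sup>+x. ennreal ((norm (\<psi> x))\<^sup>2) \<partial>lborel"
  have P: "?P < \<infinity>" using \<psi> L2_iff_nn_integral by auto
  define r where "r n = (LINT x|lborel. hs n x * \<psi> x) - (LINT x|lborel. h x * \<psi> x)" for n
  have le: "(ennreal (norm (r n)))\<^sup>2 \<le> ?d n * ?P" for n
  proof -
    have "r n = (LINT x|lborel. (hs n x - h x) * \<psi> x)"
      unfolding r_def using L2_mult_integrable[OF hs \<psi>] L2_mult_integrable[OF h \<psi>]
      by (simp add: left_diff_distrib)
    then have "ennreal (norm (r n)) \<le> (\<integral>\<^sup>+x. ennreal (norm ((hs n x - h x) * \<psi> x)) \<partial>lborel)"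
      using norm_integral_le_nn_integral by simp
    also have "\<dots> = (\<integral>\<^sup>+x. ennreal (norm (hs n x - h x)) * ennreal (norm (\<psi> x)) \<partial>lborel)"
      by (simp add: norm_mult ennreal_mult)
    finally have "(ennreal (norm (r n)))\<^sup>2 \<le> (\<integral>\<^sup>+x. ennreal (norm (hs n x - h x)) * ennreal (norm (\<psi> x)) \<partial>lborel)\<^sup>2"
      by (intro power_mono) auto
    also have "\<dots> \<le> (\<integral>\<^sup>+x. (ennreal (norm (hs n x - h x)))\<^sup>2 \<partial>lborel) * (\<integral>\<^sup>+x. (ennreal (norm (\<psi> x)))\<^sup>2 \<partial>lborel)"
      by (rule Cauchy_Schwarz_nn_integral) measurable
    also have "\<dots> = ?d n * ?P" by (simp add: ennreal_power)
    finally show ?thesis .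
  qed
  have "(\<lambda>n. ?P * ?d n) \<longlonglongrightarrow> ?P * 0"
    using t P unfolding L2_tendsto_def by (intro ennreal_tendsto_cmult) auto
  then have "(\<lambda>n. ?d n * ?P) \<longlonglongrightarrow> 0" by (simp add: mult.commute)
  then have "(\<lambda>n. (ennreal (norm (r n)))\<^sup>2) \<longlonglongrightarrow> 0"
    by (rule tendsto_sandwich[OF _ _ tendsto_const, rotated 2]) (use le in auto)
  then have "(\<lambda>n. ennreal ((norm (r n))\<^sup>2)) \<longlonglongrightarrow> ennreal 0" by (simp add: ennreal_power)
  then have "(\<lambda>n. (norm (r n))\<^sup>2) \<longlonglongrightarrow> 0"
    by (subst (asm) tendsto_ennreal_iff) auto
  then have "(\<lambda>n. sqrt ((norm (r n))\<^sup>2)) \<longlonglongrightarrow> sqrt 0" by (rule tendsto_real_sqrt)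
  then have "r \<longlonglongrightarrow> 0" by (simp add: tendsto_norm_zero_iff)
  then have "(\<lambda>n. r n + (LINT x|lborel. h x * \<psi> x)) \<longlonglongrightarrow> 0 + (LINT x|lborel. h x * \<psi> x)"
    by (intro tendsto_intros)
  then show ?thesis by (simp add: r_def)
qed

lemma fourier_L1_measurable [measurable]:
  assumes [measurable]: "f \<in> borel_measurable borel"
  shows "fourier_L1 f \<in> borel_measurable borel"
  unfolding fourier_L1_def[abs_def] by measurable

lemma fourier_L1_add_scaled:
  assumes "integrable lborel f" "integrable lborel h"
  shows "fourier_L1 (\<lambda>x. f x + c * h x) \<xi> = fourier_L1 f \<xi> + c * fourier_L1 h \<xi>"
proof -
  have [measurable]: "f \<in> borel_measurable borel" "h \<in> borel_measurable borel"
    using assms by (auto dest: borel_measurable_integrable)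
  have i: "integrable lborel (\<lambda>x. wave \<xi> x * f x)" if "integrable lborel f" for f
    using borel_measurable_integrable[OF that]
    by (intro Bochner_Integration.integrable_bound[OF that]) (auto simp: norm_mult)
  have "(LINT x|lborel. wave \<xi> x * (f x + c * h x))
     = (LINT x|lborel. wave \<xi> x * f x + c * (wave \<xi> x * h x))"
    by (simp add: algebra_simps)
  also have "\<dots> = (LINT x|lborel. wave \<xi> x * f x) + c * (LINT x|lborel. wave \<xi> x * h x)"
    using i[OF assms(1)] i[OF assms(2)] by simp
  finally show ?thesis by (simp add: fourier_L1_def algebra_simps)
qed

text \<open>The normalising factor \<open>(2 * pi) powr (- 3 / 2)\<close> squares to the inverse of
  the Plancherel constant in dimension three.\<close>

lemma fourier_L1_L2_le:
  assumes "integrable lborel f"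
  shows "(\<integral>\<^sup>+\<xi>. ennreal ((norm (fourier_L1 f \<xi>))\<^sup>2) \<partial>lborel) \<le> (\<integral>\<^sup>+x. ennreal ((norm (f x))\<^sup>2) \<partial>lborel)"
proof -
  have [measurable]: "f \<in> borel_measurable borel" using assms by (auto dest: borel_measurable_integrable)
  define c where "c = (2 * pi) powr (- 3 / 2)"
  have c2: "c\<^sup>2 = inverse ((2 * pi) ^ 3)"
  proof -
    have "c\<^sup>2 = (2 * pi) powr (- 3)" by (simp add: c_def power2_eq_square powr_add[symmetric])
    also have "\<dots> = inverse ((2 * pi) powr (real 3))" by (simp add: powr_minus)
    finally show ?thesis by (subst (asm) powr_realpow) auto
  qed
  have "(\<integral>\<^sup>+\<xi>. ennreal ((norm (fourier_L1 f \<xi>))\<^sup>2) \<partial>lborel) =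
     (\<integral>\<^sup>+\<xi>. ennreal (c\<^sup>2) * ennreal ((norm (LINT x|lborel. wave \<xi> x * f x))\<^sup>2) \<partial>lborel)"
    by (intro nn_integral_cong) (simp add: fourier_L1_def c_def norm_mult power_mult_distrib ennreal_mult)
  also have "\<dots> = ennreal (c\<^sup>2) * (\<integral>\<^sup>+\<xi>. ennreal ((norm (LINT x|lborel. wave \<xi> x * f x))\<^sup>2) \<partial>lborel)"
    by (rule nn_integral_cmult) measurable
  also have "\<dots> \<le> ennreal (c\<^sup>2) * (ennreal ((2 * pi) ^ DIM(real^3)) * (\<integral>\<^sup>+x. ennreal ((norm (f x))\<^sup>2) \<partial>lborel))"
    by (intro mult_left_mono plancherel_inequality[OF assms]) auto
  also have "\<dots> = (\<integral>\<^sup>+x. ennreal ((norm (f x))\<^sup>2) \<partial>lborel)"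
    by (simp add: c2 mult.assoc[symmetric] ennreal_mult[symmetric])
  finally show ?thesis .
qed

lemma fourier_L1_in_L2:
  assumes "integrable lborel f" "f \<in> L2" shows "fourier_L1 f \<in> L2"
proof -
  have "f \<in> borel_measurable borel" using assms(2) by (simp add: L2_def)
  then show ?thesis
    using le_less_trans[OF fourier_L1_L2_le[OF assms(1)]] assms(2) L2_iff_nn_integral fourier_L1_measurable by blast
qed

lemma L2_tendsto_const: "L2_tendsto (\<lambda>_. f) f"
  by (simp add: L2_tendsto_def)

lemma fourier_L2_of_L1:
  assumes "integrable lborel f" "f \<in> L2" shows "fourier_L2 f (fourier_L1 f)"
  unfolding fourier_L2_def using assms fourier_L1_in_L2[OF assms]
  by (intro conjI exI[of _ "\<lambda>_. f"]) (auto simp: L2_tendsto_const)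

text \<open>Linearity of the graph reduces single-valuedness and injectivity to statements about
  functions vanishing almost everywhere.\<close>

lemma fourier_L2_add_scaled:
  assumes "fourier_L2 f F" "fourier_L2 h H"
  shows "fourier_L2 (\<lambda>x. f x + c * h x) (\<lambda>\<xi>. F \<xi> + c * H \<xi>)"
proof -
  from assms obtain fs hs where s: "f \<in> L2" "F \<in> L2" "h \<in> L2" "H \<in> L2"
    "\<And>n. integrable lborel (fs n)" "\<And>n. fs n \<in> L2" "L2_tendsto fs f" "L2_tendsto (\<lambda>n. fourier_L1 (fs n)) F"
    "\<And>n. integrable lborel (hs n)" "\<And>n. hs n \<in> L2" "L2_tendsto hs h" "L2_tendsto (\<lambda>n. fourier_L1 (hs n)) H"
    unfolding fourier_L2_def by blast
  note m = s(1,2,3,4,6,10)[THEN L2_measurable]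
  have "L2_tendsto (\<lambda>n x. fs n x + c * hs n x) (\<lambda>x. f x + c * h x)"
    by (intro L2_tendsto_add_scaled s m)
  moreover have "L2_tendsto (\<lambda>n \<xi>. fourier_L1 (fs n) \<xi> + c * fourier_L1 (hs n) \<xi>) (\<lambda>x. F x + c * H x)"
    by (intro L2_tendsto_add_scaled s m fourier_L1_measurable)
  moreover have "fourier_L1 (\<lambda>x. fs n x + c * hs n x) = (\<lambda>\<xi>. fourier_L1 (fs n) \<xi> + c * fourier_L1 (hs n) \<xi>)" for n
    by (rule ext) (rule fourier_L1_add_scaled[OF s(5,9)])
  ultimately show ?thesis
    unfolding fourier_L2_def using s
    by (intro conjI L2_add_scaled exI[of _ "\<lambda>n x. fs n x + c * hs n x"] allI) (auto intro!: L2_add_scaled)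
qed

lemma fourier_L2_cong_AE:
  assumes "fourier_L2 f F" "f' \<in> L2" "AE x in lborel. f' x = f x"
  shows "fourier_L2 f' F"
proof -
  have eq: "(\<integral>\<^sup>+x. ennreal ((norm (h x - f x))\<^sup>2) \<partial>lborel) = (\<integral>\<^sup>+x. ennreal ((norm (h x - f' x))\<^sup>2) \<partial>lborel)" for h :: "real^3 \<Rightarrow> complex"
    by (rule nn_integral_cong_AE) (use assms(3) in auto)
  have "L2_tendsto fs f' \<longleftrightarrow> L2_tendsto fs f" for fs by (simp add: L2_tendsto_def eq)
  with assms show ?thesis by (auto simp: fourier_L2_def)
qed

text \<open>\<open>F\<close> is close in the square mean to \<open>fourier_L1 (fs n)\<close>, whose
  norm is at most that of \<open>fs n\<close>, and the latter tends to 0.\<close>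

lemma fourier_L2_zero:
  assumes F: "fourier_L2 f F" and f: "AE x in lborel. f x = 0"
  shows "AE \<xi> in lborel. F \<xi> = 0"
proof -
  from F obtain fs where s: "F \<in> L2" "\<And>n. integrable lborel (fs n)" "\<And>n. fs n \<in> L2" "L2_tendsto fs f" "L2_tendsto (\<lambda>n. fourier_L1 (fs n)) F"
    unfolding fourier_L2_def by blast
  note [measurable] = s(1)[THEN L2_measurable] s(3)[THEN L2_measurable]
  let ?d = "\<lambda>n. \<integral>\<^sup>+\<xi>. ennreal ((norm (fourier_L1 (fs n) \<xi> - F \<xi>))\<^sup>2) \<partial>lborel"
  let ?e = "\<lambda>n. \<integral>\<^sup>+x. ennreal ((norm (fs n x - f x))\<^sup>2) \<partial>lborel"
  have "(\<integral>\<^sup>+\<xi>. ennreal ((norm (F \<xi>))\<^sup>2) \<partial>lborel) \<le> 2 * ?d n + 2 * ?e n" for n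
  proof -
    have "(norm (F \<xi>))\<^sup>2 \<le> 2 * (norm (fourier_L1 (fs n) \<xi> - F \<xi>))\<^sup>2 + 2 * (norm (fourier_L1 (fs n) \<xi>))\<^sup>2" for \<xi>
      using norm_add_sq_le[of "F \<xi> - fourier_L1 (fs n) \<xi>" "fourier_L1 (fs n) \<xi>"] by (simp add: norm_minus_commute)
    then have "(\<integral>\<^sup>+\<xi>. ennreal ((norm (F \<xi>))\<^sup>2) \<partial>lborel) \<le>
       (\<integral>\<^sup>+\<xi>. ennreal (2 * (norm (fourier_L1 (fs n) \<xi> - F \<xi>))\<^sup>2 + 2 * (norm (fourier_L1 (fs n) \<xi>))\<^sup>2) \<partial>lborel)"
      by (intro nn_integral_mono ennreal_leI)
    also have "\<dots> = (\<integral>\<^sup>+\<xi>. 2 * ennreal ((norm (fourier_L1 (fs n) \<xi> - F \<xi>))\<^sup>2) + 2 * ennreal ((norm (fourier_L1 (fs n) \<xi>))\<^sup>2) \<partial>lborel)"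
      by (intro nn_integral_cong) (simp add: ennreal_mult)
    also have "\<dots> = 2 * ?d n + 2 * (\<integral>\<^sup>+\<xi>. ennreal ((norm (fourier_L1 (fs n) \<xi>))\<^sup>2) \<partial>lborel)"
      by (subst nn_integral_add) (auto simp: nn_integral_cmult)
    also have "\<dots> \<le> 2 * ?d n + 2 * (\<integral>\<^sup>+x. ennreal ((norm (fs n x))\<^sup>2) \<partial>lborel)"
      by (intro add_left_mono mult_left_mono fourier_L1_L2_le s) auto
    \<comment> \<open>As \<open>f\<close> vanishes almost everywhere, the norm of
      \<open>fs n\<close> is its distance to \<open>f\<close>.\<close>
    also have "(\<integral>\<^sup>+x. ennreal ((norm (fs n x))\<^sup>2) \<partial>lborel) = ?e n"
      by (rule nn_integral_cong_AE) (use f in auto)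
    finally show ?thesis .
  qed
  moreover have "(\<lambda>n. 2 * ?d n + 2 * ?e n) \<longlonglongrightarrow> 2 * 0 + 2 * 0"
    using s(4,5) unfolding L2_tendsto_def by (intro tendsto_add ennreal_tendsto_cmult) auto
  ultimately have "(\<integral>\<^sup>+\<xi>. ennreal ((norm (F \<xi>))\<^sup>2) \<partial>lborel) \<le> 2 * 0 + 2 * 0"
    by (intro LIMSEQ_le_const) auto
  then have "(\<integral>\<^sup>+\<xi>. ennreal ((norm (F \<xi>))\<^sup>2) \<partial>lborel) = 0" by simp
  then have "AE \<xi> in lborel. ennreal ((norm (F \<xi>))\<^sup>2) = 0" by (subst (asm) nn_integral_0_iff_AE) auto
  then show ?thesis by (simp add: ennreal_eq_0_iff)
qed

lemma gaussian_in_L2: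
  fixes y :: "real^3"
  assumes "0 < a" shows "(\<lambda>x. complex_of_real (gauss a (x - y))) \<in> L2"
proof -
  have "integrable lborel (\<lambda>x::real^3. exp (- (2 * a) * (norm x)\<^sup>2))" using assms by (intro gaussian_integrable) simp
  from lborel_integrable_affine[OF _ this, of 1 "- y"]
  have "integrable lborel (\<lambda>x. exp (- (2 * a) * (norm (x - y))\<^sup>2))" by simp
  moreover have "(norm (complex_of_real (gauss a (x - y))))\<^sup>2 = exp (- (2 * a) * (norm (x - y))\<^sup>2)" for x
    by (simp add: power2_eq_square[of "exp _"] exp_add[symmetric])
  ultimately show ?thesis by (simp only: L2_def) simp
qed

lemma modulated_gaussian_in_L2:
  fixes y :: "real^3"
  assumes "0 < a" shows "(\<lambda>\<xi>. exp (\<i> * of_real (y \<bullet> \<xi>)) * complex_of_real (gauss a \<xi>)) \<in> L2"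
  by (rule L2_dominated[OF gaussian_in_L2[OF assms, of 0], where C = 1]) (auto simp: norm_mult)

text \<open>Pairing with modulated Gaussians shows that all Gaussian averages of \<open>f\<close> vanish. Since a product of two
  Gaussians is a Gaussian, the same holds for \<open>f\<close> times a Gaussian, which is integrable.\<close>
lemma fourier_L2_injective:
  assumes F: "fourier_L2 f F" and F0: "AE \<xi> in lborel. F \<xi> = 0"
  shows "AE x in lborel. f x = 0"
proof -
  from F obtain fs where s: "f \<in> L2" "F \<in> L2" "\<And>n. integrable lborel (fs n)" "\<And>n. fs n \<in> L2" "L2_tendsto fs f" "L2_tendsto (\<lambda>n. fourier_L1 (fs n)) F"
    unfolding fourier_L2_def by blast
  note [measurable] = s(1,2)[THEN L2_measurable] s(4)[THEN L2_measurable]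
  have test: "(LINT x|lborel. f x * of_real (gauss a (x - y))) = 0" if a: "0 < a" for a and y :: "real^3"
  proof -
    \<comment> \<open>Chosen so that \<open>4 * \<epsilon> * a = 1\<close>: the transform of
      \<open>\<phi>\<close> is then a multiple of \<open>gauss a (x - y)\<close>.\<close>
    define \<epsilon> where "\<epsilon> = 1 / (4 * a)"
    have \<epsilon>: "0 < \<epsilon>" using a by (simp add: \<epsilon>_def)
    define \<phi> where "\<phi> \<xi> = exp (\<i> * of_real (y \<bullet> \<xi>)) * complex_of_real (gauss \<epsilon> \<xi>)" for \<xi> :: "real^3"
    define K where "K = complex_of_real ((2 * pi) powr (- 3 / 2)) * of_real (sqrt (pi / \<epsilon>) ^ DIM(real^3))"
    have K: "K \<noteq> 0" using \<epsilon> by (simp add: K_def)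
    have \<phi>: "\<phi> \<in> L2" "integrable lborel \<phi>"
      unfolding \<phi>_def using modulated_gaussian_in_L2[OF \<epsilon>] gaussian_modulated_integrable[OF \<epsilon>] by auto
    have dual: "(LINT \<xi>|lborel. fourier_L1 (fs n) \<xi> * \<phi> \<xi>) = K * (LINT x|lborel. fs n x * of_real (gauss a (x - y)))" for n
    proof -
      have "(LINT \<xi>|lborel. fourier_L1 (fs n) \<xi> * \<phi> \<xi>) = of_real ((2 * pi) powr (- 3 / 2)) *
         (LINT \<xi>|lborel. (LINT x|lborel. wave \<xi> x * fs n x) * \<phi> \<xi>)"
        unfolding fourier_L1_def by (simp only: mult.assoc integral_mult_right_zero)
      also have "\<dots> = of_real ((2 * pi) powr (- 3 / 2)) * (LINT x|lborel. fs n x * (LINT \<xi>|lborel. wave x \<xi> * \<phi> \<xi>))"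
        by (simp only: fourier_multiplication_formula[OF s(3) \<phi>(2)])
      also have "(\<lambda>x. fs n x * (LINT \<xi>|lborel. wave x \<xi> * \<phi> \<xi>)) =
         (\<lambda>x. of_real (sqrt (pi / \<epsilon>) ^ DIM(real^3)) * (fs n x * of_real (gauss a (x - y))))"
        unfolding \<phi>_def gaussian_modulated_fourier[OF \<epsilon>] using a by (simp add: \<epsilon>_def mult_ac)
      finally show ?thesis by (simp only: integral_mult_right_zero K_def mult.assoc)
    qed
    have "(\<lambda>n. LINT \<xi>|lborel. fourier_L1 (fs n) \<xi> * \<phi> \<xi>) \<longlonglongrightarrow> (LINT \<xi>|lborel. F \<xi> * \<phi> \<xi>)"
      by (rule L2_tendsto_pairing[OF s(6) fourier_L1_in_L2[OF s(3,4)] s(2) \<phi>(1)])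
    moreover have "(LINT \<xi>|lborel. F \<xi> * \<phi> \<xi>) = 0"
      by (rule integral_eq_zero_AE) (use F0 in auto)
    moreover have "(\<lambda>n. K * (LINT x|lborel. fs n x * of_real (gauss a (x - y)))) \<longlonglongrightarrow>
        K * (LINT x|lborel. f x * of_real (gauss a (x - y)))"
      by (intro tendsto_mult tendsto_const L2_tendsto_pairing s gaussian_in_L2 a)
    ultimately have "K * (LINT x|lborel. f x * of_real (gauss a (x - y))) = 0"
      unfolding dual using LIMSEQ_unique by fastforce
    then show ?thesis using K by simp
  qed
  define \<kappa> where "\<kappa> x = f x * of_real (gauss 1 (x - 0))" for x
  have \<kappa>: "integrable lborel \<kappa>" unfolding \<kappa>_def by (intro L2_mult_integrable s gaussian_in_L2) simp
  have "AE x in lborel. \<kappa> x = 0"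
  proof (rule AE_eq_0_of_integral_continuous[OF \<kappa>])
    fix \<psi> :: "real^3 \<Rightarrow> real" assume \<psi>: "continuous_on UNIV \<psi>" "\<And>x. \<bar>\<psi> x\<bar> \<le> 1"
    show "(LINT x|lborel. \<kappa> x * of_real (\<psi> x)) = 0"
    proof (rule integral_mult_continuous_eq_0[OF \<kappa> _ \<psi>])
      fix a :: real and y :: "real^3" assume a: "0 < a"
      \<comment> \<open>Completing the square; the new centre is the mean of 0 and \<open>y\<close>
        with weights 1 and \<open>a\<close>.\<close>
      have sq: "(norm x)\<^sup>2 + a * (norm (x - y))\<^sup>2 = (1 + a) * (norm (x - (a / (1 + a)) *\<^sub>R y))\<^sup>2 + a / (1 + a) * (norm y)\<^sup>2" for x :: "real^3"
      proof -
        have "(1 + a) * (norm (x - b *\<^sub>R y))\<^sup>2 = (1 + a) * (norm x)\<^sup>2 - 2 * ((1 + a) * b) * (x \<bullet> y) + ((1 + a) * b) * b * (norm y)\<^sup>2" for b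
          unfolding power2_norm_eq_inner by (simp add: inner_diff_left inner_diff_right inner_commute algebra_simps)
        from this[of "a / (1 + a)"]
        have "(1 + a) * (norm (x - (a / (1 + a)) *\<^sub>R y))\<^sup>2 = (1 + a) * (norm x)\<^sup>2 - 2 * a * (x \<bullet> y) + a * (a / (1 + a)) * (norm y)\<^sup>2"
          using a by simp
        moreover have "(norm (x - y))\<^sup>2 = (norm x)\<^sup>2 - 2 * (x \<bullet> y) + (norm y)\<^sup>2"
          unfolding power2_norm_eq_inner by (simp add: inner_diff_left inner_diff_right inner_commute)
        moreover have "a * (a / (1 + a)) + a / (1 + a) = a"
        proof -
          have "a * b + b = b * (1 + a)" for b by (simp add: algebra_simps)
          from this[of "a / (1 + a)"] show ?thesis using a by simp
        qed
        moreover have "r * y = (c * y + d * y)" if "c + d = r" for c d r y :: real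
          using that by (simp add: distrib_right[symmetric])
        note this[of "a * (a / (1 + a))" "a / (1 + a)" a "(norm y)\<^sup>2"]
        ultimately show ?thesis by (simp add: distrib_left distrib_right right_diff_distrib)
      qed
      have "\<kappa> x * of_real (gauss a (x - y)) = of_real (exp (- (a / (1 + a)) * (norm y)\<^sup>2)) *
          (f x * of_real (exp (- (1 + a) * (norm (x - (a / (1 + a)) *\<^sub>R y))\<^sup>2)))" for x
      proof -
        have "gauss 1 (x - 0) * gauss a (x - y) = exp (- (a / (1 + a)) * (norm y)\<^sup>2) * exp (- (1 + a) * (norm (x - (a / (1 + a)) *\<^sub>R y))\<^sup>2)"
          unfolding exp_add[symmetric] using sq[of x] by (simp add: algebra_simps)
        then show ?thesis unfolding \<kappa>_def by (simp only: mult.assoc of_real_mult[symmetric]) (simp only: of_real_mult mult_ac)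
      qed
      then show "(LINT x|lborel. \<kappa> x * of_real (gauss a (x - y))) = 0"
        using test[of "1 + a"] a by (simp only: integral_mult_right_zero) simp
    qed
  qed
  then show ?thesis by (simp add: \<kappa>_def)
qed

section \<open>The resolvent\<close>

lemma Cc_infinity_D:
  assumes "u \<in> Cc_infinity"
  shows "integrable lborel u" "u \<in> borel_measurable borel" "u \<in> L2" "\<exists>B. \<forall>x. norm (u x) \<le> B"
proof -
  have "C_k 0 u" using assms unfolding Cc_infinity_def by blast
  then have cont: "continuous_on UNIV u" by simp
  define K where "K = closure {x. u x \<noteq> 0}"
  have K: "compact K" using assms by (simp add: Cc_infinity_def K_def)
  have contK: "continuous_on K u" using cont by (rule continuous_on_subset) simp
  have zero: "u x = 0" if "x \<notin> K" for x
    using that closure_subset[of "{x. u x \<noteq> 0}"] by (auto simp: K_def)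
  show [measurable]: "u \<in> borel_measurable borel" using cont by (rule borel_measurable_continuous_onI)
  have "(\<lambda>x. indicator K x *\<^sub>R u x) = u" using zero by (auto simp: indicator_def fun_eq_iff)
  then show int: "integrable lborel u" using borel_integrable_compact[OF K contK] by simp
  have "bounded (u ` K)" using compact_continuous_image[OF contK K] by (rule compact_imp_bounded)
  then obtain B where B: "\<And>x. x \<in> K \<Longrightarrow> norm (u x) \<le> B" by (auto simp: bounded_iff)
  have bd: "norm (u x) \<le> max B 0" for x using B[of x] zero[of x] by (cases "x \<in> K") auto
  then show "\<exists>B. \<forall>x. norm (u x) \<le> B" by blast
  have "integrable lborel (\<lambda>x. max B 0 * norm (u x))" using int by simp
  then have "integrable lborel (\<lambda>x. (norm (u x))\<^sup>2)"
  proof (rule Bochner_Integration.integrable_bound)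
    have "norm (u x) * norm (u x) \<le> max B 0 * norm (u x)" for x by (intro mult_right_mono bd) simp
    then show "AE x in lborel. norm ((norm (u x))\<^sup>2) \<le> norm (max B 0 * norm (u x))"
      by (intro AE_I2) (simp add: power2_eq_square)
  qed measurable
  then show "u \<in> L2" by (simp add: L2_def)
qed

text \<open>For moderate \<open>r\<close> the distance of \<open>z\<close> from the closed ray
  bounds the difference from below; for large \<open>r\<close> it grows like \<open>r\<close>. The
  weight is that of \<open>sobolev_H1\<close>: division by \<open>norm \<xi> - z\<close> gains one
  derivative.\<close>

lemma norm_minus_spectrum_ge:
  assumes "z \<notin> complex_of_real ` {0..}"
  obtains c where "0 < c" "\<And>r. 0 \<le> r \<Longrightarrow> c * sqrt (1 + r\<^sup>2) \<le> norm (of_real r - z)"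
proof -
  have "closed (complex_of_real ` {0..})"
  proof -
    have "complex_of_real ` {0..} = \<real> \<inter> {w. 0 \<le> Re w}"
      by (auto simp: complex_is_Real_iff complex_eq_iff image_iff)
    then show ?thesis by (simp add: closed_Int closed_halfspace_Re_ge closed_complex_Reals)
  qed
  define d where "d = infdist z (complex_of_real ` {0..})"
  have d: "0 < d"
    unfolding d_def using assms \<open>closed (complex_of_real ` {0..})\<close> infdist_pos_not_in_closed by fastforce
  have le: "d \<le> norm (of_real r - z)" if "0 \<le> r" for r
    using infdist_le[of "of_real r" "complex_of_real ` {0..}" z] that by (auto simp: d_def dist_norm norm_minus_commute)
  \<comment> \<open>Multiplying \<open>r \<le> norm z + norm (r - z)\<close> by \<open>d\<close> and
    using \<open>d \<le> norm (r - z)\<close> gives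
    \<open>d * (1 + r) \<le> (1 + norm z + d) * norm (r - z)\<close>.\<close>
  define c where "c = d / (1 + norm z + d)"
  have n: "0 < 1 + norm z + d" using d by (simp add: add_pos_pos add_pos_nonneg)
  have c: "0 < c" using d n by (simp add: c_def)
  have "c * sqrt (1 + r\<^sup>2) \<le> norm (of_real r - z)" if r: "0 \<le> r" for r
  proof -
    have "sqrt (1 + r\<^sup>2) \<le> 1 + r" using r by (intro real_le_lsqrt) (auto simp: power2_sum)
    then have "c * sqrt (1 + r\<^sup>2) \<le> c * (1 + r)" using c by (intro mult_left_mono) auto
    also have "\<dots> \<le> norm (of_real r - z)"
    proof -
      have "r \<le> norm z + norm (of_real r - z)"
        using norm_triangle_ineq[of "of_real r - z" z] r by simp
      then have "d * (1 + r) \<le> d * (1 + norm z) + d * norm (of_real r - z)"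
        using d by (simp add: distrib_left[symmetric])
      also have "d * (1 + norm z) \<le> norm (of_real r - z) * (1 + norm z)"
        using le[OF r] by (intro mult_right_mono) (auto simp: add_nonneg_nonneg)
      finally have "d * (1 + r) \<le> norm (of_real r - z) * (1 + norm z + d)" by (simp add: algebra_simps)
      then show ?thesis using n by (simp add: c_def divide_le_eq)
    qed
    finally show ?thesis .
  qed
  then show thesis using that[OF c] by blast
qed

text \<open>The normalising constant occurs once in the transform of a convolution and is absorbed
  by \<open>fourier_L1 u\<close>; the unnormalised transform of \<open>g z\<close> is the symbol of
  the resolvent itself.\<close>

lemma fourier_L1_G:
  assumes z: "z \<notin> complex_of_real ` {0..}" and u: "integrable lborel u"
  shows "integrable lborel (G z u)" "fourier_L1 (G z u) \<xi> = fourier_L1 u \<xi> / (of_real (norm \<xi>) - z)"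
  using integrable_convolution[OF g_integrable[OF z] u] fourier_convolution[OF g_integrable[OF z] u, of \<xi>]
  by (simp_all add: G_def[abs_def] fourier_L1_def g_fourier[OF z])

text \<open>A bounded integrable function is square-integrable: the square of
  \<open>norm (G z u x)\<close> is at most \<open>C * norm (G z u x)\<close>.\<close>

lemma G_in_L2:
  assumes z: "z \<notin> complex_of_real ` {0..}" and u: "integrable lborel u" and B: "\<And>x. norm (u x) \<le> B"
  shows "G z u \<in> L2"
proof -
  note int = fourier_L1_G(1)[OF z u]
  have mu: "u \<in> borel_measurable borel" using u by (auto dest: borel_measurable_integrable)
  have [measurable]: "G z u \<in> borel_measurable borel" using int by (auto dest: borel_measurable_integrable)
  define C where "C = B * (LINT y|lborel. norm (g z y))"
  have C: "norm (G z u x) \<le> C" for x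
    unfolding G_def C_def by (rule integrable_convolution_pointwise(2)[OF g_integrable[OF z] mu B])
  have "integrable lborel (\<lambda>x. C * norm (G z u x))" using int by simp
  then have "integrable lborel (\<lambda>x. (norm (G z u x))\<^sup>2)"
  proof (rule Bochner_Integration.integrable_bound)
    have "norm (G z u x) * norm (G z u x) \<le> C * norm (G z u x)" for x by (intro mult_right_mono C) simp
    then show "AE x in lborel. norm ((norm (G z u x))\<^sup>2) \<le> norm (C * norm (G z u x))"
      by (intro AE_I2) (simp add: power2_eq_square order_trans[OF _ abs_ge_self])
  qed measurable
  then show ?thesis by (simp add: L2_def)
qed

theorem theorem2p1:
  fixes z :: complex
  assumes "z \<notin> complex_of_real ` {0..}"
  shows "\<forall>u \<in> Cc_infinity.
           (\<forall>x. integrable lborel (\<lambda>y. g z (x - y) * u y)) \<and>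
           G z u \<in> L2 \<and>
           (minus_scalar H0 z)\<inverse> `` {u} = L2_class (G z u)"
proof (intro ballI conjI allI)
  note z = assms
  fix u assume u: "u \<in> Cc_infinity"
  note [measurable] = Cc_infinity_D(2)[OF u]
  note ui = Cc_infinity_D(1)[OF u]
  obtain B where B: "\<And>x. norm (u x) \<le> B" using Cc_infinity_D(4)[OF u] by blast
  show "integrable lborel (\<lambda>y. g z (x - y) * u y)" for x
    by (rule integrable_convolution_pointwise(1)[OF g_integrable[OF z] _ B]) measurable
  show GL2: "G z u \<in> L2" by (rule G_in_L2[OF z ui B])
  define U where "U = fourier_L1 u"
  have uU: "fourier_L2 u U" unfolding U_def by (rule fourier_L2_of_L1[OF ui Cc_infinity_D(3)[OF u]])
  have UL2: "U \<in> L2" using uU by (simp add: fourier_L2_def)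
  have mU[measurable]: "U \<in> borel_measurable borel" using UL2 by (rule L2_measurable)
  define V where "V \<xi> = U \<xi> / (of_real (norm \<xi>) - z)" for \<xi>
  have nz: "of_real (norm \<xi>) - z \<noteq> 0" for \<xi> :: "real^3" using z by (auto simp: image_iff)
  \<comment> \<open>The resolvent equation on the Fourier side, solved for the multiplier term: the
    right side is a linear combination of transforms already known.\<close>
  have mult: "of_real (norm \<xi>) * V \<xi> = U \<xi> + z * V \<xi>" for \<xi>
    using nz[of \<xi>] by (simp add: V_def field_simps)
  have GV: "fourier_L2 (G z u) V"
  proof -
    have "fourier_L1 (G z u) = V" by (rule ext) (simp add: V_def U_def fourier_L1_G(2)[OF z ui])
    then show ?thesis using fourier_L2_of_L1[OF fourier_L1_G(1)[OF z ui] GL2] by simp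
  qed
  show "(minus_scalar H0 z)\<inverse> `` {u} = L2_class (G z u)"
  proof (intro equalityI subsetI)
    fix v assume "v \<in> (minus_scalar H0 z)\<inverse> `` {u}"
    then obtain h F where h: "u = (\<lambda>x. h x - z * v x)" and vF: "fourier_L2 v F" and hF: "fourier_L2 h (\<lambda>\<xi>. of_real (norm \<xi>) * F \<xi>)"
      unfolding minus_scalar_def H0_def fourier_multiplier_def by auto
    \<comment> \<open>The function is identically 0 by \<open>h\<close>, so its transform vanishes
      almost everywhere. The signs are placed in the coefficients to fit the linearity rule.\<close>
    have "fourier_L2 (\<lambda>x. (h x + (- z) * v x) + (- 1) * u x) (\<lambda>\<xi>. (of_real (norm \<xi>) * F \<xi> + (- z) * F \<xi>) + (- 1) * U \<xi>)"
      by (intro fourier_L2_add_scaled hF vF uU)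
    then have "AE \<xi> in lborel. (of_real (norm \<xi>) * F \<xi> + (- z) * F \<xi>) + (- 1) * U \<xi> = 0"
      by (rule fourier_L2_zero) (simp add: h)
    then have FV: "AE \<xi> in lborel. F \<xi> + (- 1) * V \<xi> = 0"
    proof eventually_elim
      case (elim \<xi>)
      then have "(of_real (norm \<xi>) - z) * F \<xi> = U \<xi>" by (simp add: algebra_simps)
      then show ?case using nz[of \<xi>] by (simp add: V_def field_simps)
    qed
    have "fourier_L2 (\<lambda>x. v x + (- 1) * G z u x) (\<lambda>\<xi>. F \<xi> + (- 1) * V \<xi>)"
      by (intro fourier_L2_add_scaled vF GV)
    from fourier_L2_injective[OF this FV] have "AE x in lborel. v x = G z u x" by simp
    moreover have "v \<in> L2" using vF by (simp add: fourier_L2_def)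
    ultimately show "v \<in> L2_class (G z u)" by (simp add: L2_class_def)
  next
    fix v assume "v \<in> L2_class (G z u)"
    then have v: "v \<in> L2" "AE x in lborel. v x = G z u x" by (auto simp: L2_class_def)
    have vV: "fourier_L2 v V" by (rule fourier_L2_cong_AE[OF GV v])
    \<comment> \<open>The image of \<open>v\<close> under \<open>H0\<close> is taken to be
      \<open>u + z * v\<close>, so that subtracting \<open>z * v\<close> returns \<open>u\<close> as
      a function, as membership in the relational image of \<open>{u}\<close> demands.\<close>
    have "fourier_L2 (\<lambda>x. u x + z * v x) (\<lambda>\<xi>. of_real (norm \<xi>) * V \<xi>)"
      unfolding mult by (intro fourier_L2_add_scaled uU vV)
    moreover have "(\<lambda>\<xi>. of_real (sqrt (1 + (norm \<xi>)\<^sup>2)) * V \<xi>) \<in> L2"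
    proof -
      obtain c where c: "0 < c" "\<And>r. 0 \<le> r \<Longrightarrow> c * sqrt (1 + r\<^sup>2) \<le> norm (of_real r - z)"
        by (rule norm_minus_spectrum_ge[OF z]) (rule that)
      show ?thesis
      proof (rule L2_dominated[OF UL2])
        fix \<xi> :: "real^3"
        have "0 < norm (of_real (norm \<xi>) - z)" using nz[of \<xi>] by simp
        then have "sqrt (1 + (norm \<xi>)\<^sup>2) / norm (of_real (norm \<xi>) - z) \<le> 1 / c"
          using c(1) c(2)[of "norm \<xi>"] by (simp add: field_simps)
        then have "sqrt (1 + (norm \<xi>)\<^sup>2) / norm (of_real (norm \<xi>) - z) * norm (U \<xi>) \<le> 1 / c * norm (U \<xi>)"
          by (intro mult_right_mono) auto
        then show "norm (of_real (sqrt (1 + (norm \<xi>)\<^sup>2)) * V \<xi>) \<le> 1 / c * norm (U \<xi>)"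
          by (simp add: V_def norm_mult norm_divide)
      qed (unfold V_def, measurable)
    qed
    ultimately have "(v, \<lambda>x. u x + z * v x) \<in> H0"
      unfolding H0_def fourier_multiplier_def sobolev_H1_def using vV v(1) by auto
    then have "(v, \<lambda>x. (u x + z * v x) - z * v x) \<in> minus_scalar H0 z"
      unfolding minus_scalar_def by (intro CollectI exI[of _ v] exI[of _ "\<lambda>x. u x + z * v x"] conjI refl)
    then show "v \<in> (minus_scalar H0 z)\<inverse> `` {u}" by simp
  qed
qed

end
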